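(* With respect to the asymptotic topology, $\mathcal{K}^n$ (resp. $\partial\mathcal{K}^n$) admits a regularity preserving strong deformation retraction onto $\mathcal{H}^n$ (resp. $\partial\mathcal{H}^n$). Under this deformation $K\mapsto K_t$ (resp. $\partial K\mapsto\partial K_t$), $t\in[0,1]$, the total curvature of each element of $\mathcal{K}^n$ (resp. $\partial\mathcal{K}^n$) evolves monotonically in $t$, as its unit normal cone uniformly shrinks to a single vector.
   Context: A convex body $K\subset\mathbf{R}^n$ is a closed convex set with interior points; it need not be bounded. A convex hypersurface is the boundary $\partial K$ of a convex body. $\mathcal{K}^n$ is the set of unbounded convex bodies $K\subset\mathbf{R}^n$ whose boundary $\partial K$ is homeomorphic to $\mathbf{R}^{n-1}$, and $\partial\mathcal{K}^n=\{\partial K: K\in\mathcal{K}^n\}$. $\mathcal{H}^n\subset\mathcal{K}^n$ is the set of closed half-spaces whose boundary hyperplane passes through the origin $o$, and $\partial\mathcal{H}^n$ is the set of their boundaries, i.e. the Grassmannian $Gr(n-1,n)$ of hyperplanes through $o$. Recession cone: $\mathrm{rc}(K)=\{v\in\mathbf{R}^n: K+v\subset K\}$. Asymptotic topology: let $\pi:\mathbf{S}^n\setminus\{(0,\dots,0,1)\}\to\mathbf{R}^n$ be stereographic projection and $d_h$ the Hausdorff distance between subsets of $\mathbf{S}^n$. Put $d_{bh}(A,B)=d_h(\pi^{-1}(A),\pi^{-1}(B))$ (bounded-Hausdorff distance) for closed $A,B\subset\mathbf{R}^n$, and for closed convex sets put $d_a(K_0,K_1)=d_{bh}(K_0,K_1)+d_{bh}(\mathrm{rc}(K_0),\mathrm{rc}(K_1))$.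 The asymptotic topology on $\mathcal{K}^n$ is the one induced by the metric $d_a$. $\partial\mathcal{K}^n$ is topologized via the boundary map $K\mapsto\partial K$: $M_i\to M$ in $\partial\mathcal{K}^n$ provided there are $K_i,K\in\mathcal{K}^n$ with $\partial K_i=M_i$, $\partial K=M$ and $K_i\to K$ in $d_a$. A strong deformation retraction of $\mathcal{K}^n$ onto $\mathcal{H}^n$ is a continuous map $\mathcal{K}^n\times[0,1]\to\mathcal{K}^n$, $(K,t)\mapsto K_t$, with $K_0=K$ and $K_1\in\mathcal{H}^n$ for all $K$, and $K_t=K$ for all $t$ whenever $K\in\mathcal{H}^n$; similarly for $\partial\mathcal{K}^n$ and $\partial\mathcal{H}^n$. It is regularity preserving if, whenever $\partial K_0$ is of class $C^k$ with $1\le k\le\infty$ or $k=\omega$ (real analytic), $\partial K_t$ is also at least $C^k$ for all $t$. A hyperplane supports $K$ if it meets $K$ and $K$ lies on one side of it; its outward normal is the unit normal pointing into the side not containing $K$. The unit normal cone $\overline{\mathrm{nc}}(K)\subset\mathbf{S}^{n-1}$ is the set of outward unit normals of support hyperplanes of $K$. The total curvature $\tau(K)$ (also regarded as the total curvature of $\partial K$) is the $(n-1)$-dimensional Hausdorff measure of $\overline{\mathrm{nc}}(K)$. That the unit normal cone uniformly shrinks to a single vector means: $\overline{\mathrm{nc}}(K_1)=\{v\}$ for some $v\in\mathbf{S}^{n-1}$, and the Hausdorff distance between $\overline{\mathrm{nc}}(K_t)$ and $\{v\}$ tends monotonically to $0$ as $t\to1$. *)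

theory Defs
  imports "HOL-Analysis.Analysis"
begin

section \<open>Hausdorff distance and Hausdorff measure\<close>

text \<open>Only meaningful for nonempty bounded sets (and set to 0 if one of them is empty); closedness is
  not required.\<close>

definition hausdorff_dist :: "'a::metric_space set \<Rightarrow> 'a set \<Rightarrow> real" where
  "hausdorff_dist A B =
     (if A = {} \<or> B = {} then 0 else max (SUP a\<in>A. infdist a B) (SUP b\<in>B. infdist b A))"

text \<open>Covering sets have to be bounded because \<^const>\<open>diameter\<close> is unspecified on unbounded
  sets; empty ones contribute nothing, also for \<open>s = 0\<close> (where a nonempty set contributes 1).\<close>

definition hausdorff_premeasure :: "nat \<Rightarrow> real \<Rightarrow> 'a::metric_space set \<Rightarrow> ennreal" where
  "hausdorff_premeasure s \<delta> A =
     (INF C \<in> {C :: nat \<Rightarrow> 'a set. A \<subseteq> (\<Union>i. C i) \<and> (\<forall>i. bounded (C i) \<and> diameter (C i) \<le> \<delta>)}.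
        \<Sum>i. if C i = {} then 0
             else ennreal (unit_ball_vol (real s) * (diameter (C i) / 2) ^ s))"

definition hausdorff_measure :: "nat \<Rightarrow> 'a::metric_space set \<Rightarrow> ennreal" where
  "hausdorff_measure s A = (SUP \<delta>\<in>{0<..}. hausdorff_premeasure s \<delta> A)"

section \<open>Unbounded convex bodies and half-spaces\<close>

definition convex_body :: "(real^'n) set \<Rightarrow> bool" where
  "convex_body K \<longleftrightarrow> closed K \<and> convex K \<and> interior K \<noteq> {}"

definition Kn :: "(real^'n) set set" where
  "Kn = {K. convex_body K \<and> \<not> bounded K \<and>
            top_of_set (frontier K) homeomorphic_space Euclidean_space (CARD('n) - 1)}"

definition Hn :: "(real^'n) set set" where
  "Hn = {{x. u \<bullet> x \<le> 0} |u. u \<noteq> 0}"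

definition recession_cone :: "(real^'n) set \<Rightarrow> (real^'n) set" where
  "recession_cone K = {v. (\<lambda>x. x + v) ` K \<subseteq> K}"

section \<open>The asymptotic topology\<close>

text \<open>The unit sphere \<open>S\<^sup>n\<close> lives in \<open>R\<^sup>n \<times> R\<close>, whose norm is the Euclidean one, with north pole
  \<open>(0, 1)\<close>; the projection is onto the equatorial hyperplane. Distances on the sphere are
  chordal.\<close>

definition punctured_sphere :: "((real^'n) \<times> real) set" where
  "punctured_sphere = sphere 0 1 - {(0, 1)}"

definition stereo :: "(real^'n) \<times> real \<Rightarrow> real^'n" where
  "stereo p = fst p /\<^sub>R (1 - snd p)"

definition stereo_preimage :: "(real^'n) set \<Rightarrow> ((real^'n) \<times> real) set" where
  "stereo_preimage A = {p \<in> punctured_sphere. stereo p \<in> A}"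

definition dist_bh :: "(real^'n) set \<Rightarrow> (real^'n) set \<Rightarrow> real" where
  "dist_bh A B = hausdorff_dist (stereo_preimage A) (stereo_preimage B)"

definition dist_a :: "(real^'n) set \<Rightarrow> (real^'n) set \<Rightarrow> real" where
  "dist_a K L = dist_bh K L + dist_bh (recession_cone K) (recession_cone L)"

definition asymptotic_topology :: "(real^'n) set topology" where
  "asymptotic_topology = Metric_space.mtopology Kn dist_a"

text \<open>\<open>\<partial>\<K>\<^sup>n\<close> carries the finest topology in which all these sequences converge. It is the quotient
  topology of the boundary map (see the lemma below), which is not injective: a hyperplane bounds
  two half-spaces.\<close>

definition hypersurface_converges :: "(nat \<Rightarrow> (real^'n) set) \<Rightarrow> (real^'n) set \<Rightarrow> bool" where
  "hypersurface_converges M L \<longleftrightarrow>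
     (\<exists>K K\<^sub>0. (\<forall>i. K i \<in> Kn \<and> frontier (K i) = M i) \<and> K\<^sub>0 \<in> Kn \<and> frontier K\<^sub>0 = L \<and>
            limitin asymptotic_topology K K\<^sub>0 sequentially)"

definition hypersurface_topology :: "(real^'n) set topology" where
  "hypersurface_topology = topology (\<lambda>U. U \<subseteq> frontier ` Kn \<and>
     (\<forall>M L. hypersurface_converges M L \<and> L \<in> U \<longrightarrow> (\<forall>\<^sub>F i in sequentially. M i \<in> U)))"

section \<open>Regularity of hypersurfaces\<close>

text \<open>\<open>C\<^sup>k\<close> on an open set: all iterated partial derivatives up to order \<open>k\<close> exist and
  are continuous.\<close>

primrec Ck_on :: "nat \<Rightarrow> (real^'n) set \<Rightarrow> (real^'n \<Rightarrow> real) \<Rightarrow> bool" where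
  "Ck_on 0 U f \<longleftrightarrow> continuous_on U f"
| "Ck_on (Suc k) U f \<longleftrightarrow> f differentiable_on U \<and>
     (\<forall>i. Ck_on k U (\<lambda>x. frechet_derivative f (at x) (axis i 1)))"

text \<open>The index set \<open>'n \<Rightarrow> nat\<close> consists of the multi-indices.\<close>

definition real_analytic_on :: "(real^'n) set \<Rightarrow> (real^'n \<Rightarrow> real) \<Rightarrow> bool" where
  "real_analytic_on U f \<longleftrightarrow>
     (\<forall>p\<in>U. \<exists>(c :: ('n \<Rightarrow> nat) \<Rightarrow> real) r. r > 0 \<and>
        (\<forall>x\<in>ball p r. ((\<lambda>\<alpha>. c \<alpha> * (\<Prod>i\<in>UNIV. (x $ i - p $ i) ^ \<alpha> i)) has_sum f x) UNIV))"

datatype regularity = C_fin nat | C_infinity | C_omega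

fun regular_on :: "regularity \<Rightarrow> (real^'n) set \<Rightarrow> (real^'n \<Rightarrow> real) \<Rightarrow> bool" where
  "regular_on (C_fin k) U f \<longleftrightarrow> Ck_on k U f"
| "regular_on C_infinity U f \<longleftrightarrow> (\<forall>k. Ck_on k U f)"
| "regular_on C_omega U f \<longleftrightarrow> real_analytic_on U f"

text \<open>The classes \<open>C\<^sup>k\<close> with \<open>1 \<le> k \<le> \<infinity>\<close> or \<open>k = \<omega>\<close>.\<close>

definition regularity_classes :: "regularity set" where
  "regularity_classes = C_fin ` {1..} \<union> {C_infinity, C_omega}"

text \<open>Locally the zero set of a function of the given class with nonvanishing derivative, i.e. an
  embedded hypersurface of that class.\<close>

definition hypersurface_of_class :: "regularity \<Rightarrow> (real^'n) set \<Rightarrow> bool" where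
  "hypersurface_of_class r M \<longleftrightarrow>
     (\<forall>p\<in>M. \<exists>U f. open U \<and> p \<in> U \<and> regular_on r U f \<and>
        (\<forall>x\<in>U. f differentiable (at x) \<and> frechet_derivative f (at x) \<noteq> (\<lambda>_. 0)) \<and>
        M \<inter> U = {x\<in>U. f x = 0})"

section \<open>Unit normal cone and total curvature\<close>

definition unit_normal_cone :: "(real^'n) set \<Rightarrow> (real^'n) set" where
  "unit_normal_cone K =
     {u. norm u = 1 \<and> (\<exists>c. K \<inter> {x. u \<bullet> x = c} \<noteq> {} \<and> K \<subseteq> {x. u \<bullet> x \<le> c})}"

definition total_curvature :: "(real^'n) set \<Rightarrow> ennreal" where
  "total_curvature K = hausdorff_measure (CARD('n) - 1) (unit_normal_cone K)"

section \<open>Deformations\<close>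

definition strong_deformation_retraction ::
    "'a topology \<Rightarrow> 'a set \<Rightarrow> ('a \<times> real \<Rightarrow> 'a) \<Rightarrow> bool" where
  "strong_deformation_retraction X A F \<longleftrightarrow>
     A \<subseteq> topspace X \<and>
     continuous_map (prod_topology X (top_of_set {0..1})) X F \<and>
     (\<forall>x\<in>topspace X. F (x, 0) = x \<and> F (x, 1) \<in> A) \<and>
     (\<forall>x\<in>A. \<forall>t\<in>{0..1}. F (x, t) = x)"

definition regularity_preserving_bodies :: "((real^'n) set \<times> real \<Rightarrow> (real^'n) set) \<Rightarrow> bool" where
  "regularity_preserving_bodies F \<longleftrightarrow>
     (\<forall>K\<in>Kn. \<forall>r\<in>regularity_classes. hypersurface_of_class r (frontier K) \<longrightarrow>
        (\<forall>t\<in>{0..1}. hypersurface_of_class r (frontier (F (K, t)))))"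

definition regularity_preserving_hypersurfaces ::
    "((real^'n) set \<times> real \<Rightarrow> (real^'n) set) \<Rightarrow> bool" where
  "regularity_preserving_hypersurfaces G \<longleftrightarrow>
     (\<forall>M\<in>frontier ` Kn. \<forall>r\<in>regularity_classes. hypersurface_of_class r M \<longrightarrow>
        (\<forall>t\<in>{0..1}. hypersurface_of_class r (G (M, t))))"

definition normal_cone_shrinks :: "(real \<Rightarrow> (real^'n) set) \<Rightarrow> bool" where
  "normal_cone_shrinks \<gamma> \<longleftrightarrow>
     (\<exists>v. norm v = 1 \<and> unit_normal_cone (\<gamma> 1) = {v} \<and>
        antimono_on {0..1} (\<lambda>t. hausdorff_dist (unit_normal_cone (\<gamma> t)) {v}) \<and>
        ((\<lambda>t. hausdorff_dist (unit_normal_cone (\<gamma> t)) {v}) \<longlongrightarrow> 0) (at_left 1))"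

section \<open>Basic properties of the two topologies\<close>

lemma hausdorff_dist_le_iff:
  assumes "A \<noteq> {}" "B \<noteq> {}" "bounded A" "bounded B"
  shows "hausdorff_dist A B \<le> r \<longleftrightarrow> (\<forall>a\<in>A. infdist a B \<le> r) \<and> (\<forall>b\<in>B. infdist b A \<le> r)"
proof -
  have bdd: "bdd_above ((\<lambda>a. infdist a T) ` S)" if ST: "S \<noteq> {}" "T \<noteq> {}" "bounded S" "bounded T" for S T :: "'a set"
  proof -
    obtain t where t: "t \<in> T" using ST by auto
    obtain e where e: "\<forall>y\<in>S. dist t y \<le> e" using ST(3) bounded_any_center[of S t] by auto
    have "infdist s T \<le> e" if "s \<in> S" for s
      using infdist_le[OF t, of s] e that by (metis dist_commute order_trans)
    then show ?thesis by (auto intro!: bdd_aboveI)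
  qed
  show ?thesis
    using assms by (simp add: hausdorff_dist_def cSUP_le_iff bdd)
qed

lemma hausdorff_dist_nonneg:
  assumes "A \<noteq> {}" "B \<noteq> {}" "bounded A" "bounded B"
  shows "0 \<le> hausdorff_dist A B"
proof -
  obtain a where "a \<in> A" using assms(1) by blast
  then have "infdist a B \<le> hausdorff_dist A B"
    using hausdorff_dist_le_iff[OF assms, of "hausdorff_dist A B"] by blast
  then show ?thesis using infdist_nonneg[of a B] by linarith
qed

lemma hausdorff_dist_commute: "hausdorff_dist A B = hausdorff_dist B A"
  by (auto simp: hausdorff_dist_def max.commute)

lemma infdist_le_hausdorff_dist:
  assumes "A \<noteq> {}" "B \<noteq> {}" "bounded A" "bounded B" "a \<in> A"
  shows "infdist a B \<le> hausdorff_dist A B"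
  using hausdorff_dist_le_iff[OF assms(1-4)] assms(5) by blast

lemma hausdorff_dist_triangle:
  assumes "A \<noteq> {}" "B \<noteq> {}" "E \<noteq> {}" "bounded A" "bounded B" "bounded E"
  shows "hausdorff_dist A E \<le> hausdorff_dist A B + hausdorff_dist B E"
proof -
  have step: "infdist x T \<le> hausdorff_dist S B + hausdorff_dist B T"
    if S: "S \<noteq> {}" "bounded S" and T: "T \<noteq> {}" "bounded T" and x: "x \<in> S" for x S T
  proof -
    have "infdist x T - hausdorff_dist B T \<le> dist x b" if "b \<in> B" for b
      using infdist_triangle[of x T b] infdist_le_hausdorff_dist[of B T b] assms T that by simp
    then have "infdist x T - hausdorff_dist B T \<le> infdist x B"
      using assms(2) by (simp add: infdist_def cINF_greatest)
    also have "\<dots> \<le> hausdorff_dist S B"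
      using infdist_le_hausdorff_dist[of S B x] S assms x by simp
    finally show ?thesis by simp
  qed
  show ?thesis
    using step[of A E] step[of E A] assms
    by (auto simp: hausdorff_dist_le_iff hausdorff_dist_commute add.commute)
qed

lemma hausdorff_dist_self: "A \<noteq> {} \<Longrightarrow> hausdorff_dist A A = 0"
  by (simp add: hausdorff_dist_def)

lemma hausdorff_dist_0D:
  assumes "A \<noteq> {}" "B \<noteq> {}" "bounded A" "bounded B" "hausdorff_dist A B = 0"
  shows "A \<subseteq> closure B"
proof
  fix a assume "a \<in> A"
  then have "infdist a B = 0"
    using infdist_le_hausdorff_dist[OF assms(1-4), of a] assms(5) infdist_nonneg[of a B] by simp
  then show "a \<in> closure B" using assms(2) by (simp add: in_closure_iff_infdist_zero)
qed

lemma north_pole_snd: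
  assumes "p \<in> punctured_sphere" shows "snd p \<noteq> 1"
proof
  assume 1: "snd p = 1"
  have "(norm (fst p))\<^sup>2 + (snd p)\<^sup>2 = 1"
    using assms by (cases p) (auto simp: punctured_sphere_def norm_Pair)
  then have "fst p = 0" using 1 by simp
  then show False using assms 1 by (cases p) (auto simp: punctured_sphere_def)
qed

lemma stereo_surj: "\<exists>p\<in>punctured_sphere. stereo p = x"
proof -
  define d where "d = (norm x)\<^sup>2 + 1"
  define y where "y = (2 / d) *\<^sub>R x"
  define s where "s = (d - 2) / d"
  have "(norm x)\<^sup>2 \<ge> 0" by simp
  then have d: "d > 0" unfolding d_def by linarith
  have "(norm y)\<^sup>2 = (4 * (norm x)\<^sup>2) / d\<^sup>2"
    using d by (simp add: y_def power_mult_distrib power_divide)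
  also have "4 * (norm x)\<^sup>2 = 4 * d - 4" by (simp add: d_def)
  finally have "(norm y)\<^sup>2 + s\<^sup>2 = (4 * d - 4) / d\<^sup>2 + (d - 2)\<^sup>2 / d\<^sup>2"
    by (simp add: s_def power_divide)
  also have "\<dots> = (4 * d - 4 + (d - 2)\<^sup>2) / d\<^sup>2" by (rule add_divide_distrib[symmetric])
  also have "4 * d - 4 + (d - 2)\<^sup>2 = d\<^sup>2" by algebra
  also have "d\<^sup>2 / d\<^sup>2 = 1" using d by simp
  finally have sn: "(norm y)\<^sup>2 + s\<^sup>2 = 1" .
  have s1: "1 - s = 2 / d" using d by (simp add: s_def diff_divide_distrib)
  have "s \<noteq> 1" using s1 d by auto
  then have "(y, s) \<in> punctured_sphere"
    using sn by (simp add: punctured_sphere_def norm_Pair)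
  moreover have "stereo (y, s) = x" using d by (simp add: stereo_def s1 y_def)
  ultimately show ?thesis by blast
qed

lemma stereo_preimage_nonempty:
  assumes "A \<noteq> {}" shows "stereo_preimage A \<noteq> {}"
proof -
  obtain x where x: "x \<in> A" using assms by blast
  obtain p where "p \<in> punctured_sphere" "stereo p = x" using stereo_surj[of x] by blast
  then have "p \<in> stereo_preimage A" using x by (simp add: stereo_preimage_def)
  then show ?thesis by blast
qed

lemma stereo_preimage_bounded: "bounded (stereo_preimage A)"
proof -
  have "stereo_preimage A \<subseteq> sphere 0 1"
    unfolding stereo_preimage_def punctured_sphere_def by blast
  then show ?thesis using bounded_subset[OF bounded_sphere] by blast
qed

lemma stereo_preimage_closure:
  assumes "closed A" "p \<in> closure (stereo_preimage A)" "p \<in> punctured_sphere"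
  shows "stereo p \<in> A"
proof -
  obtain q where q: "\<And>n. q n \<in> stereo_preimage A" "q \<longlonglongrightarrow> p"
    using assms(2) closure_sequential by metis
  have "(\<lambda>n. stereo (q n)) \<longlonglongrightarrow> stereo p"
    unfolding stereo_def using north_pole_snd[OF assms(3)]
    by (intro tendsto_intros q(2)) auto
  moreover have "\<And>n. stereo (q n) \<in> A" using q(1) by (simp add: stereo_preimage_def)
  ultimately show ?thesis
    using closed_sequentially[OF assms(1), of "\<lambda>n. stereo (q n)"] by simp
qed

lemma dist_bh_0D:
  assumes "A \<noteq> {}" "B \<noteq> {}" "closed B" "dist_bh A B = 0"
  shows "A \<subseteq> B"
proof
  fix x assume "x \<in> A"
  obtain p where p: "p \<in> punctured_sphere" "stereo p = x" using stereo_surj[of x] by blast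
  then have "p \<in> stereo_preimage A" using \<open>x \<in> A\<close> by (simp add: stereo_preimage_def)
  then have "p \<in> closure (stereo_preimage B)"
    using hausdorff_dist_0D[of "stereo_preimage A" "stereo_preimage B"] assms
    by (auto simp: dist_bh_def stereo_preimage_nonempty stereo_preimage_bounded)
  then show "x \<in> B" using stereo_preimage_closure[OF assms(3) _ p(1)] p(2) by simp
qed

lemma recession_cone_nonempty: "recession_cone K \<noteq> {}"
proof -
  have "0 \<in> recession_cone K" by (simp add: recession_cone_def)
  then show ?thesis by blast
qed

lemma KnD: "K \<in> Kn \<Longrightarrow> K \<noteq> {} \<and> closed K"
  by (auto simp: Kn_def convex_body_def)

lemma Metric_space_dist_a: "Metric_space (Kn :: (real^'n) set set) dist_a"
proof
  note ne = stereo_preimage_nonempty stereo_preimage_bounded recession_cone_nonempty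
  have tri: "dist_bh A E \<le> dist_bh A B + dist_bh B E"
    if "A \<noteq> {}" "B \<noteq> {}" "E \<noteq> {}" for A B E :: "(real^'n) set"
    unfolding dist_bh_def by (rule hausdorff_dist_triangle) (auto simp: ne that)
  have refl: "dist_bh A A = 0" if "A \<noteq> {}" for A :: "(real^'n) set"
    by (simp add: dist_bh_def hausdorff_dist_self ne that)
  have comm: "dist_bh A B = dist_bh B A" for A B :: "(real^'n) set"
    by (simp add: dist_bh_def hausdorff_dist_commute)
  have nn: "0 \<le> dist_bh A B" if "A \<noteq> {}" "B \<noteq> {}" for A B :: "(real^'n) set"
    unfolding dist_bh_def by (rule hausdorff_dist_nonneg) (auto simp: ne that)
  have sup_nn: "0 \<le> dist_bh A B" for A B :: "(real^'n) set"
  proof (cases "A = {} \<or> B = {}")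
    case True
    then show ?thesis by (auto simp: dist_bh_def hausdorff_dist_def stereo_preimage_def)
  qed (use nn in blast)
  show "0 \<le> dist_a K L" for K L :: "(real^'n) set"
    by (simp add: dist_a_def sup_nn)
  show "dist_a K L = dist_a L K" for K L :: "(real^'n) set"
    by (simp add: dist_a_def comm)
  show "dist_a K L = 0 \<longleftrightarrow> K = L" if "K \<in> Kn" "L \<in> Kn" for K L :: "(real^'n) set"
  proof
    assume 0: "dist_a K L = 0"
    then have "dist_bh K L = 0"
      using sup_nn[of K L] sup_nn[of "recession_cone K" "recession_cone L"] by (simp add: dist_a_def)
    then show "K = L"
      using dist_bh_0D[of K L] dist_bh_0D[of L K] KnD that comm[of K L] by fastforce
  next
    assume "K = L"
    then show "dist_a K L = 0"
      using refl[of L] refl[of "recession_cone L"] KnD[OF that(2)] ne(3)[of L] by (simp add: dist_a_def)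
  qed
  show "dist_a K N \<le> dist_a K L + dist_a L N"
    if "K \<in> Kn" "L \<in> Kn" "N \<in> Kn" for K L N :: "(real^'n) set"
    using tri[of K L N] tri[of "recession_cone K" "recession_cone L" "recession_cone N"]
      KnD[OF that(1)] KnD[OF that(2)] KnD[OF that(3)]
    by (simp add: dist_a_def ne(3))
qed

lemma topspace_asymptotic_topology [simp]: "topspace asymptotic_topology = Kn"
  unfolding asymptotic_topology_def
  by (rule Metric_space.topspace_mtopology[OF Metric_space_dist_a])

lemma openin_hypersurface_topology:
  fixes U :: "(real^'n) set set"
  shows
  "openin hypersurface_topology U \<longleftrightarrow> U \<subseteq> frontier ` Kn \<and>
     (\<forall>M L. hypersurface_converges M L \<and> L \<in> U \<longrightarrow> (\<forall>\<^sub>F i in sequentially. M i \<in> U))"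
proof -
  have "istopology (\<lambda>U :: (real^'n) set set. U \<subseteq> frontier ` Kn \<and>
     (\<forall>M L. hypersurface_converges M L \<and> L \<in> U \<longrightarrow> (\<forall>\<^sub>F i in sequentially. M i \<in> U)))"
    (is "istopology ?P")
    unfolding istopology_def
  proof (intro conjI allI impI)
    fix S T assume "?P S" "?P T"
    then show "S \<inter> T \<subseteq> frontier ` Kn" by blast
    fix M L assume "hypersurface_converges M L \<and> L \<in> S \<inter> T"
    then show "\<forall>\<^sub>F i in sequentially. M i \<in> S \<inter> T"
      using \<open>?P S\<close> \<open>?P T\<close> unfolding Int_iff eventually_conj_iff by blast
  next
    fix \<U> assume U: "\<forall>S\<in>\<U>. ?P S"
    then show "\<Union>\<U> \<subseteq> frontier ` Kn" by blast
    fix M L assume "hypersurface_converges M L \<and> L \<in> \<Union>\<U>"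
    then obtain S where "S \<in> \<U>" "\<forall>\<^sub>F i in sequentially. M i \<in> S" using U by blast
    then show "\<forall>\<^sub>F i in sequentially. M i \<in> \<Union>\<U>" by (auto elim: eventually_mono)
  qed
  then show ?thesis unfolding hypersurface_topology_def by (subst topology_inverse') blast+
qed

lemma topspace_hypersurface_topology [simp]: "topspace hypersurface_topology = frontier ` Kn"
proof
  show "topspace hypersurface_topology \<subseteq> frontier ` Kn"
    using openin_topspace openin_hypersurface_topology by blast
  have "openin hypersurface_topology (frontier ` Kn)"
    unfolding openin_hypersurface_topology hypersurface_converges_def
    by (metis (mono_tags, lifting) always_eventually image_eqI subset_refl)
  then show "frontier ` Kn \<subseteq> topspace hypersurface_topology"
    by (rule openin_subset)
qed

lemma quotient_map_frontier:
  "quotient_map asymptotic_topology hypersurface_topology (frontier :: (real^'n) set \<Rightarrow> _)"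
proof -
  interpret Metric_space "Kn :: (real^'n) set set" dist_a by (rule Metric_space_dist_a)
  have "openin asymptotic_topology {K \<in> Kn. frontier K \<in> U} \<longleftrightarrow> openin hypersurface_topology U"
    if U: "U \<subseteq> frontier ` Kn" for U :: "(real^'n) set set"
  proof
    assume o: "openin asymptotic_topology {K \<in> Kn. frontier K \<in> U}"
    show "openin hypersurface_topology U"
      unfolding openin_hypersurface_topology
    proof (intro conjI allI impI U)
      fix M L assume "hypersurface_converges M L \<and> L \<in> U"
      then obtain K K0 where K: "\<forall>i. K i \<in> Kn \<and> frontier (K i) = M i" "K0 \<in> Kn"
          "frontier K0 \<in> U" "limitin asymptotic_topology K K0 sequentially"
        unfolding hypersurface_converges_def by blast
      then have "\<forall>\<^sub>F i in sequentially. K i \<in> {K \<in> Kn. frontier K \<in> U}"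
        using o unfolding limitin_def by blast
      then show "\<forall>\<^sub>F i in sequentially. M i \<in> U"
        by eventually_elim (use K(1) in auto)
    qed
  next
    assume o: "openin hypersurface_topology U"
    show "openin asymptotic_topology {K \<in> Kn. frontier K \<in> U}"
    proof (rule ccontr)
      assume "\<not> ?thesis"
      then obtain K0 where K0: "K0 \<in> Kn" "frontier K0 \<in> U"
          and r: "\<And>r. r > 0 \<Longrightarrow> \<not> mball K0 r \<subseteq> {K \<in> Kn. frontier K \<in> U}"
        unfolding asymptotic_topology_def openin_mtopology by blast
      have "\<exists>K. K \<in> mball K0 (inverse (real (Suc i))) \<and> frontier K \<notin> U" for i
        using r[of "inverse (real (Suc i))"] by force
      then obtain K where K: "\<And>i. K i \<in> mball K0 (inverse (real (Suc i)))" "\<And>i. frontier (K i) \<notin> U"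
        by metis
      have "limitin asymptotic_topology K K0 sequentially"
        unfolding asymptotic_topology_def limitin_metric
      proof (intro conjI K0 allI impI)
        fix e :: real assume "e > 0"
        then have "\<forall>\<^sub>F i in sequentially. inverse (real (Suc i)) < e"
          using LIMSEQ_inverse_real_of_nat by (simp add: order_tendsto_iff)
        then show "\<forall>\<^sub>F i in sequentially. K i \<in> Kn \<and> dist_a (K i) K0 < e"
          proof eventually_elim
            case (elim i)
            then show ?case using K(1)[of i] by (simp add: commute)
          qed
      qed
      then have "hypersurface_converges (\<lambda>i. frontier (K i)) (frontier K0)"
        unfolding hypersurface_converges_def using K0 K(1) by (intro exI[of _ K] exI[of _ K0]) auto
      then have "\<forall>\<^sub>F i in sequentially. frontier (K i) \<in> U"
        using o K0 unfolding openin_hypersurface_topology by blast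
      then show False using K(2) by simp
    qed
  qed
  then show ?thesis unfolding quotient_map_def by simp
qed

end

theory Submission
  imports Defs
begin

text \<open>A body \<open>K\<close> whose boundary is homeomorphic to \<open>R\<^sup>n\<^sup>-\<^sup>1\<close> has a recession cone that is not a linear
  subspace: otherwise \<open>K\<close> is the product of a subspace and a compact convex body, and its boundary is
  not contractible. Averaging closest points gives a unit vector \<open>e\<close> in the recession cone
  and its dual, and an interior point \<open>p\<close> of \<open>K\<close>, both depending continuously on \<open>K\<close>. With \<open>p\<close> as
  the origin, \<open>K\<close> is deformed by the projective maps \<open>x \<mapsto> x / (1 - s (e \<bullet> x))\<close>, \<open>0 \<le> s < \<infinity>\<close>, followed by a
  translation; as \<open>s\<close> tends to infinity the images converge to the half-space \<open>{x. 0 \<le> e \<bullet> x}\<close>,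
  together with their recession cones. The maps are real analytic, hence preserve
  regularity, and form a semigroup; a normal \<open>u\<close> with support value \<open>h > 0\<close> is moved to
  \<open>u - s h e\<close>, so the normal cones decrease to \<open>{- e}\<close>.\<close>

section \<open>Power series in several variables\<close>

text \<open>Each property of \<open>e\<close> has its own task. Being nonnegative on the recession
  cone, it keeps the images closed: otherwise they could accumulate where the denominator
  \<open>1 + s * (e \<bullet> y)\<close> of the inverse map vanishes. Being itself a recession
  direction, it becomes interior to the recession cone of every image with \<open>s > 0\<close>, so
  that the boundary is at once a graph and the image stays in \<open>Kn\<close>. The hyperplane
  \<open>s * (e \<bullet> x) = 1\<close> is sent to infinity. The part of the body beyond it is
  lost, and the slice in it spans new recession directions, so that convergence of the recession
  cones, which the topology demands, needs an argument of its own. For nested normal cones,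
  attainment is the obstacle: a normal \<open>v\<close> of the image comes from a functional
  \<open>u = v + (s * h) *\<^sub>R e\<close> bounded on the body, but \<open>v\<close> itself must
  attain a maximum there, and a bounded functional on an unbounded body need not. The positive
  multiple of \<open>e\<close> that separates \<open>v\<close> from \<open>u\<close> repairs this.
  Hypersurfaces are treated by lifting to bodies; the lift is ambiguous only for
  hyperplanes.\<close>

definition monomial :: "('n \<Rightarrow> nat) \<Rightarrow> real^'n \<Rightarrow> real" where
  "monomial \<alpha> h = (\<Prod>i\<in>UNIV. (h $ i) ^ \<alpha> i)"

definition polydisc :: "real \<Rightarrow> (real^'n) set" where
  "polydisc \<rho> = {h. \<forall>i. \<bar>h $ i\<bar> \<le> \<rho>}"

text \<open>A power series on the polydisc whose weighted \<open>\<ell>\<^sup>1\<close> norm is at most \<open>B\<close>. This norm is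
  submultiplicative, so that substituting series into each other only takes a regrouping of absolutely convergent
  sums.\<close>

definition majorized :: "real \<Rightarrow> real \<Rightarrow> (real^'n \<Rightarrow> real) \<Rightarrow> bool" where
  "majorized \<rho> B f \<longleftrightarrow> (\<exists>c S. ((\<lambda>\<alpha>. \<bar>c \<alpha>\<bar> * \<rho> ^ sum \<alpha> UNIV) has_sum S) UNIV \<and> S \<le> B \<and>
     (\<forall>h\<in>polydisc \<rho>. ((\<lambda>\<alpha>. c \<alpha> * monomial \<alpha> h) has_sum f h) UNIV))"

lemma abs_monomial_le:
  assumes "h \<in> polydisc \<rho>"
  shows "\<bar>monomial \<alpha> h\<bar> \<le> \<rho> ^ sum \<alpha> UNIV"
proof -
  have "\<bar>monomial \<alpha> h\<bar> = (\<Prod>i\<in>UNIV. \<bar>h $ i\<bar> ^ \<alpha> i)"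
    by (simp add: monomial_def abs_prod power_abs)
  also have "\<dots> \<le> (\<Prod>i\<in>UNIV. \<rho> ^ \<alpha> i)"
    using assms by (intro prod_mono) (auto simp: polydisc_def intro!: power_mono)
  also have "\<dots> = \<rho> ^ sum \<alpha> UNIV" by (simp add: power_sum)
  finally show ?thesis .
qed

text \<open>Absolute summability permits summing fibre by fibre over the indices with equal
  exponent, and the triangle inequality inside a fibre can only lower the weighted norm. The
  constructions below give series indexed by pairs, coordinates or shifted exponents; this turns
  them back into power series.\<close>

lemma majorized_regroup:
  fixes a :: "'j \<Rightarrow> real" and m :: "'j \<Rightarrow> 'n::finite \<Rightarrow> nat"
  assumes \<rho>: "\<rho> > 0" and S: "((\<lambda>j. \<bar>a j\<bar> * \<rho> ^ sum (m j) UNIV) has_sum S) UNIV" "S \<le> B"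
    and f: "\<And>h. h \<in> polydisc \<rho> \<Longrightarrow> ((\<lambda>j. a j * monomial (m j) h) has_sum f h) UNIV"
  shows "majorized \<rho> B f"
proof -
  define J where "J \<beta> = {j. m j = \<beta>}" for \<beta>
  define w where "w j = \<bar>a j\<bar> * \<rho> ^ sum (m j) UNIV" for j
  define c where "c \<beta> = infsum a (J \<beta>)" for \<beta>
  have bij: "bij_betw snd (Sigma UNIV J) UNIV"
    by (rule bij_betwI[where g = "\<lambda>j. (m j, j)"]) (auto simp: J_def)
  have summ: "w summable_on J \<beta>" for \<beta>
    using S(1) unfolding w_def by (blast intro: summable_on_subset_banach has_sum_imp_summable)
  have absa: "(\<lambda>j. \<bar>a j\<bar>) summable_on J \<beta>" for \<beta>
  proof -
    have "(\<lambda>j. w j * (1 / \<rho> ^ sum \<beta> UNIV)) summable_on J \<beta>"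
      by (intro summable_on_cmult_left summ)
    then show ?thesis
      by (rule summable_on_cong[THEN iffD1, rotated]) (use \<rho> in \<open>auto simp: w_def J_def\<close>)
  qed
  have c: "(a has_sum c \<beta>) (J \<beta>)" for \<beta>
    unfolding c_def using absa[of \<beta>]
    by (intro has_sum_infsum, subst summable_on_iff_abs_summable_on_real) simp
  define g where "g \<beta> = infsum w (J \<beta>)" for \<beta>
  have g: "(w has_sum g \<beta>) (J \<beta>)" for \<beta>
    unfolding g_def using summ by (intro has_sum_infsum)
  have "((\<lambda>p. w (snd p)) has_sum S) (Sigma UNIV J)"
    using has_sum_reindex_bij_betw[OF bij, of w S] S(1) unfolding w_def by simp
  then have gS: "(g has_sum S) UNIV"
    by (rule has_sum_SigmaD) (use g in auto)
  have cg: "\<bar>c \<beta>\<bar> * \<rho> ^ sum \<beta> UNIV \<le> g \<beta>" for \<beta>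
  proof -
    have "((\<lambda>j. a j * \<rho> ^ sum \<beta> UNIV) has_sum (c \<beta> * \<rho> ^ sum \<beta> UNIV)) (J \<beta>)"
      by (intro has_sum_cmult_left c)
    from norm_infsum_le[OF this g[of \<beta>]] \<rho> show ?thesis
      by (auto simp: J_def w_def abs_mult)
  qed
  have cs: "(\<lambda>\<beta>. \<bar>c \<beta>\<bar> * \<rho> ^ sum \<beta> UNIV) summable_on UNIV"
    by (rule summable_on_comparison_test[OF has_sum_imp_summable[OF gS]]) (use cg \<rho> in auto)
  show ?thesis unfolding majorized_def
  proof (intro exI conjI ballI)
    show "((\<lambda>\<beta>. \<bar>c \<beta>\<bar> * \<rho> ^ sum \<beta> UNIV) has_sum (infsum (\<lambda>\<beta>. \<bar>c \<beta>\<bar> * \<rho> ^ sum \<beta> UNIV) UNIV)) UNIV"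
      using cs by (rule has_sum_infsum)
    have "infsum (\<lambda>\<beta>. \<bar>c \<beta>\<bar> * \<rho> ^ sum \<beta> UNIV) UNIV \<le> S"
      by (rule has_sum_mono[OF has_sum_infsum[OF cs] gS]) (rule cg)
    then show "infsum (\<lambda>\<beta>. \<bar>c \<beta>\<bar> * \<rho> ^ sum \<beta> UNIV) UNIV \<le> B" using S(2) by simp
    fix h :: "real^'n" assume h: "h \<in> polydisc \<rho>"
    have "((\<lambda>p. a (snd p) * monomial (m (snd p)) h) has_sum f h) (Sigma UNIV J)"
      using has_sum_reindex_bij_betw[OF bij, of "\<lambda>j. a j * monomial (m j) h"] f[OF h] by simp
    then show "((\<lambda>\<beta>. c \<beta> * monomial \<beta> h) has_sum f h) UNIV"
    proof (rule has_sum_SigmaD)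
      fix \<beta>
      have "((\<lambda>j. a j * monomial \<beta> h) has_sum (c \<beta> * monomial \<beta> h)) (J \<beta>)"
        by (intro has_sum_cmult_left c)
      then show "((\<lambda>j. a (snd (\<beta>, j)) * monomial (m (snd (\<beta>, j))) h) has_sum c \<beta> * monomial \<beta> h) (J \<beta>)"
        by (rule has_sum_cong[THEN iffD1, rotated]) (auto simp: J_def)
    qed
  qed
qed

lemma majorized_mono: "majorized \<rho> B f \<Longrightarrow> B \<le> B' \<Longrightarrow> majorized \<rho> B' f"
  unfolding majorized_def by (meson order_trans)

lemma majorized_cong:
  "majorized \<rho> B f \<Longrightarrow> (\<And>h. h \<in> polydisc \<rho> \<Longrightarrow> f h = g h) \<Longrightarrow> majorized \<rho> B g"
  unfolding majorized_def by simp

text \<open>The coefficients \<open>w k * c k \<alpha>\<close> form an absolutely summable family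
  because the weights \<open>\<bar>w k\<bar> * b k\<close> are summable, so they may be regrouped by
  \<alpha>. Products, geometric series and substitutions are all instances.\<close>

lemma majorized_has_sum:
  fixes g :: "'k \<Rightarrow> real^'n \<Rightarrow> real"
  assumes \<rho>: "\<rho> > 0" and g: "\<And>k. majorized \<rho> (b k) (g k)"
    and S: "((\<lambda>k. \<bar>w k\<bar> * b k) has_sum B) UNIV"
    and f: "\<And>h. h \<in> polydisc \<rho> \<Longrightarrow> ((\<lambda>k. w k * g k h) has_sum f h) UNIV"
  shows "majorized \<rho> B f"
proof -
  have "\<forall>k. \<exists>c s. ((\<lambda>\<alpha>. \<bar>c \<alpha>\<bar> * \<rho> ^ sum \<alpha> UNIV) has_sum s) UNIV \<and> s \<le> b k \<and>
     (\<forall>h\<in>polydisc \<rho>. ((\<lambda>\<alpha>. c \<alpha> * monomial \<alpha> h) has_sum g k h) UNIV)"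
    using g unfolding majorized_def by blast
  then obtain c s where c: "\<And>k. ((\<lambda>\<alpha>. \<bar>c k \<alpha>\<bar> * \<rho> ^ sum \<alpha> UNIV) has_sum s k) UNIV" "\<And>k. s k \<le> b k"
     "\<And>k h. h\<in>polydisc \<rho> \<Longrightarrow> ((\<lambda>\<alpha>. c k \<alpha> * monomial \<alpha> h) has_sum g k h) UNIV"
    unfolding choice_iff by blast
  have s0: "0 \<le> s k" for k
    by (rule has_sum_nonneg[OF c(1)]) (use \<rho> in auto)
  define a where "a = (\<lambda>p. w (fst p) * c (fst p) (snd p))"
  have sw: "(\<lambda>k. \<bar>w k\<bar> * s k) summable_on UNIV"
    by (rule summable_on_comparison_test[OF has_sum_imp_summable[OF S]])
       (use c(2) s0 in \<open>auto intro!: mult_left_mono\<close>)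
  have inner: "((\<lambda>\<alpha>. \<bar>a (k, \<alpha>)\<bar> * \<rho> ^ sum (snd (k, \<alpha>)) UNIV) has_sum (\<bar>w k\<bar> * s k)) UNIV" for k
    using has_sum_cmult_right[OF c(1)[of k], of "\<bar>w k\<bar>"] by (simp add: a_def abs_mult mult.assoc)
  have "(\<lambda>p. \<bar>a p\<bar> * \<rho> ^ sum (snd p) UNIV) summable_on (Sigma UNIV (\<lambda>_. UNIV))"
    by (rule summable_on_SigmaI[OF inner sw]) (use \<rho> in auto)
  then have ab: "(\<lambda>p. \<bar>a p\<bar> * \<rho> ^ sum (snd p) UNIV) summable_on UNIV" by simp
  show ?thesis
  proof (rule majorized_regroup[OF \<rho>, where a = a and m = snd])
    show 1: "((\<lambda>p. \<bar>a p\<bar> * \<rho> ^ sum (snd p) UNIV) has_sum (infsum (\<lambda>p. \<bar>a p\<bar> * \<rho> ^ sum (snd p) UNIV) UNIV)) UNIV"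
      using ab by (rule has_sum_infsum)
    then have "((\<lambda>p. \<bar>a p\<bar> * \<rho> ^ sum (snd p) UNIV) has_sum (infsum (\<lambda>p. \<bar>a p\<bar> * \<rho> ^ sum (snd p) UNIV) UNIV)) (Sigma UNIV (\<lambda>_. UNIV))"
      by simp
    then have "((\<lambda>k. \<bar>w k\<bar> * s k) has_sum (infsum (\<lambda>p. \<bar>a p\<bar> * \<rho> ^ sum (snd p) UNIV) UNIV)) UNIV"
      by (rule has_sum_SigmaD) (use inner in auto)
    then show "infsum (\<lambda>p. \<bar>a p\<bar> * \<rho> ^ sum (snd p) UNIV) UNIV \<le> B"
      by (rule has_sum_mono[OF _ S]) (use c(2) in \<open>auto intro!: mult_left_mono\<close>)
    fix h :: "real^'n" assume h: "h \<in> polydisc \<rho>"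
    have "(\<lambda>p. \<bar>a p * monomial (snd p) h\<bar>) summable_on UNIV"
      by (rule summable_on_comparison_test[OF ab])
         (use abs_monomial_le[OF h] in \<open>auto simp: abs_mult intro!: mult_left_mono\<close>)
    then have "(\<lambda>p. a p * monomial (snd p) h) summable_on (Sigma UNIV (\<lambda>_. UNIV))"
      by (subst summable_on_iff_abs_summable_on_real) simp
    then have "((\<lambda>p. a p * monomial (snd p) h) has_sum f h) (Sigma UNIV (\<lambda>_. UNIV))"
    proof (rule has_sum_SigmaI[rotated 2])
      show "((\<lambda>k. w k * g k h) has_sum f h) UNIV" by (rule f[OF h])
      show "((\<lambda>\<alpha>. a (k, \<alpha>) * monomial (snd (k, \<alpha>)) h) has_sum w k * g k h) UNIV" for k
        using has_sum_cmult_right[OF c(3)[OF h, of k], of "w k"] by (simp add: a_def mult.assoc)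
    qed
    then show "((\<lambda>p. a p * monomial (snd p) h) has_sum f h) UNIV" by simp
  qed
qed

lemma majorized_monomial_times:
  assumes \<rho>: "\<rho> > 0" and g: "majorized \<rho> B g"
  shows "majorized \<rho> (\<rho> ^ sum \<alpha> UNIV * B) (\<lambda>h. monomial \<alpha> h * g h)"
proof -
  obtain c s where c: "((\<lambda>\<alpha>. \<bar>c \<alpha>\<bar> * \<rho> ^ sum \<alpha> UNIV) has_sum s) UNIV" "s \<le> B"
     "\<And>h. h\<in>polydisc \<rho> \<Longrightarrow> ((\<lambda>\<alpha>. c \<alpha> * monomial \<alpha> h) has_sum g h) UNIV"
    using g unfolding majorized_def by blast
  show ?thesis
  proof (rule majorized_regroup[OF \<rho>, where a = c and m = "\<lambda>\<beta> i. \<alpha> i + \<beta> i"])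
    show "((\<lambda>\<beta>. \<bar>c \<beta>\<bar> * \<rho> ^ (\<Sum>i\<in>UNIV. \<alpha> i + \<beta> i)) has_sum (\<rho> ^ sum \<alpha> UNIV * s)) UNIV"
      using has_sum_cmult_right[OF c(1), of "\<rho> ^ sum \<alpha> UNIV"]
      by (simp add: sum.distrib power_add mult.left_commute)
    show "\<rho> ^ sum \<alpha> UNIV * s \<le> \<rho> ^ sum \<alpha> UNIV * B" using c(2) \<rho> by simp
    fix h :: "real^'a" assume "h \<in> polydisc \<rho>"
    from has_sum_cmult_right[OF c(3)[OF this], of "monomial \<alpha> h"]
    show "((\<lambda>\<beta>. c \<beta> * monomial (\<lambda>i. \<alpha> i + \<beta> i) h) has_sum monomial \<alpha> h * g h) UNIV"
      by (simp add: monomial_def prod.distrib power_add mult.left_commute)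
  qed
qed

lemma majorized_const: 
  assumes "\<rho> > 0" shows "majorized \<rho> \<bar>a\<bar> (\<lambda>h. a)"
  by (rule majorized_regroup[OF assms, where a = "\<lambda>_::unit. a" and m = "\<lambda>_ _. 0"])
     (auto simp: monomial_def intro!: has_sum_finiteI)

text \<open>Only the first factor is expanded: the product becomes a combination of monomial
  multiples of \<open>g\<close>.\<close>

lemma majorized_mult:
  assumes \<rho>: "\<rho> > 0" and f: "majorized \<rho> A f" and g: "majorized \<rho> B g" and "B \<ge> 0"
  shows "majorized \<rho> (A * B) (\<lambda>h. f h * g h)"
proof -
  obtain c s where c: "((\<lambda>\<alpha>. \<bar>c \<alpha>\<bar> * \<rho> ^ sum \<alpha> UNIV) has_sum s) UNIV" "s \<le> A"
     "\<And>h. h\<in>polydisc \<rho> \<Longrightarrow> ((\<lambda>\<alpha>. c \<alpha> * monomial \<alpha> h) has_sum f h) UNIV"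
    using f unfolding majorized_def by blast
  have "majorized \<rho> (s * B) (\<lambda>h. f h * g h)"
  proof (rule majorized_has_sum[OF \<rho> majorized_monomial_times[OF \<rho> g], where w = c])
    show "((\<lambda>\<alpha>. \<bar>c \<alpha>\<bar> * (\<rho> ^ sum \<alpha> UNIV * B)) has_sum s * B) UNIV"
      using has_sum_cmult_left[OF c(1), of B] by (simp add: mult.assoc)
    fix h :: "real^'a" assume "h \<in> polydisc \<rho>"
    from has_sum_cmult_left[OF c(3)[OF this], of "g h"]
    show "((\<lambda>\<alpha>. c \<alpha> * (monomial \<alpha> h * g h)) has_sum f h * g h) UNIV"
      by (simp add: mult.assoc)
  qed
  then show ?thesis by (rule majorized_mono) (use c(2) assms(4) in \<open>simp add: mult_right_mono\<close>)
qed

lemma majorized_power: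
  assumes "\<rho> > 0" "majorized \<rho> B f" "B \<ge> 0"
  shows "majorized \<rho> (B ^ k) (\<lambda>h. f h ^ k)"
proof (induction k)
  case 0 show ?case using majorized_const[OF assms(1), of 1] by simp
next
  case (Suc k)
  then show ?case using majorized_mult[OF assms(1,2) Suc] assms(3) by simp
qed

lemma majorized_prod:
  assumes "\<rho> > 0" "\<And>i. majorized \<rho> (B i) (f i)" "\<And>i. B i \<ge> 0" "finite I"
  shows "majorized \<rho> (\<Prod>i\<in>I. B i) (\<lambda>h. \<Prod>i\<in>I. f i h)"
  using assms(4)
proof induction
  case empty show ?case using majorized_const[OF assms(1), of 1] by simp
next
  case (insert i I)
  then show ?case using majorized_mult[OF assms(1,2) insert(3)] assms(3) by (simp add: prod_nonneg)
qed

lemma majorized_linear: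
  fixes a :: "real^'n"
  assumes "\<rho> > 0" 
  shows "majorized \<rho> ((\<Sum>i\<in>UNIV. \<bar>a $ i\<bar>) * \<rho>) (\<lambda>h. a \<bullet> h)"
  by (rule majorized_regroup[OF assms, where a = "\<lambda>i. a $ i" and m = "\<lambda>i j. if j = i then 1 else 0"])
     (auto simp: monomial_def inner_vec_def if_distrib sum_distrib_right power_sum cong: if_cong intro!: has_sum_finiteI)

text \<open>A geometric series in \<open>- (a \<bullet> h) / D\<close>, whose weighted norm is at
  most 1/2. The norms of its terms add up to at most \<open>1 / (D - b)\<close>, and
  \<open>b \<le> D / 2\<close>.\<close>

lemma majorized_inverse_linear:
  fixes a :: "real^'n"
  assumes \<rho>: "\<rho> > 0" and D: "(\<Sum>i\<in>UNIV. \<bar>a $ i\<bar>) * \<rho> \<le> D / 2" "D > 0"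
  shows "majorized \<rho> (2 / D) (\<lambda>h. 1 / (D + a \<bullet> h))"
proof -
  define b where "b = (\<Sum>i\<in>UNIV. \<bar>a $ i\<bar>) * \<rho>"
  have b: "b \<ge> 0" "b \<le> D/2" using assms by (auto simp: b_def sum_nonneg)
  have ah: "\<bar>a \<bullet> h\<bar> \<le> b" if "h \<in> polydisc \<rho>" for h
  proof -
    have "\<bar>a \<bullet> h\<bar> \<le> (\<Sum>i\<in>UNIV. \<bar>a $ i * h $ i\<bar>)" by (simp add: inner_vec_def)
    also have "\<dots> \<le> (\<Sum>i\<in>UNIV. \<bar>a $ i\<bar> * \<rho>)"
      using that by (intro sum_mono) (auto simp: abs_mult polydisc_def intro!: mult_left_mono)
    finally show ?thesis by (simp add: b_def sum_distrib_right)
  qed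
  have geo: "((\<lambda>k. x ^ k) has_sum (1 / (1 - x))) UNIV" if "\<bar>x\<bar> < 1" for x :: real
  proof (rule norm_summable_imp_has_sum)
    show "summable (\<lambda>n. norm (x ^ n))" using that summable_geometric[of "\<bar>x\<bar>"] by (simp add: power_abs)
    show "(\<lambda>n. x ^ n) sums (1 / (1 - x))" using that geometric_sums[of x] by simp
  qed
  have "majorized \<rho> (1 / (D - b)) (\<lambda>h. 1 / (D + a \<bullet> h))"
  proof (rule majorized_has_sum[OF \<rho> majorized_power[OF \<rho> majorized_linear[OF \<rho>, of a, folded b_def] b(1)],
        where w = "\<lambda>k. (-1) ^ k / D ^ Suc k"])
    have "((\<lambda>k. (1/D) * (b / D) ^ k) has_sum (1/D) * (1 / (1 - b / D))) UNIV"
      using b D by (intro has_sum_cmult_right geo) (simp add: field_simps)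
    moreover have "(1/D) * (1 / (1 - b / D)) = 1 / (D - b)" using D b by (simp add: field_simps)
    ultimately show "((\<lambda>k. \<bar>(- 1) ^ k / D ^ Suc k\<bar> * b ^ k) has_sum 1 / (D - b)) UNIV"
      using D by (simp add: abs_divide power_abs abs_mult power_divide)
    fix h :: "real^'n" assume h: "h \<in> polydisc \<rho>"
    have lt: "\<bar>a \<bullet> h\<bar> < D" using ah[OF h] b D by linarith
    have "((\<lambda>k. (1/D) * (- (a \<bullet> h) / D) ^ k) has_sum (1/D) * (1 / (1 - (- (a \<bullet> h) / D)))) UNIV"
      using lt D by (intro has_sum_cmult_right geo) (simp add: abs_divide)
    moreover have "(1/D) * (1 / (1 - (- (a \<bullet> h) / D))) = 1 / (D + a \<bullet> h)" using D lt by (simp add: field_simps)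
    moreover have "(1/D) * (- (a \<bullet> h) / D) ^ k = (- 1) ^ k / D ^ Suc k * (a \<bullet> h) ^ k" for k
      using power_mult_distrib[of "-1" "a \<bullet> h / D" k] by (simp add: power_divide)
    ultimately show "((\<lambda>k. (- 1) ^ k / D ^ Suc k * (a \<bullet> h) ^ k) has_sum 1 / (D + a \<bullet> h)) UNIV"
      by simp
  qed
  then show ?thesis by (rule majorized_mono) (use b D in \<open>simp add: field_simps\<close>)
qed

lemma norm_le_polydisc:
  fixes h :: "real^'n"
  assumes "h \<in> polydisc \<rho>" shows "norm h \<le> real CARD('n) * \<rho>"
proof -
  have "norm h \<le> (\<Sum>i\<in>UNIV. \<bar>h $ i\<bar>)" by (rule norm_le_l1_cart)
  also have "\<dots> \<le> (\<Sum>i\<in>(UNIV::'n set). \<rho>)" using assms by (intro sum_mono) (auto simp: polydisc_def)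
  finally show ?thesis by simp
qed

lemma ball_subset_polydisc: "h \<in> ball 0 \<rho> \<Longrightarrow> h \<in> polydisc \<rho>"
  using component_le_norm_cart[of h] by (auto simp: polydisc_def) (meson less_imp_le order_trans)

text \<open>\<open>f\<close> is expanded around \<open>Q y\<close>. The increments of
  \<open>Q\<close> can be made small in the weighted norm, not merely in value, so the monomial with
  exponent \<alpha> in them has norm at most the product of the
  \<open>\<epsilon> ^ \<alpha> i\<close>, and these bounds are summable against the coefficients of
  \<open>f\<close>.\<close>

lemma real_analytic_on_substitute:
  fixes f :: "real^'n \<Rightarrow> real" and Q :: "real^'m \<Rightarrow> real^'n"
  assumes f: "real_analytic_on U f"
    and Q: "\<And>y \<epsilon>. y \<in> V \<Longrightarrow> \<epsilon> > 0 \<Longrightarrow>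
              Q y \<in> U \<and> (\<exists>\<rho>>0. \<forall>i. majorized \<rho> \<epsilon> (\<lambda>h. Q (y + h) $ i - Q y $ i))"
  shows "real_analytic_on V (\<lambda>y. f (Q y))"
  unfolding real_analytic_on_def
proof
  fix y assume y: "y \<in> V"
  then have "Q y \<in> U" using Q[of y 1] by simp
  then obtain c r where r: "r > 0" and c: "\<And>x. x \<in> ball (Q y) r \<Longrightarrow> 
        ((\<lambda>\<alpha>. c \<alpha> * (\<Prod>i\<in>UNIV. (x $ i - Q y $ i) ^ \<alpha> i)) has_sum f x) UNIV"
    using f unfolding real_analytic_on_def by meson
  \<comment> \<open>With this half-width, points of the polydisc have norm at most
    \<open>CARD('n) * \<epsilon> = r / 2\<close>, hence stay in the ball of convergence.\<close>
  define \<epsilon> where "\<epsilon> = r / (2 * real CARD('n))"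
  have \<epsilon>: "\<epsilon> > 0" using r by (simp add: \<epsilon>_def)
  have small: "Q y + k \<in> ball (Q y) r" if "k \<in> polydisc \<epsilon>" for k
  proof -
    have "norm k \<le> real CARD('n) * \<epsilon>" by (rule norm_le_polydisc[OF that])
    also have "\<dots> < r" using r by (simp add: \<epsilon>_def)
    finally show ?thesis by (simp add: dist_norm)
  qed
  have f': "((\<lambda>\<alpha>. c \<alpha> * monomial \<alpha> k) has_sum f (Q y + k)) UNIV" if "k \<in> polydisc \<epsilon>" for k
    using c[OF small[OF that]] by (simp add: monomial_def)
  \<comment> \<open>Convergence at the corner of the polydisc controls all of it: unconditional
    summability of reals is absolute, and the monomials at the corner are the weights.\<close>
  have "((\<lambda>\<alpha>. c \<alpha> * monomial \<alpha> (\<chi> i. \<epsilon>)) has_sum f (Q y + (\<chi> i. \<epsilon>))) UNIV"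
    using \<epsilon> by (intro f') (simp add: polydisc_def)
  then have "(\<lambda>\<alpha>. \<bar>c \<alpha> * monomial \<alpha> (\<chi> i. \<epsilon>)\<bar>) summable_on UNIV"
    using summable_on_iff_abs_summable_on_real[THEN iffD1, OF has_sum_imp_summable] by fastforce
  moreover have "\<bar>c \<alpha> * monomial \<alpha> (\<chi> i. \<epsilon>)\<bar> = \<bar>c \<alpha>\<bar> * (\<Prod>i\<in>UNIV. \<epsilon> ^ \<alpha> i)" for \<alpha>
    using \<epsilon> by (simp add: monomial_def abs_mult power_sum[symmetric])
  ultimately have cs: "(\<lambda>\<alpha>. \<bar>c \<alpha>\<bar> * (\<Prod>i\<in>UNIV. \<epsilon> ^ \<alpha> i)) summable_on UNIV" by simp
  obtain \<rho> where \<rho>: "\<rho> > 0" and g: "\<And>i. majorized \<rho> \<epsilon> (\<lambda>h. Q (y + h) $ i - Q y $ i)"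
    using Q[OF y \<epsilon>] by auto
  have dQ: "Q (y + h) - Q y \<in> polydisc \<epsilon>" if h: "h \<in> polydisc \<rho>" for h
    unfolding polydisc_def
  proof (clarify)
    fix i
    obtain d S where d: "((\<lambda>\<alpha>. \<bar>d \<alpha>\<bar> * \<rho> ^ sum \<alpha> UNIV) has_sum S) UNIV" "S \<le> \<epsilon>"
      "((\<lambda>\<alpha>. d \<alpha> * monomial \<alpha> h) has_sum (Q (y + h) $ i - Q y $ i)) UNIV"
      using g[of i] h unfolding majorized_def by blast
    have "norm (Q (y + h) $ i - Q y $ i) \<le> S"
      by (rule norm_infsum_le[OF d(3,1)]) (auto simp: abs_mult intro!: mult_left_mono abs_monomial_le[OF h])
    then show "\<bar>(Q (y + h) - Q y) $ i\<bar> \<le> \<epsilon>" using d(2) by simp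
  qed
  have "majorized \<rho> (infsum (\<lambda>\<alpha>. \<bar>c \<alpha>\<bar> * (\<Prod>i\<in>UNIV. \<epsilon> ^ \<alpha> i)) UNIV) (\<lambda>h. f (Q (y + h)))"
  proof (rule majorized_has_sum[OF \<rho>])
    show "majorized \<rho> (\<Prod>i\<in>UNIV. \<epsilon> ^ \<alpha> i) (\<lambda>h. \<Prod>i\<in>UNIV. (Q (y + h) $ i - Q y $ i) ^ \<alpha> i)" for \<alpha>
      using \<epsilon> by (intro majorized_prod majorized_power \<rho> g) auto
    show "((\<lambda>\<alpha>. \<bar>c \<alpha>\<bar> * (\<Prod>i\<in>UNIV. \<epsilon> ^ \<alpha> i)) has_sum (infsum (\<lambda>\<alpha>. \<bar>c \<alpha>\<bar> * (\<Prod>i\<in>UNIV. \<epsilon> ^ \<alpha> i)) UNIV)) UNIV"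
      using cs by (rule has_sum_infsum)
    fix h :: "real^'m" assume "h \<in> polydisc \<rho>"
    from f'[OF dQ[OF this]]
    show "((\<lambda>\<alpha>. c \<alpha> * (\<Prod>i\<in>UNIV. (Q (y + h) $ i - Q y $ i) ^ \<alpha> i)) has_sum f (Q (y + h))) UNIV"
      by (simp add: monomial_def)
  qed
  then obtain d where d: "\<And>h. h \<in> polydisc \<rho> \<Longrightarrow> ((\<lambda>\<alpha>. d \<alpha> * monomial \<alpha> h) has_sum f (Q (y + h))) UNIV"
    unfolding majorized_def by meson
  show "\<exists>c r. r > 0 \<and> (\<forall>x\<in>ball y r. ((\<lambda>\<alpha>. c \<alpha> * (\<Prod>i\<in>UNIV. (x $ i - y $ i) ^ \<alpha> i)) has_sum f (Q x)) UNIV)"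
  proof (intro exI conjI ballI)
    fix x assume "x \<in> ball y \<rho>"
    then have "x - y \<in> polydisc \<rho>" by (intro ball_subset_polydisc) (simp add: dist_norm norm_minus_commute)
    from d[OF this] show "((\<lambda>\<alpha>. d \<alpha> * (\<Prod>i\<in>UNIV. (x $ i - y $ i) ^ \<alpha> i)) has_sum f (Q x)) UNIV"
      by (simp add: monomial_def)
  qed (rule \<rho>)
qed

section \<open>Regularity under projective maps\<close>

text \<open>The projective map that takes \<open>b\<close> to \<open>p\<close> with derivative the
  identity there. It serves as the map from the deformed body back to \<open>K\<close>; its inverse
  has the same form, with \<open>a\<close> negated and \<open>b\<close>, \<open>p\<close>
  exchanged.\<close>

definition proj_map :: "real^'n \<Rightarrow> real^'n \<Rightarrow> real^'n \<Rightarrow> real^'n \<Rightarrow> real^'n" where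
  "proj_map a b p y = p + (y - b) /\<^sub>R (1 + a \<bullet> (y - b))"

text \<open>The increment of the \<open>i\<close>-th coordinate is exactly
  \<open>(m i \<bullet> h) / (D + a \<bullet> h)\<close>, a linear form times a geometric series.
  Its norm is at most \<open>l1 (m i) * \<rho> * (2 / D)\<close> and so becomes small with
  \<rho>.\<close>

lemma real_analytic_on_proj_map:
  fixes f :: "real^'n \<Rightarrow> real"
  assumes f: "real_analytic_on U f"
    and V: "\<And>y. y \<in> V \<Longrightarrow> 1 + a \<bullet> (y - b) > 0 \<and> proj_map a b p y \<in> U"
  shows "real_analytic_on V (\<lambda>y. f (proj_map a b p y))"
proof (rule real_analytic_on_substitute[OF f], intro conjI)
  fix y and \<epsilon> :: real assume y: "y \<in> V" and \<epsilon>: "\<epsilon> > 0"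
  show "proj_map a b p y \<in> U" using V[OF y] by simp
  define z where "z = y - b"
  define D where "D = 1 + a \<bullet> z"
  have D: "D > 0" using V[OF y] by (simp add: D_def z_def)
  define m where "m i = axis i 1 - (z $ i / D) *\<^sub>R a" for i
  define l1 where "l1 v = (\<Sum>j\<in>UNIV. \<bar>v $ j\<bar>)" for v :: "real^'n"
  have l1: "l1 v \<ge> 0" for v by (simp add: l1_def sum_nonneg)
  \<comment> \<open>\<open>N\<close> bounds the sums of absolute coordinates of \<open>a\<close> and
    of all \<open>m i\<close> at once, so one \<rho> serves every coordinate; the summand 1 makes it
    positive.\<close>
  define N where "N = 1 + l1 a + (\<Sum>i\<in>UNIV. l1 (m i))"
  have mN: "l1 (m i) \<le> N" for i
    using member_le_sum[of i UNIV "\<lambda>i. l1 (m i)"] l1 by (simp add: N_def add_increasing)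
  have aN: "l1 a \<le> N" using l1 by (simp add: N_def sum_nonneg)
  have N: "N > 0" using l1 by (simp add: N_def add_pos_nonneg sum_nonneg)
  define \<rho> where "\<rho> = min (D / (2 * N)) (\<epsilon> * D / (2 * N))"
  have \<rho>: "\<rho> > 0" using D N \<epsilon> by (simp add: \<rho>_def)
  have \<rho>1: "N * \<rho> \<le> D / 2" and \<rho>2: "N * \<rho> \<le> \<epsilon> * D / 2"
    using N by (auto simp: \<rho>_def min_def field_simps)
  have aD: "l1 a * \<rho> \<le> D / 2" using mult_right_mono[OF aN, of \<rho>] \<rho> \<rho>1 by linarith
  have maj: "majorized \<rho> \<epsilon> (\<lambda>h. proj_map a b p (y + h) $ i - proj_map a b p y $ i)" for i
  proof -
    have "majorized \<rho> (l1 (m i) * \<rho> * (2 / D)) (\<lambda>h. (m i \<bullet> h) * (1 / (D + a \<bullet> h)))"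
      unfolding l1_def using aD D
      by (intro majorized_mult majorized_linear majorized_inverse_linear \<rho>) (auto simp: l1_def)
    moreover have "l1 (m i) * \<rho> * (2 / D) \<le> \<epsilon>"
    proof -
      have "l1 (m i) * \<rho> \<le> \<epsilon> * D / 2" using mult_right_mono[OF mN[of i], of \<rho>] \<rho> \<rho>2 by linarith
      then show ?thesis using D by (simp add: field_simps)
    qed
    ultimately have "majorized \<rho> \<epsilon> (\<lambda>h. (m i \<bullet> h) * (1 / (D + a \<bullet> h)))"
      by (rule majorized_mono)
    then show ?thesis
    proof (rule majorized_cong)
      fix h :: "real^'n" assume h: "h \<in> polydisc \<rho>"
      have "\<bar>a \<bullet> h\<bar> \<le> (\<Sum>i\<in>UNIV. \<bar>a $ i * h $ i\<bar>)" by (simp add: inner_vec_def)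
      also have "\<dots> \<le> (\<Sum>i\<in>UNIV. \<bar>a $ i\<bar> * \<rho>)"
        using h by (intro sum_mono) (auto simp: abs_mult polydisc_def intro!: mult_left_mono)
      finally have "\<bar>a \<bullet> h\<bar> \<le> l1 a * \<rho>" by (simp add: l1_def sum_distrib_right)
      then have Dh: "D + a \<bullet> h > 0" using aD D by linarith
      have e: "y + h - b = z + h" "1 + a \<bullet> (z + h) = D + a \<bullet> h"
        by (auto simp: D_def z_def inner_diff_right inner_add_right)
      have "proj_map a b p (y + h) $ i - proj_map a b p y $ i = (z $ i + h $ i) / (D + a \<bullet> h) - z $ i / D"
        unfolding proj_map_def e by (simp add: z_def[symmetric] D_def[symmetric] divide_inverse mult.commute)
      also have "\<dots> = (h $ i - z $ i / D * (a \<bullet> h)) * (1 / (D + a \<bullet> h))"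
        using D Dh by (simp add: field_simps)
      also have "h $ i - z $ i / D * (a \<bullet> h) = m i \<bullet> h"
        by (simp add: m_def inner_diff_left inner_axis')
      finally show "(m i \<bullet> h) * (1 / (D + a \<bullet> h)) = proj_map a b p (y + h) $ i - proj_map a b p y $ i" ..
    qed
  qed
  show "\<exists>\<rho>>0. \<forall>i. majorized \<rho> \<epsilon> (\<lambda>h. proj_map a b p (y + h) $ i - proj_map a b p y $ i)"
    using \<rho> maj by blast
qed

lemma real_analytic_on_affine: "real_analytic_on U (\<lambda>x. u \<bullet> x - c :: real)"
  unfolding real_analytic_on_def
proof
  fix p :: "real^'a"
  \<comment> \<open>The option type lists the monomials that occur: \<open>None\<close> is the
    constant term, \<open>Some i\<close> the \<open>i\<close>-th coordinate.\<close>
  define a where "a j = (case j of None \<Rightarrow> u \<bullet> p - c | Some i \<Rightarrow> u $ i)" for j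
  define m where "m j = (case j of None \<Rightarrow> (\<lambda>_. 0) | Some i \<Rightarrow> (\<lambda>k. if k = i then 1 else 0 :: nat))" for j :: "'a option"
  have fin: "finite (UNIV :: 'a option set)" by simp
  have "majorized 1 (\<Sum>j\<in>UNIV. \<bar>a j\<bar> * 1 ^ sum (m j) UNIV) (\<lambda>h. \<Sum>j\<in>UNIV. a j * monomial (m j) h)"
    by (rule majorized_regroup[where a = a and m = m]) (auto intro!: has_sum_finiteI)
  moreover have "(\<Sum>j\<in>UNIV. a j * monomial (m j) h) = u \<bullet> (p + h) - c" for h
    by (simp add: UNIV_option_conv sum.reindex a_def m_def monomial_def if_distrib inner_add_right
        cong: if_cong) (simp add: inner_vec_def)
  ultimately obtain d where d: "\<And>h. h \<in> polydisc 1 \<Longrightarrow>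
      ((\<lambda>\<alpha>. d \<alpha> * monomial \<alpha> h) has_sum (u \<bullet> (p + h) - c)) UNIV"
    unfolding majorized_def by auto
  show "\<exists>d r. r > 0 \<and> (\<forall>x\<in>ball p r. ((\<lambda>\<alpha>. d \<alpha> * (\<Prod>i\<in>UNIV. (x $ i - p $ i) ^ \<alpha> i)) has_sum u \<bullet> x - c) UNIV)"
  proof (intro exI conjI ballI)
    fix x assume "x \<in> ball p 1"
    then have "x - p \<in> polydisc 1" by (intro ball_subset_polydisc) (simp add: dist_norm norm_minus_commute)
    from d[OF this] show "((\<lambda>\<alpha>. d \<alpha> * (\<Prod>i\<in>UNIV. (x $ i - p $ i) ^ \<alpha> i)) has_sum u \<bullet> x - c) UNIV"
      by (simp add: monomial_def)
  qed simp
qed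

section \<open>Calculus of iterated partial derivatives\<close>

lemma Ck_on_cong:
  assumes "open U" "\<And>x. x \<in> U \<Longrightarrow> f x = g x" "Ck_on k U f"
  shows "Ck_on k U g"
  using assms(2,3)
proof (induction k arbitrary: f g)
  case 0 then show ?case using continuous_on_cong by fastforce
next
  case (Suc k)
  have d: "(g has_derivative frechet_derivative f (at x)) (at x)" if "x \<in> U" for x
  proof -
    have "(f has_derivative frechet_derivative f (at x)) (at x)"
      using Suc.prems(2) that assms(1) by (simp add: differentiable_on_eq_differentiable_at frechet_derivative_works[symmetric])
    then show ?thesis
      using has_derivative_transform_within_open[OF _ assms(1) that] Suc.prems(1) by blast
  qed
  have "g differentiable_on U"
    using d differentiableI assms(1) by (auto simp: differentiable_on_eq_differentiable_at differentiable_def)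
  moreover have "Ck_on k U (\<lambda>x. frechet_derivative g (at x) (axis i 1))" for i
  proof (rule Suc.IH)
    show "Ck_on k U (\<lambda>x. frechet_derivative f (at x) (axis i 1))" using Suc.prems(2) by simp
    show "frechet_derivative f (at x) (axis i 1) = frechet_derivative g (at x) (axis i 1)" if "x \<in> U" for x
      using frechet_derivative_at[OF d[OF that]] by simp
  qed
  ultimately show ?case by simp
qed

text \<open>\<open>Ck_on\<close> speaks of \<open>frechet_derivative\<close>, a choice. By
  uniqueness of derivatives on an open set an explicit formula may take its place.\<close>

lemma Ck_on_SucI:
  assumes "open U" "\<And>x. x \<in> U \<Longrightarrow> (f has_derivative f' x) (at x)" "\<And>i. Ck_on k U (\<lambda>x. f' x (axis i 1))"
  shows "Ck_on (Suc k) U f"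
proof -
  have "f differentiable_on U"
    using assms(1,2) by (auto simp: differentiable_on_eq_differentiable_at differentiable_def)
  moreover have "Ck_on k U (\<lambda>x. frechet_derivative f (at x) (axis i 1))" for i
    by (rule Ck_on_cong[OF assms(1) _ assms(3)[of i]]) (simp add: frechet_derivative_at[OF assms(2), symmetric])
  ultimately show ?thesis by simp
qed

lemma Ck_on_has_derivative:
  "open U \<Longrightarrow> Ck_on (Suc k) U f \<Longrightarrow> x \<in> U \<Longrightarrow> (f has_derivative frechet_derivative f (at x)) (at x)"
  by (simp add: differentiable_on_eq_differentiable_at frechet_derivative_works[symmetric])

lemma Ck_on_Suc_imp: "Ck_on (Suc k) U f \<Longrightarrow> Ck_on k U f"
proof (induction k arbitrary: f)
  case 0 then show ?case by (simp add: differentiable_imp_continuous_on)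
next
  case (Suc k)
  have "Ck_on k U (\<lambda>x. frechet_derivative f (at x) (axis i 1))" for i
    by (rule Suc.IH) (use Suc.prems in simp)
  then show ?case using Suc.prems by simp
qed

lemma Ck_on_const: "open U \<Longrightarrow> Ck_on k U (\<lambda>_. c)"
proof (induction k arbitrary: c)
  case (Suc k)
  show ?case by (rule Ck_on_SucI[where f' = "\<lambda>_ _. 0"]) (use Suc in auto)
qed simp

lemma Ck_on_add:
  assumes "open U" shows "Ck_on k U f \<Longrightarrow> Ck_on k U g \<Longrightarrow> Ck_on k U (\<lambda>x. f x + g x)"
proof (induction k arbitrary: f g)
  case (Suc k)
  show ?case
    by (rule Ck_on_SucI[OF assms has_derivative_add[OF Ck_on_has_derivative[OF assms Suc.prems(1)] Ck_on_has_derivative[OF assms Suc.prems(2)]]])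
       (use Suc in auto)
qed (auto intro: continuous_on_add)

lemma Ck_on_mult:
  assumes "open U" shows "Ck_on k U f \<Longrightarrow> Ck_on k U g \<Longrightarrow> Ck_on k U (\<lambda>x. f x * g x)"
proof (induction k arbitrary: f g)
  case (Suc k)
  show ?case
    by (rule Ck_on_SucI[OF assms has_derivative_mult[OF Ck_on_has_derivative[OF assms Suc.prems(1)] Ck_on_has_derivative[OF assms Suc.prems(2)]]])
       (use Suc Suc.prems[THEN Ck_on_Suc_imp] in \<open>auto intro!: Ck_on_add assms\<close>)
qed (auto intro: continuous_on_mult)

lemma Ck_on_sum:
  assumes "open U" shows "finite I \<Longrightarrow> (\<And>i. i \<in> I \<Longrightarrow> Ck_on k U (f i)) \<Longrightarrow> Ck_on k U (\<lambda>x. \<Sum>i\<in>I. f i x)"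
  by (induction I rule: finite_induct) (auto intro!: Ck_on_add Ck_on_const assms)

lemma Ck_on_affine: 
  assumes "open U" shows "Ck_on k U (\<lambda>x. u \<bullet> x - c)"
proof (cases k)
  case (Suc j)
  show ?thesis unfolding Suc
    by (rule Ck_on_SucI[where f' = "\<lambda>_ h. u \<bullet> h"]) (auto intro!: derivative_eq_intros Ck_on_const assms)
qed (auto intro!: continuous_intros)

text \<open>The derivative is a constant multiple of the square of the function itself, so the
  induction feeds on its own hypothesis.\<close>

lemma Ck_on_inverse_affine:
  assumes "open U" "\<And>x. x \<in> U \<Longrightarrow> 1 + a \<bullet> (x - b) > 0"
  shows "Ck_on k U (\<lambda>x. inverse (1 + a \<bullet> (x - b)))"
proof (induction k)
  case 0
  show ?case using assms(2) by (auto intro!: continuous_intros) fastforce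
next
  case (Suc k)
  show ?case
  proof (rule Ck_on_SucI[OF assms(1), where f' = "\<lambda>x h. - (inverse (1 + a \<bullet> (x - b)) * (a \<bullet> h) * inverse (1 + a \<bullet> (x - b)))"])
    show "((\<lambda>x. inverse (1 + a \<bullet> (x - b))) has_derivative
       (\<lambda>h. - (inverse (1 + a \<bullet> (x - b)) * (a \<bullet> h) * inverse (1 + a \<bullet> (x - b))))) (at x)" if "x \<in> U" for x
      using assms(2)[OF that] by (auto intro!: derivative_eq_intros)
    fix i :: 'a
    have "Ck_on k U (\<lambda>x. (- (a \<bullet> axis i 1)) * (inverse (1 + a \<bullet> (x - b)) * inverse (1 + a \<bullet> (x - b))))"
      by (intro Ck_on_mult Ck_on_const assms(1) Suc)
    then show "Ck_on k U (\<lambda>x. - (inverse (1 + a \<bullet> (x - b)) * (a \<bullet> axis i 1) * inverse (1 + a \<bullet> (x - b))))"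
      by (simp add: mult.commute mult.left_commute)
  qed
qed

definition proj_deriv :: "real^'n \<Rightarrow> real^'n \<Rightarrow> real^'n \<Rightarrow> real^'n \<Rightarrow> real^'n" where
  "proj_deriv a b y h = inverse (1 + a \<bullet> (y - b)) *\<^sub>R h
      - (inverse (1 + a \<bullet> (y - b)) * (a \<bullet> h) * inverse (1 + a \<bullet> (y - b))) *\<^sub>R (y - b)"

lemma has_derivative_proj_map:
  assumes "1 + a \<bullet> (y - b) > 0"
  shows "(proj_map a b p has_derivative proj_deriv a b y) (at y)"
  unfolding proj_map_def[abs_def] proj_deriv_def[abs_def]
  using assms by (auto intro!: derivative_eq_intros simp: algebra_simps)

text \<open>Surjectivity keeps the derivative of a composition \<open>f (proj_map a b p y)\<close>
  from vanishing. The witness comes from pairing the equation with \<open>a\<close>: since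
  \<open>a \<bullet> z = D - 1\<close>, this gives
  \<open>a \<bullet> h = D\<^sup>2 * (a \<bullet> k)\<close>, and then \<open>h\<close> can be
  solved for.\<close>

lemma proj_deriv_surj:
  assumes "1 + a \<bullet> (y - b) > 0"
  shows "\<exists>h. proj_deriv a b y h = k"
proof
  define z where "z = y - b" 
  define D where "D = 1 + a \<bullet> z"
  have D: "D > 0" using assms by (simp add: D_def z_def)
  have az: "a \<bullet> z = D - 1" by (simp add: D_def)
  have "inverse D * (a \<bullet> (D *\<^sub>R (k + (a \<bullet> k) *\<^sub>R z))) * inverse D = (a \<bullet> k)"
    using D by (simp add: inner_add_right az field_simps)
  then show "proj_deriv a b y (D *\<^sub>R (k + (a \<bullet> k) *\<^sub>R z)) = k"
    unfolding proj_deriv_def z_def[symmetric] D_def[symmetric] using D by simp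
qed

text \<open>By the chain rule each partial derivative of the composition is a finite sum of products
  of a partial derivative of \<open>f\<close>, composed with the map, and a rational coefficient.
  The induction over \<open>k\<close> therefore runs for all \<open>f\<close> together.\<close>

lemma Ck_on_proj_map:
  assumes U: "open U" and V: "open V" "\<And>y. y \<in> V \<Longrightarrow> 1 + a \<bullet> (y - b) > 0 \<and> proj_map a b p y \<in> U"
  shows "Ck_on k U f \<Longrightarrow> Ck_on k V (\<lambda>y. f (proj_map a b p y))"
proof (induction k arbitrary: f)
  case 0
  have "continuous_on V (proj_map a b p)"
    by (intro continuous_at_imp_continuous_on ballI has_derivative_continuous[OF has_derivative_proj_map])
       (use V(2) in auto)
  then show ?case
    using 0 V(2) continuous_on_compose2[of U f V "proj_map a b p"] by (simp add: subset_eq)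
next
  case (Suc k)
  define D where "D x = frechet_derivative f (at x)" for x
  have D: "(f has_derivative D x) (at x)" if "x \<in> U" for x
    unfolding D_def by (rule Ck_on_has_derivative[OF U Suc.prems that])
  show ?case
  proof (rule Ck_on_SucI[OF V(1), where f' = "\<lambda>y h. D (proj_map a b p y) (proj_deriv a b y h)"])
    show "((\<lambda>y. f (proj_map a b p y)) has_derivative (\<lambda>h. D (proj_map a b p y) (proj_deriv a b y h))) (at y)"
      if "y \<in> V" for y
      using has_derivative_compose[OF has_derivative_proj_map D] V(2)[OF that] by blast
    fix i :: 'a
    have comp: "Ck_on k V (\<lambda>y. proj_deriv a b y (axis i 1) $ j)" for j
    proof -
      have inv: "Ck_on k V (\<lambda>y. inverse (1 + a \<bullet> (y - b)))"
        using Ck_on_inverse_affine[OF V(1)] V(2) by blast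
      have aff: "Ck_on k V (\<lambda>y. axis j 1 \<bullet> y - b $ j)"
        by (rule Ck_on_affine[OF V(1)])
      have "Ck_on k V (\<lambda>y. inverse (1 + a \<bullet> (y - b)) * (axis i 1 $ j) +
          (- a $ i) * (inverse (1 + a \<bullet> (y - b)) * inverse (1 + a \<bullet> (y - b)) * (axis j 1 \<bullet> y - b $ j)))"
        by (intro Ck_on_add Ck_on_mult Ck_on_const V(1) inv aff)
      then show ?thesis
        by (rule Ck_on_cong[OF V(1), rotated])
           (simp add: proj_deriv_def inner_axis inner_axis' algebra_simps)
    qed
    have "Ck_on k V (\<lambda>y. \<Sum>j\<in>UNIV. D (proj_map a b p y) (axis j 1) * (proj_deriv a b y (axis i 1) $ j))"
    proof (intro Ck_on_sum[OF V(1)] Ck_on_mult[OF V(1)] comp Suc.IH)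
      show "Ck_on k U (\<lambda>x. D x (axis j 1))" for j using Suc.prems by (simp add: D_def)
    qed simp
    then show "Ck_on k V (\<lambda>y. D (proj_map a b p y) (proj_deriv a b y (axis i 1)))"
    proof (rule Ck_on_cong[OF V(1), rotated])
      fix y assume "y \<in> V"
      then have lin: "linear (D (proj_map a b p y))"
        using D V(2) has_derivative_linear by blast
      have "D (proj_map a b p y) v = (\<Sum>j\<in>UNIV. D (proj_map a b p y) (axis j 1) * (v $ j))" for v
      proof -
        have "D (proj_map a b p y) (\<Sum>j\<in>UNIV. (v $ j) *\<^sub>R axis j 1) = (\<Sum>j\<in>UNIV. (v $ j) *\<^sub>R D (proj_map a b p y) (axis j 1))"
          by (simp add: linear_sum[OF lin] linear_scale[OF lin])
        then show ?thesis by (simp add: basis_expansion[of v, unfolded scalar_mult_eq_scaleR] mult.commute)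
      qed
      then show "(\<Sum>j\<in>UNIV. D (proj_map a b p y) (axis j 1) * (proj_deriv a b y (axis i 1) $ j))
          = D (proj_map a b p y) (proj_deriv a b y (axis i 1))" by (rule sym)
    qed
  qed
qed

lemma regular_on_proj_map:
  assumes "open U" "open V" "\<And>y. y \<in> V \<Longrightarrow> 1 + a \<bullet> (y - b) > 0 \<and> proj_map a b p y \<in> U" "regular_on r U f"
  shows "regular_on r V (\<lambda>y. f (proj_map a b p y))"
proof (cases r)
  case C_omega
  then show ?thesis using real_analytic_on_proj_map[of U f V a b p] assms(3,4) by simp
qed (use Ck_on_proj_map[OF assms(1-3)] assms(4) in auto)

text \<open>As hypersurfaces are given by local equations, it suffices to pull back the equation;
  its derivative stays nonzero because \<open>proj_deriv\<close> is onto.\<close>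

lemma hypersurface_of_class_proj_map:
  assumes "hypersurface_of_class r M"
  shows "hypersurface_of_class r {y. 1 + a \<bullet> (y - b) > 0 \<and> proj_map a b p y \<in> M}" (is "hypersurface_of_class r ?M")
  unfolding hypersurface_of_class_def
proof
  fix y assume y: "y \<in> ?M"
  have "\<exists>U f. open U \<and> proj_map a b p y \<in> U \<and> regular_on r U f \<and>
        (\<forall>x\<in>U. f differentiable (at x) \<and> frechet_derivative f (at x) \<noteq> (\<lambda>_. 0)) \<and>
        M \<inter> U = {x\<in>U. f x = 0}"
    by (rule bspec[OF assms[unfolded hypersurface_of_class_def]]) (use y in simp)
  then obtain U f where Uf: "open U \<and> proj_map a b p y \<in> U \<and> regular_on r U f \<and>
        (\<forall>x\<in>U. f differentiable (at x) \<and> frechet_derivative f (at x) \<noteq> (\<lambda>_. 0)) \<and>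
        M \<inter> U = {x\<in>U. f x = 0}"
    by (elim exE) (rule that)
  note U = Uf[THEN conjunct1] Uf[THEN conjunct2, THEN conjunct1]
     Uf[THEN conjunct2, THEN conjunct2, THEN conjunct1]
     Uf[THEN conjunct2, THEN conjunct2, THEN conjunct2, THEN conjunct1, rule_format]
     Uf[THEN conjunct2, THEN conjunct2, THEN conjunct2, THEN conjunct2]
  define O' where "O' = {y. 1 + a \<bullet> (y - b) > 0}"
  define V where "V = O' \<inter> proj_map a b p -` U"
  have O': "open O'"
    unfolding O'_def by (intro open_Collect_less continuous_intros)
  have "continuous_on O' (proj_map a b p)"
    by (intro continuous_at_imp_continuous_on ballI has_derivative_continuous[OF has_derivative_proj_map])
       (auto simp: O'_def)
  then have V: "open V" unfolding V_def
    using O' U(1) continuous_on_open_vimage[of O' "proj_map a b p"] by (metis inf_commute)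
  have V2: "\<And>y. y \<in> V \<Longrightarrow> 1 + a \<bullet> (y - b) > 0 \<and> proj_map a b p y \<in> U"
    by (auto simp: V_def O'_def)
  show "\<exists>V g. open V \<and> y \<in> V \<and> regular_on r V g \<and>
        (\<forall>x\<in>V. g differentiable (at x) \<and> frechet_derivative g (at x) \<noteq> (\<lambda>_. 0)) \<and>
        ?M \<inter> V = {x\<in>V. g x = 0}"
  proof (intro exI conjI ballI)
    show "open V" by (rule V)
    show "y \<in> V" using y U(2) by (simp add: V_def O'_def)
    show "regular_on r V (\<lambda>y. f (proj_map a b p y))"
      by (rule regular_on_proj_map[OF U(1) V V2 U(3)])
    show "?M \<inter> V = {x\<in>V. f (proj_map a b p x) = 0}" using U(5) V2 by auto
    fix x assume x: "x \<in> V"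
    let ?D = "frechet_derivative f (at (proj_map a b p x))"
    have D: "((\<lambda>y. f (proj_map a b p y)) has_derivative (\<lambda>h. ?D (proj_deriv a b x h))) (at x)"
      using V2[OF x] U(4)[of "proj_map a b p x", unfolded frechet_derivative_works]
      by (intro has_derivative_compose[OF has_derivative_proj_map]) simp_all
    then show "(\<lambda>y. f (proj_map a b p y)) differentiable (at x)" by (rule differentiableI)
    show "frechet_derivative (\<lambda>y. f (proj_map a b p y)) (at x) \<noteq> (\<lambda>_. 0)"
    proof
      assume "frechet_derivative (\<lambda>y. f (proj_map a b p y)) (at x) = (\<lambda>_. 0)"
      then have z: "?D (proj_deriv a b x h) = 0" for h using frechet_derivative_at[OF D] by metis
      have "?D k = 0" for k
      proof -
        obtain h where "proj_deriv a b x h = k" using proj_deriv_surj V2[OF x] by blast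
        then show ?thesis using z[of h] by simp
      qed
      then have "?D = (\<lambda>_. 0)" by (rule ext)
      then show False using U(4)[of "proj_map a b p x"] V2[OF x] by simp
    qed
  qed
qed

lemma hypersurface_of_class_hyperplane:
  assumes "u \<noteq> 0" shows "hypersurface_of_class r {x. u \<bullet> x = c}"
  unfolding hypersurface_of_class_def
proof (intro ballI exI conjI)
  have d: "((\<lambda>x. u \<bullet> x - c) has_derivative (\<lambda>h. u \<bullet> h)) (at x)" for x
    by (auto intro!: derivative_eq_intros)
  show "regular_on r UNIV (\<lambda>x. u \<bullet> x - c)"
    by (cases r) (auto intro!: Ck_on_affine real_analytic_on_affine)
  show "(\<lambda>x. u \<bullet> x - c) differentiable (at x)" for x using d by (rule differentiableI)
  show "frechet_derivative (\<lambda>x. u \<bullet> x - c) (at x) \<noteq> (\<lambda>_. 0)" for x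
    using frechet_derivative_at[OF d] assms inner_eq_zero_iff[of u] by metis
qed auto

section \<open>Kuratowski convergence\<close>

text \<open>Painleve-Kuratowski convergence. For unbounded limits it is convergence in \<^const>\<open>dist_bh\<close>:
  the preimages of the limit under the stereographic projection then accumulate at the pole, which is
  the only point added by compactification.\<close>

definition kconv :: "(nat \<Rightarrow> 'a::metric_space set) \<Rightarrow> 'a set \<Rightarrow> bool" where
  "kconv K L \<longleftrightarrow> (\<forall>j. K j \<noteq> {}) \<and> (\<forall>x\<in>L. (\<lambda>j. infdist x (K j)) \<longlonglongrightarrow> 0) \<and>
     (\<forall>r \<xi> x. strict_mono (r :: nat \<Rightarrow> nat) \<longrightarrow> (\<forall>j. \<xi> j \<in> K (r j)) \<longrightarrow> \<xi> \<longlonglongrightarrow> x \<longrightarrow> x \<in> L)"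

lemma kconv_limit_in:
  "kconv K L \<Longrightarrow> strict_mono r \<Longrightarrow> (\<And>j. \<xi> j \<in> K (r j)) \<Longrightarrow> \<xi> \<longlonglongrightarrow> x \<Longrightarrow> x \<in> L"
  unfolding kconv_def by blast

lemma kconv_nonempty: "kconv K L \<Longrightarrow> K j \<noteq> {}"
  unfolding kconv_def by blast

lemma kconv_infdist: "kconv K L \<Longrightarrow> x \<in> L \<Longrightarrow> (\<lambda>j. infdist x (K j)) \<longlonglongrightarrow> 0"
  unfolding kconv_def by blast

lemma infdist_tendsto_0_imp_seq:
  assumes "\<And>j. K j \<noteq> {}" "(\<lambda>j. infdist x (K j)) \<longlonglongrightarrow> 0"
  obtains \<xi> where "\<And>j. \<xi> j \<in> K j" "\<xi> \<longlonglongrightarrow> x"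
proof -
  have "\<exists>y\<in>K j. dist x y < infdist x (K j) + inverse (real (Suc j))" for j
  proof (rule ccontr)
    assume "\<not> ?thesis"
    then have "infdist x (K j) + inverse (real (Suc j)) \<le> dist x y" if "y \<in> K j" for y
      using that by force
    then have "infdist x (K j) + inverse (real (Suc j)) \<le> infdist x (K j)"
      using assms(1) by (subst (2) infdist_notempty) (auto intro: cINF_greatest)
    moreover have "inverse (real (Suc j)) > 0" by simp
    ultimately show False by linarith
  qed
  then obtain \<xi> where \<xi>: "\<And>j. \<xi> j \<in> K j" "\<And>j. dist x (\<xi> j) < infdist x (K j) + inverse (real (Suc j))"
    by metis
  have "(\<lambda>j. infdist x (K j) + inverse (real (Suc j))) \<longlonglongrightarrow> 0 + 0"
    by (intro tendsto_add assms(2) LIMSEQ_inverse_real_of_nat)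
  then have "(\<lambda>j. dist x (\<xi> j)) \<longlonglongrightarrow> 0"
    unfolding add_0_left
    by (rule tendsto_sandwich[rotated 2, OF tendsto_const])
       (use \<xi>(2) in \<open>auto intro!: always_eventually less_imp_le simp del: of_nat_Suc\<close>)
  then have "\<xi> \<longlonglongrightarrow> x" by (subst tendsto_dist_iff) (simp add: dist_commute)
  with \<xi>(1) show ?thesis by (rule that)
qed

lemma infdist_tendsto_0I:
  assumes "\<forall>\<^sub>F j in sequentially. \<xi> j \<in> K j" "\<xi> \<longlonglongrightarrow> x"
  shows "(\<lambda>j. infdist x (K j)) \<longlonglongrightarrow> 0"
proof (rule tendsto_sandwich[OF _ _ tendsto_const])
  show "(\<lambda>j. dist x (\<xi> j)) \<longlonglongrightarrow> 0" using assms(2) tendsto_dist_iff[of \<xi> x sequentially] by (simp add: dist_commute)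
  show "\<forall>\<^sub>F j in sequentially. infdist x (K j) \<le> dist x (\<xi> j)"
    using assms(1) by eventually_elim (rule infdist_le)
qed (auto simp: infdist_nonneg)

text \<open>The points approached by the sets \<open>K j\<close> form a closed set. This allows a
  boundary point of a limit to be pushed inwards first, where membership can be checked
  exactly.\<close>

lemma infdist_tendsto_0_closure:
  assumes "\<And>e. e > 0 \<Longrightarrow> \<exists>y. dist x y < e \<and> (\<lambda>j. infdist y (K j)) \<longlonglongrightarrow> 0"
  shows "(\<lambda>j. infdist x (K j)) \<longlonglongrightarrow> 0"
proof (rule tendstoI)
  fix e :: real assume "e > 0"
  then obtain y where y: "dist x y < e / 2" "(\<lambda>j. infdist y (K j)) \<longlonglongrightarrow> 0"
    using assms[of "e / 2"] by auto
  have "\<forall>\<^sub>F j in sequentially. infdist y (K j) < e / 2"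
    using order_tendstoD(2)[OF y(2), of "e / 2"] \<open>e > 0\<close> by simp
  then show "\<forall>\<^sub>F j in sequentially. dist (infdist x (K j)) 0 < e"
  proof eventually_elim
    case (elim j)
    then show ?case using infdist_triangle[of x "K j" y] y(1) infdist_nonneg[of x "K j"]
      by (simp add: dist_real_def)
  qed
qed

lemma kconv_seq:
  assumes "kconv K L" "x \<in> L"
  obtains \<xi> where "\<And>j. \<xi> j \<in> K j" "\<xi> \<longlonglongrightarrow> x"
  using infdist_tendsto_0_imp_seq[of K x] assms unfolding kconv_def by metis

lemma kconv_subseq:
  assumes "kconv K L" "strict_mono r" shows "kconv (\<lambda>j. K (r j)) L"
  unfolding kconv_def
proof (intro conjI allI ballI impI)
  fix x assume "x \<in> L"
  from LIMSEQ_subseq_LIMSEQ[OF kconv_infdist[OF assms(1) this] assms(2)]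
  show "(\<lambda>j. infdist x (K (r j))) \<longlonglongrightarrow> 0" by (simp add: o_def)
next
  fix s \<xi> x assume s: "strict_mono s" "\<forall>j. \<xi> j \<in> K (r (s j))" "\<xi> \<longlonglongrightarrow> x"
  have "strict_mono (r \<circ> s)" using assms(2) s(1) by (rule strict_mono_o)
  from kconv_limit_in[OF assms(1) this _ s(3)] s(2) show "x \<in> L" by simp
qed (use assms(1) in \<open>auto simp: kconv_def\<close>)

lemma kconv_const: "closed L \<Longrightarrow> L \<noteq> {} \<Longrightarrow> kconv (\<lambda>_. L) L"
  unfolding kconv_def using closed_sequentially by auto

lemma kconv_translation:
  fixes b :: "nat \<Rightarrow> 'a::real_normed_vector"
  assumes "kconv K L" "b \<longlonglongrightarrow> c"
  shows "kconv (\<lambda>j. (+) (b j) ` K j) ((+) c ` L)"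
  unfolding kconv_def
proof (intro conjI allI ballI impI)
  fix x assume "x \<in> (+) c ` L"
  then obtain y where y: "y \<in> L" "x = c + y" by auto
  obtain \<xi> where \<xi>: "\<And>j. \<xi> j \<in> K j" "\<xi> \<longlonglongrightarrow> y" using kconv_seq[OF assms(1) y(1)] by blast
  show "(\<lambda>j. infdist x ((+) (b j) ` K j)) \<longlonglongrightarrow> 0"
    by (rule infdist_tendsto_0I[where \<xi> = "\<lambda>j. b j + \<xi> j"])
       (use \<xi> assms(2) y in \<open>auto intro!: tendsto_add\<close>)
next
  fix s \<xi> x assume s: "strict_mono s" "\<forall>j. \<xi> j \<in> (+) (b (s j)) ` K (s j)" "\<xi> \<longlonglongrightarrow> x"
  have "x - c \<in> L"
  proof (rule kconv_limit_in[OF assms(1) s(1)])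
    show "(\<lambda>j. \<xi> j - b (s j)) \<longlonglongrightarrow> x - c"
      using LIMSEQ_subseq_LIMSEQ[OF assms(2) s(1)] by (intro tendsto_diff s(3)) (simp add: o_def)
    show "\<xi> j - b (s j) \<in> K (s j)" for j using s(2)[rule_format, of j] by auto
  qed
  then show "x \<in> (+) c ` L" by (rule rev_image_eqI) simp
qed (use kconv_nonempty[OF assms(1)] in auto)

text \<open>The segments from points near \<open>y \<in> L\<close> to far away points of \<open>K\<^sub>j\<close> converge to a ray.\<close>

lemma kconv_direction:
  fixes L :: "(real^'n) set"
  assumes "kconv K L" "\<And>j. convex (K j)" "strict_mono r" "\<And>j. x j \<in> K (r j)"
    and c: "\<And>j. c j > 0" "c \<longlonglongrightarrow> 0" "(\<lambda>j. c j *\<^sub>R x j) \<longlonglongrightarrow> v"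
  shows "v \<in> recession_cone L"
proof -
  have "y + v \<in> L" if y: "y \<in> L" for y
  proof -
    obtain \<xi> where \<xi>: "\<And>j. \<xi> j \<in> K j" "\<xi> \<longlonglongrightarrow> y" using kconv_seq[OF assms(1) y] by blast
    define \<eta> where "\<eta> j = (1 - c j) *\<^sub>R \<xi> (r j) + c j *\<^sub>R x j" for j
    have "\<eta> \<longlonglongrightarrow> (1 - 0) *\<^sub>R y + v" unfolding \<eta>_def
      using LIMSEQ_subseq_LIMSEQ[OF \<xi>(2) assms(3)] by (intro tendsto_intros c) (simp add: o_def)
    then have lim: "\<eta> \<longlonglongrightarrow> y + v" by simp
    have "\<forall>\<^sub>F j in sequentially. c j < 1" using order_tendstoD(2)[OF c(2), of 1] by simp
    then obtain N where N: "\<And>j. j \<ge> N \<Longrightarrow> c j < 1" unfolding eventually_sequentially by blast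
    show ?thesis
    proof (rule kconv_limit_in[OF assms(1)])
      show "strict_mono (\<lambda>j. r (j + N))" using assms(3) by (simp add: strict_mono_def)
      show "(\<lambda>j. \<eta> (j + N)) \<longlonglongrightarrow> y + v" using lim by (rule LIMSEQ_ignore_initial_segment)
      show "\<eta> (j + N) \<in> K (r (j + N))" for j
        unfolding \<eta>_def using N[of "j + N"] c(1)[of "j + N"]
        by (intro convexD_alt assms(2) \<xi>(1) assms(4)) auto
    qed
  qed
  then show ?thesis by (auto simp: recession_cone_def)
qed

lemma bounded_limit_points_tendsto:
  fixes X :: "nat \<Rightarrow> 'a::heine_borel"
  assumes "bounded (range X)" and q: "\<And>r l. strict_mono r \<Longrightarrow> (\<lambda>j. X (r j)) \<longlonglongrightarrow> l \<Longrightarrow> l = q"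
  shows "X \<longlonglongrightarrow> q"
proof (rule ccontr)
  assume "\<not> X \<longlonglongrightarrow> q"
  then obtain e where e: "e > 0" "\<not> (\<forall>\<^sub>F j in sequentially. dist (X j) q < e)"
    unfolding tendsto_iff by blast
  then obtain r :: "nat \<Rightarrow> nat" where r: "strict_mono r" "\<And>j. \<not> dist (X (r j)) q < e"
    using not_eventually_sequentiallyD by blast
  have "bounded (range (X \<circ> r))" using assms(1) by (rule bounded_subset) auto
  then obtain l s where s: "strict_mono s" "((X \<circ> r) \<circ> s) \<longlonglongrightarrow> l"
    using bounded_imp_convergent_subsequence by blast
  then have lim: "(\<lambda>j. X (r (s j))) \<longlonglongrightarrow> l" by (simp add: o_def)
  have "l = q" by (rule q[OF _ lim[folded o_def[of r s]]]) (use strict_mono_o[OF r(1) s(1)] in \<open>simp_all add: o_def lim\<close>)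
  then have "\<forall>\<^sub>F j in sequentially. dist (X (r (s j))) q < e" using lim e(1) tendstoD by blast
  then show False using r(2) by (auto simp: eventually_sequentially)
qed

text \<open>Otherwise unit normals separating \<open>x j\<close> from \<open>K j\<close> along a
  subsequence accumulate at some \<open>u\<close>, and \<open>u\<close> attains its maximum over
  \<open>L\<close> at the interior point \<open>l\<close>. Convexity thus upgrades approximation to
  membership near interior points of the limit.\<close>

lemma kconv_eventually_in:
  fixes L :: "(real^'n) set"
  assumes "kconv K L" "\<And>j. convex (K j)" "\<And>j. closed (K j)" and x: "x \<longlonglongrightarrow> l" "l \<in> interior L"
  shows "\<forall>\<^sub>F j in sequentially. x j \<in> K j"
proof (rule ccontr)
  assume "\<not> ?thesis"
  then obtain r :: "nat \<Rightarrow> nat" where r: "strict_mono r" "\<And>j. x (r j) \<notin> K (r j)"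
    using not_eventually_sequentiallyD by blast
  have "\<exists>a. norm a = 1 \<and> (\<forall>y\<in>K (r j). a \<bullet> y \<le> a \<bullet> x (r j))" for j
  proof -
    obtain a b where ab: "a \<bullet> x (r j) < b" "\<And>y. y \<in> K (r j) \<Longrightarrow> b < a \<bullet> y"
      using separating_hyperplane_closed_point[OF assms(2,3) r(2)] by blast
    obtain y where "y \<in> K (r j)" using kconv_nonempty[OF assms(1)] by blast
    then have "a \<noteq> 0" using ab by fastforce
    then show ?thesis using ab
      by (intro exI[of _ "- a /\<^sub>R norm a"]) (force simp: field_simps)
  qed
  then obtain a where a: "\<And>j. norm (a j) = 1" "\<And>j y. y \<in> K (r j) \<Longrightarrow> a j \<bullet> y \<le> a j \<bullet> x (r j)"
    by metis
  have "bounded (range a)" by (rule boundedI[of _ 1]) (auto simp: a)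
  then obtain u s where s: "strict_mono s" "(a \<circ> s) \<longlonglongrightarrow> u"
    using bounded_imp_convergent_subsequence by blast
  then have au: "(\<lambda>j. a (s j)) \<longlonglongrightarrow> u" by (simp add: o_def)
  have nu: "norm u = 1" using tendsto_norm[OF au] a(1) by (simp add: LIMSEQ_const_iff)
  have rs: "strict_mono (\<lambda>j. r (s j))" using strict_mono_o[OF r(1) s(1)] by (simp add: o_def)
  have le: "u \<bullet> y \<le> u \<bullet> l" if y: "y \<in> L" for y
  proof -
    obtain \<xi> where \<xi>: "\<And>j. \<xi> j \<in> K j" "\<xi> \<longlonglongrightarrow> y" using kconv_seq[OF assms(1) y] by blast
    have 1: "(\<lambda>j. a (s j) \<bullet> \<xi> (r (s j))) \<longlonglongrightarrow> u \<bullet> y"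
      using LIMSEQ_subseq_LIMSEQ[OF \<xi>(2) rs] by (intro tendsto_inner au) (simp add: o_def)
    have 2: "(\<lambda>j. a (s j) \<bullet> x (r (s j))) \<longlonglongrightarrow> u \<bullet> l"
      using LIMSEQ_subseq_LIMSEQ[OF x(1) rs] by (intro tendsto_inner au) (simp add: o_def)
    show ?thesis by (rule LIMSEQ_le[OF 1 2]) (use a(2) \<xi>(1) in auto)
  qed
  obtain e where e: "e > 0" "cball l e \<subseteq> L" using x(2) by (auto simp: mem_interior_cball)
  have "l + e *\<^sub>R u \<in> L" using e nu by (intro subsetD[OF e(2)]) (simp add: dist_norm)
  from le[OF this] have "e * (u \<bullet> u) \<le> 0" by (simp add: inner_add_right)
  then show False using e(1) nu by (simp add: norm_eq_1)
qed

text \<open>The closest points stay bounded, and each of their limit points lies in \<open>L\<close>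
  at distance at most \<open>dist l q\<close> from \<open>l\<close>; uniqueness of the closest point
  identifies it.\<close>

lemma kconv_closest_point:
  fixes L :: "(real^'n) set"
  assumes "kconv K L" "\<And>j. closed (K j)" "closed L" "convex L" "L \<noteq> {}" and z: "z \<longlonglongrightarrow> l"
  shows "(\<lambda>j. closest_point (K j) (z j)) \<longlonglongrightarrow> closest_point L l"
proof (rule bounded_limit_points_tendsto)
  define q where "q = closest_point L l"
  have q: "q \<in> L" unfolding q_def using assms(3,5) by (rule closest_point_in_set)
  obtain \<xi> where \<xi>: "\<And>j. \<xi> j \<in> K j" "\<xi> \<longlonglongrightarrow> q" using kconv_seq[OF assms(1) q] by blast
  have le: "dist (z j) (closest_point (K j) (z j)) \<le> dist (z j) (\<xi> j)" for j
    by (rule closest_point_le[OF assms(2) \<xi>(1)])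
  have dz: "(\<lambda>j. dist (z j) (\<xi> j)) \<longlonglongrightarrow> dist l q" by (intro tendsto_dist z \<xi>)
  have "bounded (range z)" "bounded (range (\<lambda>j. dist (z j) (\<xi> j)))"
    using z dz by (auto intro: convergent_imp_bounded)
  then obtain A B where "\<And>j. norm (z j) \<le> A" "\<And>j. norm (dist (z j) (\<xi> j)) \<le> B"
    by (auto simp: bounded_iff)
  then have "norm (closest_point (K j) (z j)) \<le> A + B" for j
    using le[of j] norm_triangle_ineq3[of "z j" "closest_point (K j) (z j)"]
    by (smt (verit) dist_norm norm_triangle_ineq4 norm_minus_commute real_norm_def norm_triangle_sub)
  then show "bounded (range (\<lambda>j. closest_point (K j) (z j)))" by (auto intro!: boundedI)
  fix r x assume r: "strict_mono r" and x: "(\<lambda>j. closest_point (K (r j)) (z (r j))) \<longlonglongrightarrow> x"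
  have "x \<in> L"
    by (rule kconv_limit_in[OF assms(1) r _ x]) (rule closest_point_in_set[OF assms(2) kconv_nonempty[OF assms(1)]])
  moreover have "dist l x \<le> dist l q"
  proof (rule LIMSEQ_le)
    show "(\<lambda>j. dist (z (r j)) (closest_point (K (r j)) (z (r j)))) \<longlonglongrightarrow> dist l x"
      using LIMSEQ_subseq_LIMSEQ[OF z r] by (intro tendsto_dist x) (simp add: o_def)
    show "(\<lambda>j. dist (z (r j)) (\<xi> (r j))) \<longlonglongrightarrow> dist l q"
      using LIMSEQ_subseq_LIMSEQ[OF dz r] by (simp add: o_def)
  qed (use le in auto)
  ultimately show "x = closest_point L l"
    using assms(3,4) closest_point_le[OF assms(3)] unfolding q_def
    by (intro closest_point_unique[symmetric, THEN sym]) (auto intro: order_trans)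
qed

section \<open>Kuratowski convergence and the bounded-Hausdorff distance\<close>

definition stereo_inv :: "real^'n \<Rightarrow> (real^'n) \<times> real" where
  "stereo_inv x = ((2 / ((norm x)\<^sup>2 + 1)) *\<^sub>R x, ((norm x)\<^sup>2 - 1) / ((norm x)\<^sup>2 + 1))"

lemma norm_square_plus_one_pos: "(norm x)\<^sup>2 + 1 > 0"
  by (smt (verit) zero_le_power2)

lemma dist_stereo_inv_pole: "(dist (stereo_inv x) (0, 1))\<^sup>2 = 4 / ((norm x)\<^sup>2 + 1)"
proof -
  define d where "d = (norm x)\<^sup>2 + 1"
  have d: "d > 0" unfolding d_def by (rule norm_square_plus_one_pos)
  have "(dist (stereo_inv x) (0, 1))\<^sup>2 = (norm ((2/d) *\<^sub>R x))\<^sup>2 + ((d - 2) / d - 1)\<^sup>2"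
    by (simp add: stereo_inv_def dist_norm norm_Pair d_def power_divide)
  also have "(norm ((2/d) *\<^sub>R x))\<^sup>2 = 4 * (d - 1) / d\<^sup>2"
    by (simp add: power_mult_distrib power_divide d_def)
  also have "(d - 2) / d - 1 = - 2 / d" using d by (simp add: field_simps)
  also have "4 * (d - 1) / d\<^sup>2 + (- 2 / d)\<^sup>2 = 4 / d"
    using d by (simp add: power_divide add_divide_distrib[symmetric] power2_eq_square)
  finally show ?thesis by (simp add: d_def)
qed

lemma stereo_inv_in_punctured_sphere: "stereo_inv x \<in> punctured_sphere"
proof -
  define d where "d = (norm x)\<^sup>2 + 1"
  have d: "d > 0" unfolding d_def by (rule norm_square_plus_one_pos)
  have "(norm (stereo_inv x))\<^sup>2 = (norm ((2/d) *\<^sub>R x))\<^sup>2 + ((d - 2) / d)\<^sup>2"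
    by (simp add: stereo_inv_def norm_Pair d_def power_divide)
  also have "(norm ((2/d) *\<^sub>R x))\<^sup>2 = 4 * (d - 1) / d\<^sup>2"
    by (simp add: power_mult_distrib power_divide d_def)
  also have "4 * (d - 1) / d\<^sup>2 + ((d - 2) / d)\<^sup>2 = (4 * (d - 1) + (d - 2)\<^sup>2) / d\<^sup>2"
    by (simp add: power_divide add_divide_distrib)
  also have "4 * (d - 1) + (d - 2)\<^sup>2 = d\<^sup>2" by algebra
  finally have "norm (stereo_inv x) = 1" using d norm_ge_zero[of "stereo_inv x"] power2_eq_1_iff[of "norm (stereo_inv x)"] by auto
  moreover have "stereo_inv x \<noteq> (0, 1)"
    using d by (auto simp: stereo_inv_def d_def[symmetric] d_def field_simps)
  ultimately show ?thesis by (simp add: punctured_sphere_def)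
qed

lemma stereo_stereo_inv [simp]: "stereo (stereo_inv x) = x"
proof -
  define d where "d = (norm x)\<^sup>2 + 1"
  have d: "d > 0" unfolding d_def by (rule norm_square_plus_one_pos)
  have "stereo (stereo_inv x) = ((2 / d) *\<^sub>R x) /\<^sub>R (1 - (d - 2) / d)"
    by (simp add: stereo_def stereo_inv_def d_def)
  also have "1 - (d - 2) / d = 2 / d" using d by (simp add: field_simps)
  finally show ?thesis using d by simp
qed

lemma stereo_inv_stereo:
  assumes "p \<in> punctured_sphere" shows "stereo_inv (stereo p) = p"
proof -
  obtain y s where p: "p = (y, s)" by (cases p)
  have s: "s \<noteq> 1" using north_pole_snd[OF assms] p by simp
  have "(norm y)\<^sup>2 + s\<^sup>2 = 1" using assms by (auto simp: p punctured_sphere_def norm_Pair)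
  then have ns: "(norm y)\<^sup>2 = (1 - s) * (1 + s)" by (simp add: power2_eq_square algebra_simps)
  have "(norm (stereo p))\<^sup>2 = (norm y)\<^sup>2 / (1 - s)\<^sup>2"
    by (simp add: stereo_def p power_mult_distrib divide_inverse power_inverse mult.commute)
  also have "\<dots> = (1 + s) / (1 - s)" using s unfolding ns by (simp add: power2_eq_square)
  finally have n: "(norm (stereo p))\<^sup>2 = (1 + s) / (1 - s)" .
  have 1: "(1 + s) / (1 - s) + 1 = 2 / (1 - s)" using s by (simp add: field_simps)
  have 2: "((1 + s) / (1 - s) - 1) / (2 / (1 - s)) = s" using s by (simp add: field_simps)
  have 3: "2 / (2 / (1 - s)) = 1 - s" using s by simp
  have "(1 - s) *\<^sub>R stereo p = y" using s by (simp add: stereo_def p)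
  then show ?thesis unfolding stereo_inv_def n 1 2 3 by (simp add: p)
qed

lemma stereo_preimage_eq_image: "stereo_preimage A = stereo_inv ` A"
proof
  show "stereo_preimage A \<subseteq> stereo_inv ` A"
    using stereo_inv_stereo by (force simp: stereo_preimage_def)
  show "stereo_inv ` A \<subseteq> stereo_preimage A"
    by (auto simp: stereo_preimage_def stereo_inv_in_punctured_sphere)
qed

lemma tendsto_stereo_inv: "(f \<longlongrightarrow> x) F \<Longrightarrow> ((\<lambda>j. stereo_inv (f j)) \<longlongrightarrow> stereo_inv x) F"
  unfolding stereo_inv_def using norm_square_plus_one_pos[of x]
  by (intro tendsto_intros) auto

lemma tendsto_stereo:
  "(f \<longlongrightarrow> p) F \<Longrightarrow> p \<in> punctured_sphere \<Longrightarrow> ((\<lambda>j. stereo (f j)) \<longlongrightarrow> stereo p) F"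
  unfolding stereo_def using north_pole_snd[of p] by (intro tendsto_intros) auto

lemma pole_in_closure_stereo_preimage:
  assumes "\<not> bounded A" shows "(0, 1) \<in> closure (stereo_preimage A)"
  unfolding closure_approachable
proof (intro allI impI)
  fix e :: real assume e: "e > 0"
  \<comment> \<open>The chordal distance from \<open>stereo_inv x\<close> to the pole is the square
    root of \<open>4 / ((norm x)\<^sup>2 + 1)\<close>, which drops below \<open>e\<close> once
    \<open>norm x > 2 / e\<close>.\<close>
  obtain x where x: "x \<in> A" "norm x > 2 / e" using assms unfolding bounded_iff by (meson not_le)
  have "2 < norm x * e" using x(2) e by (simp add: field_simps)
  then have "4 < (norm x * e)\<^sup>2" using power_strict_mono[of 2 "norm x * e" 2] by simp
  also have "\<dots> \<le> e\<^sup>2 * ((norm x)\<^sup>2 + 1)" by (simp add: power_mult_distrib algebra_simps)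
  finally have "(dist (stereo_inv x) (0, 1))\<^sup>2 < e\<^sup>2"
    using norm_square_plus_one_pos[of x] by (simp add: dist_stereo_inv_pole divide_less_eq)
  then have "dist (stereo_inv x) (0, 1) < e" using e by (simp add: power_less_imp_less_base)
  then show "\<exists>y\<in>stereo_preimage A. dist y (0, 1) < e"
    using x(1) by (auto simp: stereo_preimage_eq_image)
qed

lemma kconv_of_dist_bh:
  assumes "\<And>j. K j \<noteq> {}" "closed L" "L \<noteq> {}" and lim: "(\<lambda>j. dist_bh (K j) L) \<longlonglongrightarrow> 0"
  shows "kconv K L"
  unfolding kconv_def
proof (intro conjI allI ballI impI)
  note ne = stereo_preimage_nonempty stereo_preimage_bounded
  fix x assume x: "x \<in> L"
  have "(\<lambda>j. infdist (stereo_inv x) (stereo_preimage (K j))) \<longlonglongrightarrow> 0"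
  proof (rule tendsto_sandwich[OF _ _ tendsto_const lim])
    show "\<forall>\<^sub>F j in sequentially. infdist (stereo_inv x) (stereo_preimage (K j)) \<le> dist_bh (K j) L"
      unfolding dist_bh_def
    proof (subst hausdorff_dist_commute, intro always_eventually allI infdist_le_hausdorff_dist)
      show "stereo_inv x \<in> stereo_preimage L" using x by (simp add: stereo_preimage_eq_image)
    qed (use assms in \<open>auto simp: ne\<close>)
  qed (auto simp: infdist_nonneg)
  then obtain \<xi> where \<xi>: "\<And>j. \<xi> j \<in> stereo_preimage (K j)" "\<xi> \<longlonglongrightarrow> stereo_inv x"
    using infdist_tendsto_0_imp_seq[of "\<lambda>j. stereo_preimage (K j)"] assms(1) ne(1) by metis
  show "(\<lambda>j. infdist x (K j)) \<longlonglongrightarrow> 0"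
  proof (rule infdist_tendsto_0I)
    show "(\<lambda>j. stereo (\<xi> j)) \<longlonglongrightarrow> x"
      using tendsto_stereo[OF \<xi>(2) stereo_inv_in_punctured_sphere] by simp
    show "\<forall>\<^sub>F j in sequentially. stereo (\<xi> j) \<in> K j"
      using \<xi>(1) by (simp add: stereo_preimage_def)
  qed
next
  note ne = stereo_preimage_nonempty stereo_preimage_bounded
  fix r \<xi> x assume r: "strict_mono r" "\<forall>j. \<xi> j \<in> K (r j)" "\<xi> \<longlonglongrightarrow> x"
  have "(\<lambda>j. infdist (stereo_inv (\<xi> j)) (stereo_preimage L)) \<longlonglongrightarrow> 0"
  proof (rule tendsto_sandwich[OF _ _ tendsto_const])
    show "(\<lambda>j. dist_bh (K (r j)) L) \<longlonglongrightarrow> 0" using LIMSEQ_subseq_LIMSEQ[OF lim r(1)] by (simp add: o_def)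
    show "\<forall>\<^sub>F j in sequentially. infdist (stereo_inv (\<xi> j)) (stereo_preimage L) \<le> dist_bh (K (r j)) L"
      unfolding dist_bh_def
    proof (intro always_eventually allI infdist_le_hausdorff_dist)
      show "stereo_inv (\<xi> j) \<in> stereo_preimage (K (r j))" for j
        using r(2) by (simp add: stereo_preimage_eq_image)
    qed (use assms in \<open>auto simp: ne\<close>)
  qed (auto simp: infdist_nonneg)
  moreover have "(\<lambda>j. infdist (stereo_inv (\<xi> j)) (stereo_preimage L)) \<longlonglongrightarrow> infdist (stereo_inv x) (stereo_preimage L)"
    by (intro tendsto_infdist tendsto_stereo_inv r)
  ultimately have "infdist (stereo_inv x) (stereo_preimage L) = 0" by (rule LIMSEQ_unique[symmetric])
  then have "stereo_inv x \<in> closure (stereo_preimage L)"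
    using ne(1)[OF assms(3)] by (simp add: in_closure_iff_infdist_zero)
  from stereo_preimage_closure[OF assms(2) this stereo_inv_in_punctured_sphere]
  show "x \<in> L" by simp
qed (use assms in auto)

lemma dist_bh_nonneg: "0 \<le> dist_bh A B"
proof (cases "A = {} \<or> B = {}")
  case True then show ?thesis by (auto simp: dist_bh_def hausdorff_dist_def stereo_preimage_def)
next
  case False then show ?thesis
    unfolding dist_bh_def by (intro hausdorff_dist_nonneg) (auto simp: stereo_preimage_nonempty stereo_preimage_bounded)
qed

text \<open>Points violating one of the two inclusions have a limit on the compact sphere. If it is
  not the pole, it projects to a point where Kuratowski convergence applies; the pole itself lies in
  the closure of the preimage of \<open>L\<close> because \<open>L\<close> is unbounded.\<close>

lemma dist_bh_tendsto_0:
  fixes L :: "(real^'n) set"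
  assumes K: "kconv K L" and L: "\<not> bounded L"
  shows "(\<lambda>j. dist_bh (K j) L) \<longlonglongrightarrow> 0"
proof (rule tendstoI)
  fix e :: real assume e: "e > 0"
  have Lne: "L \<noteq> {}" using L by auto
  note ne = stereo_preimage_nonempty[OF kconv_nonempty[OF K]] stereo_preimage_nonempty[OF Lne] stereo_preimage_bounded
  have sub: "\<exists>s :: nat \<Rightarrow> nat. \<exists>l\<in>sphere 0 1. strict_mono s \<and> (p \<circ> s) \<longlonglongrightarrow> l"
    if "\<And>j. p j \<in> punctured_sphere" for p :: "nat \<Rightarrow> (real^'n) \<times> real"
  proof -
    have "seq_compact (sphere (0::(real^'n) \<times> real) 1)" by (simp add: compact_imp_seq_compact)
    moreover have "\<forall>j. p j \<in> sphere 0 1" using that by (auto simp: punctured_sphere_def)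
    ultimately obtain l s where "l \<in> sphere 0 1" "strict_mono s" "(p \<circ> s) \<longlonglongrightarrow> l"
      using seq_compactE[of "sphere 0 1" p] by blast
    then show ?thesis by blast
  qed
  have 1: "\<forall>\<^sub>F j in sequentially. \<forall>p\<in>stereo_preimage (K j). infdist p (stereo_preimage L) \<le> e / 2"
  proof (rule ccontr)
    assume "\<not> ?thesis"
    then obtain r :: "nat \<Rightarrow> nat" where r: "strict_mono r"
      "\<And>j. \<not> (\<forall>p\<in>stereo_preimage (K (r j)). infdist p (stereo_preimage L) \<le> e / 2)"
      using not_eventually_sequentiallyD by blast
    then obtain p where p: "\<And>j. p j \<in> stereo_preimage (K (r j))" "\<And>j. infdist (p j) (stereo_preimage L) > e / 2"
      by (metis not_le)
    then obtain s l where s: "strict_mono s" "l \<in> sphere 0 1" "(p \<circ> s) \<longlonglongrightarrow> l"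
      using sub[of p] by (auto simp: stereo_preimage_def)
    have lim: "(\<lambda>j. p (s j)) \<longlonglongrightarrow> l" using s(3) by (simp add: o_def)
    have "l \<in> closure (stereo_preimage L)"
    proof (cases "l = (0, 1)")
      case True then show ?thesis using pole_in_closure_stereo_preimage[OF L] by simp
    next
      case False
      then have l: "l \<in> punctured_sphere" using s(2) by (simp add: punctured_sphere_def)
      have "stereo l \<in> L"
      proof (rule kconv_limit_in[OF K])
        show "strict_mono (r \<circ> s)" by (rule strict_mono_o) fact+
        show "(\<lambda>j. stereo (p (s j))) \<longlonglongrightarrow> stereo l" by (rule tendsto_stereo[OF lim l])
        show "stereo (p (s j)) \<in> K ((r \<circ> s) j)" for j using p(1) by (simp add: stereo_preimage_def)
      qed
      then have "l \<in> stereo_preimage L" using l by (simp add: stereo_preimage_def)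
      then show ?thesis using closure_subset by blast
    qed
    then have "infdist l (stereo_preimage L) = 0" using ne(2) by (simp add: in_closure_iff_infdist_zero)
    moreover have "(\<lambda>j. infdist (p (s j)) (stereo_preimage L)) \<longlonglongrightarrow> infdist l (stereo_preimage L)"
      by (intro tendsto_infdist lim)
    ultimately have "e / 2 \<le> 0"
      using p(2) by (intro LIMSEQ_le[OF tendsto_const]) (auto intro!: exI less_imp_le)
    then show False using e by simp
  qed
  have 2: "\<forall>\<^sub>F j in sequentially. \<forall>p\<in>stereo_preimage L. infdist p (stereo_preimage (K j)) \<le> e / 2"
  proof (rule ccontr)
    assume "\<not> ?thesis"
    then obtain r :: "nat \<Rightarrow> nat" where r: "strict_mono r"
      "\<And>j. \<not> (\<forall>p\<in>stereo_preimage L. infdist p (stereo_preimage (K (r j))) \<le> e / 2)"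
      using not_eventually_sequentiallyD by blast
    then obtain p where p: "\<And>j. p j \<in> stereo_preimage L" "\<And>j. infdist (p j) (stereo_preimage (K (r j))) > e / 2"
      by (metis not_le)
    then obtain s l where s: "strict_mono s" "l \<in> sphere 0 1" "(p \<circ> s) \<longlonglongrightarrow> l"
      using sub[of p] by (auto simp: stereo_preimage_def)
    have lim: "(\<lambda>j. p (s j)) \<longlonglongrightarrow> l" using s(3) by (simp add: o_def)
    have "l \<in> closure (stereo_preimage L)"
      unfolding closure_sequential using lim p(1) by (intro exI[of _ "\<lambda>j. p (s j)"]) auto
    \<comment> \<open>The limit may be the pole, which is no \<open>stereo_inv x\<close>; a nearby
      point coming from \<open>L\<close> stands in for it.\<close>
    then obtain x where x: "x \<in> L" "dist (stereo_inv x) l < e / 4"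
      unfolding closure_approachable stereo_preimage_eq_image using e by (metis (no_types, lifting) divide_pos_pos imageE zero_less_numeral)
    obtain \<xi> where \<xi>: "\<And>j. \<xi> j \<in> K j" "\<xi> \<longlonglongrightarrow> x" using kconv_seq[OF K x(1)] by blast
    have rs: "strict_mono (\<lambda>j. r (s j))" using r(1) s(1) by (simp add: strict_mono_def)
    have "(\<lambda>j. dist (p (s j)) (stereo_inv (\<xi> (r (s j))))) \<longlonglongrightarrow> dist l (stereo_inv x)"
      using LIMSEQ_subseq_LIMSEQ[OF \<xi>(2) rs] by (intro tendsto_dist lim tendsto_stereo_inv) (simp add: o_def)
    then have "\<forall>\<^sub>F j in sequentially. dist (p (s j)) (stereo_inv (\<xi> (r (s j)))) < e / 4"
      using x(2) by (intro order_tendstoD) (auto simp: dist_commute)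
    then obtain j where "dist (p (s j)) (stereo_inv (\<xi> (r (s j)))) < e / 4"
      by (auto simp: eventually_sequentially)
    moreover have "infdist (p (s j)) (stereo_preimage (K (r (s j)))) \<le> dist (p (s j)) (stereo_inv (\<xi> (r (s j))))"
      using \<xi>(1) by (intro infdist_le) (simp add: stereo_preimage_eq_image)
    ultimately show False using p(2)[of "s j"] e by linarith
  qed
  show "\<forall>\<^sub>F j in sequentially. dist (dist_bh (K j) L) 0 < e"
    using 1 2
  proof eventually_elim
    case (elim j)
    then have "dist_bh (K j) L \<le> e / 2"
      unfolding dist_bh_def using ne by (subst hausdorff_dist_le_iff) auto
    then show ?case using dist_bh_nonneg[of "K j" L] e by (simp add: dist_real_def)
  qed
qed

text \<open>The metric splits into two distances, and each is replaced by Kuratowski convergence.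
  For the second one the limit is the recession cone, which therefore has to be unbounded and closed
  too.\<close>

lemma limitin_asymptotic_topology_iff:
  fixes L :: "(real^'n) set"
  assumes K: "\<And>j. K j \<in> Kn" and L: "L \<in> Kn" and rcL: "\<not> bounded (recession_cone L)"
    and cl: "closed (recession_cone L)"
  shows "limitin asymptotic_topology K L sequentially \<longleftrightarrow>
     kconv K L \<and> kconv (\<lambda>j. recession_cone (K j)) (recession_cone L)"
proof -
  interpret Metric_space "Kn :: (real^'n) set set" dist_a by (rule Metric_space_dist_a)
  have "limitin asymptotic_topology K L sequentially \<longleftrightarrow> (\<lambda>j. dist_a (K j) L) \<longlonglongrightarrow> 0"
    unfolding asymptotic_topology_def limitin_metric
    using K L by (auto simp: tendsto_iff dist_real_def)
  also have "\<dots> \<longleftrightarrow> (\<lambda>j. dist_bh (K j) L) \<longlonglongrightarrow> 0 \<and>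
      (\<lambda>j. dist_bh (recession_cone (K j)) (recession_cone L)) \<longlonglongrightarrow> 0" (is "?l \<longleftrightarrow> ?r1 \<and> ?r2")
  proof
    assume l: ?l
    show "?r1 \<and> ?r2"
      by (intro conjI tendsto_sandwich[OF _ _ tendsto_const l]) (auto simp: dist_a_def dist_bh_nonneg)
  next
    assume "?r1 \<and> ?r2"
    then show ?l unfolding dist_a_def using tendsto_add[of "\<lambda>j. dist_bh (K j) L" 0] by fastforce
  qed
  also have "?r1 \<longleftrightarrow> kconv K L"
    using kconv_of_dist_bh[of K L] dist_bh_tendsto_0[of K L] K[THEN KnD] L KnD[OF L] by (auto simp: Kn_def)
  also have "?r2 \<longleftrightarrow> kconv (\<lambda>j. recession_cone (K j)) (recession_cone L)"
    using kconv_of_dist_bh[of "\<lambda>j. recession_cone (K j)" "recession_cone L"]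
       dist_bh_tendsto_0[of "\<lambda>j. recession_cone (K j)" "recession_cone L"] rcL cl recession_cone_nonempty by auto
  finally show ?thesis .
qed

text \<open>Both factors are metric, so sequences detect continuity: a failure at
  \<open>(L, t)\<close> yields a bad pair within \<open>1 / (i + 1)\<close> in each factor.\<close>

lemma continuous_map_asymptotic_topology:
  fixes F :: "(real^'n) set \<times> real \<Rightarrow> (real^'n) set"
  assumes FK: "\<And>K t. K \<in> Kn \<Longrightarrow> t \<in> {0..1} \<Longrightarrow> F (K, t) \<in> Kn"
    and lim: "\<And>K L s t. (\<And>j. K j \<in> Kn) \<Longrightarrow> L \<in> Kn \<Longrightarrow> limitin asymptotic_topology K L sequentially \<Longrightarrow>
        (\<And>j. s j \<in> {0..1}) \<Longrightarrow> t \<in> {0..1} \<Longrightarrow> s \<longlonglongrightarrow> t \<Longrightarrow>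
        limitin asymptotic_topology (\<lambda>j. F (K j, s j)) (F (L, t)) sequentially"
  shows "continuous_map (prod_topology asymptotic_topology (top_of_set {0..1})) asymptotic_topology F"
  unfolding continuous_map_def
proof (intro conjI allI impI)
  interpret Metric_space "Kn :: (real^'n) set set" dist_a by (rule Metric_space_dist_a)
  show "F \<in> topspace (prod_topology asymptotic_topology (top_of_set {0..1})) \<rightarrow> topspace asymptotic_topology"
    using FK by auto
  fix U assume U: "openin asymptotic_topology (U :: (real^'n) set set)"
  let ?S = "{p \<in> topspace (prod_topology asymptotic_topology (top_of_set {0..1})). F p \<in> U}"
  show "openin (prod_topology asymptotic_topology (top_of_set {0..1})) ?S"
    unfolding openin_prod_topology_alt
  proof (intro allI impI, rule ccontr)
    fix L t assume "(L, t) \<in> ?S"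
    then have L: "L \<in> Kn" and t: "t \<in> {0..1}" and FU: "F (L, t) \<in> U" by auto
    assume no: "\<not> (\<exists>V W. openin asymptotic_topology V \<and> openin (top_of_set {0..1}) W \<and> L \<in> V \<and> t \<in> W \<and> V \<times> W \<subseteq> ?S)"
    have "\<exists>K s. K \<in> Kn \<and> s \<in> {0..1} \<and> dist_a L K < inverse (real (Suc i)) \<and> dist t s < inverse (real (Suc i)) \<and> F (K, s) \<notin> U" for i
    proof -
      have "openin asymptotic_topology (mball L (inverse (real (Suc i))))"
        unfolding asymptotic_topology_def by simp
      moreover have "openin (top_of_set {0..1}) ({0..1} \<inter> ball t (inverse (real (Suc i))))"
        by (simp add: openin_open_Int)
      moreover have "L \<in> mball L (inverse (real (Suc i)))" "t \<in> {0..1} \<inter> ball t (inverse (real (Suc i)))"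
        using L t by auto
      ultimately have "\<not> (mball L (inverse (real (Suc i))) \<times> ({0..1} \<inter> ball t (inverse (real (Suc i)))) \<subseteq> ?S)"
        using no by blast
      then show ?thesis by (auto simp del: of_nat_Suc)
    qed
    then obtain K s where Ks: "\<And>i. K i \<in> Kn" "\<And>i. s i \<in> {0..1}" "\<And>i. dist_a L (K i) < inverse (real (Suc i))"
        "\<And>i. dist t (s i) < inverse (real (Suc i))" "\<And>i. F (K i, s i) \<notin> U" by metis
    have "limitin asymptotic_topology K L sequentially"
      unfolding asymptotic_topology_def limitin_metric
    proof (intro conjI L allI impI)
      fix e :: real assume "e > 0"
      then have "\<forall>\<^sub>F i in sequentially. inverse (real (Suc i)) < e"
        using LIMSEQ_inverse_real_of_nat by (simp add: order_tendsto_iff)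
      then show "\<forall>\<^sub>F i in sequentially. K i \<in> Kn \<and> dist_a (K i) L < e"
      proof eventually_elim
        case (elim i)
        then show ?case using Ks(1,3)[of i] by (simp add: commute)
      qed
    qed
    moreover have "s \<longlonglongrightarrow> t"
    proof (rule tendstoI)
      fix e :: real assume "e > 0"
      then have "\<forall>\<^sub>F i in sequentially. inverse (real (Suc i)) < e"
        using LIMSEQ_inverse_real_of_nat by (simp add: order_tendsto_iff)
      then show "\<forall>\<^sub>F i in sequentially. dist (s i) t < e"
      proof eventually_elim
        case (elim i)
        then show ?case using Ks(4)[of i] by (simp add: dist_commute)
      qed
    qed
    ultimately have "limitin asymptotic_topology (\<lambda>j. F (K j, s j)) (F (L, t)) sequentially"
      using lim Ks(1,2) L t by blast
    then have "\<forall>\<^sub>F j in sequentially. F (K j, s j) \<in> U"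
      using U FU unfolding limitin_def by blast
    then show False using Ks(5) by simp
  qed
qed

section \<open>Recession cones\<close>

lemma recession_coneD: "v \<in> recession_cone K \<Longrightarrow> x \<in> K \<Longrightarrow> x + v \<in> K"
  by (auto simp: recession_cone_def)

lemma recession_cone_zero: "0 \<in> recession_cone K"
  by (simp add: recession_cone_def)

lemma recession_cone_add: "v \<in> recession_cone K \<Longrightarrow> w \<in> recession_cone K \<Longrightarrow> v + w \<in> recession_cone K"
  by (auto simp: recession_cone_def subset_eq add.assoc[symmetric])

text \<open>A ray from one point \<open>x\<close> can be moved to any other point \<open>y\<close>:
  the points at fraction \<open>c = 1 / (n + 1)\<close> of the segments from \<open>y\<close> to
  \<open>x + (n + 1) *\<^sub>R v\<close> tend to \<open>y + v\<close>.\<close>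

lemma recession_cone_iff:
  assumes "closed K" "convex K" "x \<in> K"
  shows "v \<in> recession_cone K \<longleftrightarrow> (\<forall>l\<ge>0. x + l *\<^sub>R v \<in> K)"
proof
  assume v: "v \<in> recession_cone K"
  have n: "x + real n *\<^sub>R v \<in> K" for n
  proof (induction n)
    case (Suc n)
    then have "x + real n *\<^sub>R v + v \<in> K" by (rule recession_coneD[OF v])
    then show ?case by (simp add: algebra_simps)
  qed (use assms in simp)
  show "\<forall>l\<ge>0. x + l *\<^sub>R v \<in> K"
  proof (intro allI impI)
    fix l :: real assume l: "l \<ge> 0"
    obtain n :: nat where "l + 1 \<le> real n" using real_arch_simple by blast
    then have n': "l \<le> real n" "real n > 0" using l by auto
    have "(1 - l / real n) *\<^sub>R x + (l / real n) *\<^sub>R (x + real n *\<^sub>R v) \<in> K"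
      using n' l by (intro convexD_alt assms n) auto
    also have "(1 - l / real n) *\<^sub>R x + (l / real n) *\<^sub>R (x + real n *\<^sub>R v) = x + l *\<^sub>R v"
      using n' by (simp add: algebra_simps)
    finally show "x + l *\<^sub>R v \<in> K" .
  qed
next
  assume r: "\<forall>l\<ge>0. x + l *\<^sub>R v \<in> K"
  have "y + v \<in> K" if y: "y \<in> K" for y
  proof (rule closed_sequentially[OF assms(1)])
    let ?c = "\<lambda>n. inverse (real (Suc n))"
    show "(1 - ?c n) *\<^sub>R y + ?c n *\<^sub>R (x + real (Suc n) *\<^sub>R v) \<in> K" for n
      by (intro convexD_alt assms(2) y r[rule_format]) (auto simp: inverse_le_1_iff)
    have "(\<lambda>n. (1 - ?c n) *\<^sub>R y + ?c n *\<^sub>R x + v) \<longlonglongrightarrow> (1 - 0) *\<^sub>R y + 0 *\<^sub>R x + v"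
      by (intro tendsto_intros LIMSEQ_inverse_real_of_nat)
    then show "(\<lambda>n. (1 - ?c n) *\<^sub>R y + ?c n *\<^sub>R (x + real (Suc n) *\<^sub>R v)) \<longlonglongrightarrow> y + v"
      by (simp add: scaleR_add_right add.assoc del: of_nat_Suc)
  qed
  then show "v \<in> recession_cone K" by (auto simp: recession_cone_def)
qed

lemma recession_cone_scale:
  assumes "closed K" "convex K" "v \<in> recession_cone K" "l \<ge> 0"
  shows "l *\<^sub>R v \<in> recession_cone K"
proof -
  have "x + l *\<^sub>R v \<in> K" if "x \<in> K" for x
    using recession_cone_iff[OF assms(1,2) that, of v] assms(3,4) by blast
  then show ?thesis by (auto simp: recession_cone_def)
qed

lemma closed_recession_cone: "closed K \<Longrightarrow> closed (recession_cone K)"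
proof -
  assume "closed K"
  then have "closed {v. x + v \<in> K}" for x
    using continuous_closed_vimage[of K "\<lambda>v. x + v"] by (simp add: vimage_def continuous_intros)
  moreover have "recession_cone K = (\<Inter>x\<in>K. {v. x + v \<in> K})" by (auto simp: recession_cone_def)
  ultimately show ?thesis by auto
qed

lemma convex_recession_cone: "closed K \<Longrightarrow> convex K \<Longrightarrow> convex (recession_cone K)"
  by (auto simp: convex_def intro!: recession_cone_add recession_cone_scale)

lemma recession_cone_translation: "recession_cone ((+) b ` K) = recession_cone K"
  by (force simp: recession_cone_def add.assoc)

text \<open>One half of the convergence of recession cones is automatic from that of the bodies;
  only the approximation of directions of the limit carries further information.\<close>

lemma kconv_recession_cone_limit:
  fixes L :: "(real^'n) set"
  assumes "kconv K L" "strict_mono r" "\<And>j. v j \<in> recession_cone (K (r j))" "v \<longlonglongrightarrow> w"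
  shows "w \<in> recession_cone L"
proof -
  have "y + w \<in> L" if y: "y \<in> L" for y
  proof -
    obtain \<xi> where \<xi>: "\<And>j. \<xi> j \<in> K j" "\<xi> \<longlonglongrightarrow> y" using kconv_seq[OF assms(1) y] by blast
    show ?thesis
    proof (rule kconv_limit_in[OF assms(1,2)])
      show "(\<lambda>j. \<xi> (r j) + v j) \<longlonglongrightarrow> y + w"
        using LIMSEQ_subseq_LIMSEQ[OF \<xi>(2) assms(2)] by (intro tendsto_add assms(4)) (simp add: o_def)
    qed (use assms(3) \<xi>(1) recession_coneD in blast)
  qed
  then show ?thesis by (auto simp: recession_cone_def)
qed

lemma recession_direction_of_sequence:
  fixes K :: "(real^'n) set"
  assumes "closed K" "convex K" and x: "\<And>j. x j \<in> K" "\<And>j. norm (x j) > real j"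
  obtains y r where "norm y = 1" "y \<in> recession_cone K" "strict_mono (r :: nat \<Rightarrow> nat)"
    "(\<lambda>j. inverse (norm (x (r j)))) \<longlonglongrightarrow> 0" "(\<lambda>j. x (r j) /\<^sub>R norm (x (r j))) \<longlonglongrightarrow> y"
proof -
  define z where "z j = x j /\<^sub>R norm (x j)" for j
  have pos: "norm (x j) > 0" for j using x(2)[of j] by (smt (verit) of_nat_0_le_iff)
  have nz: "norm (z j) = 1" for j using pos[of j] by (simp add: z_def)
  have "bounded (range z)" by (rule boundedI[of _ 1]) (auto simp: nz)
  then obtain y r where r: "strict_mono r" "(z \<circ> r) \<longlonglongrightarrow> y"
    using bounded_imp_convergent_subsequence by blast
  then have zy: "(\<lambda>j. z (r j)) \<longlonglongrightarrow> y" by (simp add: o_def)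
  have inv: "(\<lambda>j. inverse (norm (x (r j)))) \<longlonglongrightarrow> 0"
  proof (rule tendsto_sandwich[OF _ _ tendsto_const])
    show "(\<lambda>j. inverse (real (r j))) \<longlonglongrightarrow> 0"
      using LIMSEQ_subseq_LIMSEQ[OF lim_inverse_n r(1)] by (simp add: o_def)
    show "\<forall>\<^sub>F j in sequentially. inverse (norm (x (r j))) \<le> inverse (real (r j))"
      using eventually_gt_at_top[of 0]
    proof eventually_elim
      case (elim j)
      then have "r j > 0" using strict_mono_imp_increasing[OF r(1), of j] by simp
      then show ?case using x(2)[of "r j"] by (intro le_imp_inverse_le) auto
    qed
  qed (use pos in \<open>auto intro!: always_eventually\<close>)
  have "norm y = 1" using tendsto_norm[OF zy] nz by (simp add: LIMSEQ_const_iff)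
  moreover have "y \<in> recession_cone K"
  proof (rule kconv_direction[OF kconv_const[OF assms(1)] assms(2) r(1)])
    show "K \<noteq> {}" using x(1) by blast
    show "x (r j) \<in> K" for j by (rule x)
    show "inverse (norm (x (r j))) > 0" for j using pos by simp
    show "(\<lambda>j. inverse (norm (x (r j)))) \<longlonglongrightarrow> 0" by (rule inv)
    show "(\<lambda>j. inverse (norm (x (r j))) *\<^sub>R x (r j)) \<longlonglongrightarrow> y" using zy by (simp add: z_def)
  qed
  ultimately show ?thesis using r(1) inv zy that unfolding z_def by blast
qed

lemma unbounded_recession_cone:
  fixes K :: "(real^'n) set"
  assumes "closed K" "convex K" "\<not> bounded K"
  shows "\<exists>v\<in>recession_cone K. norm v = 1"
proof -
  have "\<exists>x\<in>K. norm x > real j" for j using assms(3) unfolding bounded_iff by (meson not_le)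
  then obtain x where "\<And>j. x j \<in> K" "\<And>j. norm (x j) > real j" by metis
  from recession_direction_of_sequence[OF assms(1,2) this] show ?thesis by blast
qed

text \<open>The invariant of the projective flow. The last condition says that \<open>e\<close> lies
  in the relative interior of the dual of the recession cone: it is positive there except on the
  lines contained in \<open>X\<close>.\<close>

definition axial_body :: "real^'n \<Rightarrow> (real^'n) set \<Rightarrow> bool" where
  "axial_body e X \<longleftrightarrow> closed X \<and> convex X \<and> 0 \<in> interior X \<and> norm e = 1 \<and> e \<in> recession_cone X \<and>
     (\<forall>y\<in>recession_cone X. 0 \<le> e \<bullet> y \<and> (e \<bullet> y = 0 \<longrightarrow> - y \<in> recession_cone X))"

text \<open>Subtracting a multiple of \<open>e\<close> moves a functional that is bounded above on \<open>X\<close> to one that attains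
  its maximum. The maximizers of smallest norm cannot escape to infinity: their limit direction would
  be a line of \<open>X\<close>, along which they could be shortened.\<close>

lemma axial_body_attains_max:
  fixes X :: "(real^'n) set"
  assumes X: "axial_body e X" and u: "\<And>x. x \<in> X \<Longrightarrow> u \<bullet> x \<le> M" and \<epsilon>: "\<epsilon> > 0"
  obtains x0 where "x0 \<in> X" "\<And>x. x \<in> X \<Longrightarrow> (u - \<epsilon> *\<^sub>R e) \<bullet> x \<le> (u - \<epsilon> *\<^sub>R e) \<bullet> x0"
proof -
  have cl: "closed X" and cv: "convex X" and X0: "0 \<in> X" and ne: "norm e = 1" and eX: "e \<in> recession_cone X"
    using X interior_subset by (auto simp: axial_body_def)
  define w where "w = u - \<epsilon> *\<^sub>R e"
  have urc: "u \<bullet> y \<le> 0" if y: "y \<in> recession_cone X" for y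
  proof (rule ccontr)
    assume "\<not> ?thesis"
    then have p: "u \<bullet> y > 0" by simp
    have "0 + ((\<bar>M\<bar> + 1) / (u \<bullet> y)) *\<^sub>R y \<in> X"
      using recession_cone_iff[OF cl cv X0] y p by simp
    from u[OF this] p show False by simp
  qed
  have erc: "0 \<le> e \<bullet> y" "e \<bullet> y = 0 \<Longrightarrow> - y \<in> recession_cone X" if "y \<in> recession_cone X" for y
    using X that by (auto simp: axial_body_def)
  have key: False if x: "\<And>j. x j \<in> X" "\<And>j. norm (x j) > real j"
     and lb: "\<And>j. w \<bullet> x j \<ge> m" and min: "\<And>j x'. x' \<in> X \<Longrightarrow> w \<bullet> x' = w \<bullet> x j \<Longrightarrow> norm (x j) \<le> norm x'"
   for x :: "nat \<Rightarrow> real^'n" and m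
  proof -
    obtain y r where y: "norm y = 1" "y \<in> recession_cone X" "strict_mono (r :: nat \<Rightarrow> nat)"
      and inv: "(\<lambda>j. inverse (norm (x (r j)))) \<longlonglongrightarrow> 0"
      and lim: "(\<lambda>j. x (r j) /\<^sub>R norm (x (r j))) \<longlonglongrightarrow> y"
      using recession_direction_of_sequence[OF cl cv x] by blast
    have pos: "norm (x j) > 0" for j using x(2)[of j] by (smt (verit) of_nat_0_le_iff)
    have "0 \<le> w \<bullet> y"
    proof (rule LIMSEQ_le)
      show "(\<lambda>j. inverse (norm (x (r j))) * m) \<longlonglongrightarrow> 0" using tendsto_mult_left_zero[OF inv] by simp
      show "(\<lambda>j. w \<bullet> (x (r j) /\<^sub>R norm (x (r j)))) \<longlonglongrightarrow> w \<bullet> y" by (intro tendsto_inner tendsto_const lim)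
      show "\<exists>N. \<forall>n\<ge>N. inverse (norm (x (r n))) * m \<le> w \<bullet> (x (r n) /\<^sub>R norm (x (r n)))"
        using lb pos by (auto intro!: mult_left_mono simp: inner_scaleR_right)
    qed
    \<comment> \<open>Here the multiple of \<open>e\<close> pays off: \<open>\<epsilon> * (e
      \<bullet> y) \<le> u \<bullet> y \<le> 0 \<le> e \<bullet> y\<close> makes the limit direction
      orthogonal to \<open>e\<close> and to \<open>w\<close>, hence the direction of a line in
      \<open>X\<close>.\<close>
    then have "\<epsilon> * (e \<bullet> y) \<le> u \<bullet> y" by (simp add: w_def inner_diff_left)
    then have "\<epsilon> * (e \<bullet> y) \<le> 0" using urc[OF y(2)] by linarith
    then have ey: "e \<bullet> y = 0" using erc(1)[OF y(2)] \<epsilon> by (simp add: mult_le_0_iff)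
    have wy: "w \<bullet> y = 0" using \<open>0 \<le> w \<bullet> y\<close> urc[OF y(2)] ey by (simp add: w_def inner_diff_left)
    have neg: "- y \<in> recession_cone X" by (rule erc(2)[OF y(2) ey])
    \<comment> \<open>Sliding \<open>x j\<close> back by its component along \<open>y\<close> stays
      in \<open>X\<close> and on the same level of \<open>w\<close>, but shortens it. In the limit
      this contradicts that \<open>y\<close> is the direction of the \<open>x j\<close>.\<close>
    have "x j \<bullet> y \<le> 0" for j
    proof (rule ccontr)
      assume "\<not> ?thesis"
      then have p: "x j \<bullet> y > 0" by simp
      have "x j + (x j \<bullet> y) *\<^sub>R (- y) \<in> X"
        using recession_cone_iff[OF cl cv x(1)[of j], of "- y"] neg p by (meson less_imp_le)
      moreover have "w \<bullet> (x j + (x j \<bullet> y) *\<^sub>R (- y)) = w \<bullet> x j" by (simp add: inner_diff_right wy)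
      ultimately have "norm (x j) \<le> norm (x j + (x j \<bullet> y) *\<^sub>R (- y))" by (rule min)
      then have "(norm (x j))\<^sup>2 \<le> (norm (x j + (x j \<bullet> y) *\<^sub>R (- y)))\<^sup>2" by (simp add: power_mono)
      also have "\<dots> = (norm (x j))\<^sup>2 - (x j \<bullet> y)\<^sup>2"
        unfolding power2_norm_eq_inner using y(1)
        by (simp add: inner_diff_left inner_diff_right inner_commute norm_eq_1 power2_eq_square)
      finally show False using p by simp
    qed
    then have "y \<bullet> y \<le> 0"
      by (intro LIMSEQ_le_const2[OF tendsto_inner[OF lim tendsto_const]])
         (auto simp: mult_nonneg_nonpos)
    then show False using y(1) by (simp add: norm_eq_1)
  qed
  show ?thesis
  proof (rule ccontr)
    assume neg: "\<not> thesis"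
    then have nomax: "\<exists>x'\<in>X. w \<bullet> x' > w \<bullet> x" if "x \<in> X" for x
      using that \<open>\<And>x0. x0 \<in> X \<Longrightarrow> (\<And>x. x \<in> X \<Longrightarrow> (u - \<epsilon> *\<^sub>R e) \<bullet> x \<le> (u - \<epsilon> *\<^sub>R e) \<bullet> x0) \<Longrightarrow> thesis\<close>
      unfolding w_def by (meson not_le)
    \<comment> \<open>Without a maximum some level exceeds all values on the ball of radius
      \<open>j\<close>. Its slice of \<open>X\<close> then lies outside this ball, and the slice has
      a point of least norm.\<close>
    have far: "\<exists>y\<in>X. w \<bullet> y \<ge> 0 \<and> norm y > real j \<and> (\<forall>x'\<in>X. w \<bullet> x' = w \<bullet> y \<longrightarrow> norm y \<le> norm x')" for j
    proof -
      have "compact (X \<inter> cball 0 (real j))" using cl by (simp add: closed_Int_compact)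
      moreover have "X \<inter> cball 0 (real j) \<noteq> {}" using X0 by force
      moreover have "continuous_on (X \<inter> cball 0 (real j)) ((\<bullet>) w)" by (intro continuous_intros)
      ultimately obtain a where a: "a \<in> X \<inter> cball 0 (real j)" "\<And>x. x \<in> X \<inter> cball 0 (real j) \<Longrightarrow> w \<bullet> x \<le> w \<bullet> a"
        using continuous_attains_sup[of "X \<inter> cball 0 (real j)" "(\<bullet>) w"] by blast
      obtain b where b: "b \<in> X" "w \<bullet> b > w \<bullet> a" using nomax a(1) by blast
      define T where "T = X \<inter> {x. w \<bullet> x = w \<bullet> b}"
      have T: "closed T" "T \<noteq> {}" unfolding T_def using b(1) by (auto intro!: closed_Int cl closed_hyperplane)
      define y where "y = closest_point T 0"
      have y: "y \<in> T" unfolding y_def by (rule closest_point_in_set[OF T])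
      have "0 \<le> w \<bullet> a" using a(2)[of 0] X0 by simp
      moreover have "norm y > real j"
      proof (rule ccontr)
        assume "\<not> ?thesis"
        then have "w \<bullet> y \<le> w \<bullet> a" using a(2)[of y] y by (simp add: T_def)
        then show False using y b(2) by (simp add: T_def)
      qed
      moreover have "norm y \<le> norm x'" if "x' \<in> X" "w \<bullet> x' = w \<bullet> y" for x'
        using closest_point_le[OF T(1), of x' 0] that y by (simp add: T_def y_def)
      ultimately show ?thesis using y b(2) by (intro bexI[of _ y]) (auto simp: T_def)
    qed
    then obtain x where "\<And>j. x j \<in> X" "\<And>j. w \<bullet> x j \<ge> 0" "\<And>j. norm (x j) > real j"
      "\<And>j. \<forall>x'\<in>X. w \<bullet> x' = w \<bullet> x j \<longrightarrow> norm (x j) \<le> norm x'" by metis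
    then show False using key[of x 0] by blast
  qed
qed

section \<open>Projective images\<close>

text \<open>The image of the part \<open>s * (e \<bullet> x) < 1\<close> of \<open>X\<close> under \<open>x \<mapsto> x / (1 - s * (e \<bullet> x))\<close>; the definition
  uses the inverse map.\<close>

definition proj_image :: "real^'n \<Rightarrow> real \<Rightarrow> (real^'n) set \<Rightarrow> (real^'n) set" where
  "proj_image e s X = {y. 1 + s * (e \<bullet> y) > 0 \<and> y /\<^sub>R (1 + s * (e \<bullet> y)) \<in> X}"

lemma proj_image_0 [simp]: "proj_image e 0 X = X"
  by (simp add: proj_image_def)

text \<open>The denominators multiply: with \<open>q = e \<bullet> y\<close>, the product of
  \<open>1 + r * q\<close> and \<open>1 + s * (q / (1 + r * q))\<close> is
  \<open>1 + (s + r) * q\<close>. The domains agree because \<open>1 + r * q \<le> 0\<close> forces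
  \<open>q < 0\<close> and hence \<open>1 + (s + r) * q \<le> 0\<close>.\<close>

lemma proj_image_proj_image:
  assumes "s \<ge> 0" "r \<ge> 0"
  shows "proj_image e r (proj_image e s X) = proj_image e (s + r) X"
proof -
  have "y \<in> proj_image e r (proj_image e s X) \<longleftrightarrow> y \<in> proj_image e (s + r) X" for y
  proof (cases "1 + r * (e \<bullet> y) > 0")
    case True
    define D where "D = 1 + r * (e \<bullet> y)"
    have D: "D > 0" using True by (simp add: D_def)
    have "D * inverse D = 1" using D by simp
    then have "D * (1 + s * (inverse D * (e \<bullet> y))) = D + s * (e \<bullet> y)" by algebra
    then have E: "D * (1 + s * (e \<bullet> (y /\<^sub>R D))) = 1 + (s + r) * (e \<bullet> y)"
      by (simp add: D_def algebra_simps)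
    have pos: "1 + s * (e \<bullet> (y /\<^sub>R D)) > 0 \<longleftrightarrow> 1 + (s + r) * (e \<bullet> y) > 0"
      unfolding E[symmetric] using D by (simp add: zero_less_mult_iff)
    have Q: "(y /\<^sub>R D) /\<^sub>R (1 + s * (e \<bullet> (y /\<^sub>R D))) = y /\<^sub>R (1 + (s + r) * (e \<bullet> y))"
      unfolding E[symmetric] by (simp add: mult.commute)
    show ?thesis unfolding proj_image_def mem_Collect_eq D_def[symmetric] pos Q using D by simp
  next
    case False
    have "\<not> 1 + (s + r) * (e \<bullet> y) > 0"
    proof
      assume p: "1 + (s + r) * (e \<bullet> y) > 0"
      have "e \<bullet> y < 0"
      proof (rule ccontr)
        assume "\<not> e \<bullet> y < 0"
        then have "r * (e \<bullet> y) \<ge> 0" using assms by simp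
        then show False using False by linarith
      qed
      then have "s * (e \<bullet> y) \<le> 0" using assms by (simp add: mult_nonneg_nonpos)
      then show False using False p by (simp add: algebra_simps)
    qed
    then show ?thesis using False by (simp add: proj_image_def)
  qed
  then show ?thesis by blast
qed

lemma axial_bodyD:
  assumes "axial_body e X"
  shows "closed X" "convex X" "0 \<in> interior X" "0 \<in> X" "norm e = 1" "e \<in> recession_cone X" "e \<bullet> e = 1"
    "\<And>y. y \<in> recession_cone X \<Longrightarrow> 0 \<le> e \<bullet> y"
    "\<And>y. y \<in> recession_cone X \<Longrightarrow> e \<bullet> y = 0 \<Longrightarrow> - y \<in> recession_cone X"
  using assms interior_subset by (auto simp: axial_body_def norm_eq_1)

text \<open>The denominator is affine, so segments go to segments, with the weights
  \<open>u\<close>, \<open>v\<close> changed in proportion to the denominators at the two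
  ends.\<close>

lemma convex_proj_image:
  assumes "convex X" shows "convex (proj_image e s X)"
  unfolding convex_def
proof (intro ballI allI impI)
  fix x y and u v :: real
  assume x: "x \<in> proj_image e s X" and y: "y \<in> proj_image e s X" and uv: "0 \<le> u" "0 \<le> v" "u + v = 1"
  define A where "A = 1 + s * (e \<bullet> x)"
  define B where "B = 1 + s * (e \<bullet> y)"
  have A: "A > 0" "x /\<^sub>R A \<in> X" and B: "B > 0" "y /\<^sub>R B \<in> X" using x y by (auto simp: proj_image_def A_def B_def)
  define D where "D = u * A + v * B"
  have D: "D > 0"
  proof (cases "u = 0")
    case False
    then have "u * A > 0" using A(1) uv by simp
    then show ?thesis using B(1) uv by (simp add: D_def add_pos_nonneg)
  qed (use B(1) uv in \<open>simp add: D_def\<close>)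
  have De: "1 + s * (e \<bullet> (u *\<^sub>R x + v *\<^sub>R y)) = D"
    using uv(3) unfolding D_def A_def B_def by (simp add: inner_add_right algebra_simps)
  have "(u * A / D) *\<^sub>R (x /\<^sub>R A) + (v * B / D) *\<^sub>R (y /\<^sub>R B) \<in> X"
    using A B D uv by (intro convexD[OF assms]) (auto simp: add_divide_distrib[symmetric] D_def[symmetric])
  also have "(u * A / D) *\<^sub>R (x /\<^sub>R A) + (v * B / D) *\<^sub>R (y /\<^sub>R B) = (u *\<^sub>R x + v *\<^sub>R y) /\<^sub>R D"
  proof -
    have "u * A / D * inverse A = inverse D * u" "v * B / D * inverse B = inverse D * v"
      using A(1) B(1) by (simp_all add: divide_inverse)
    then show ?thesis by (simp add: scaleR_add_right)
  qed
  finally show "u *\<^sub>R x + v *\<^sub>R y \<in> proj_image e s X"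
    using D by (simp add: proj_image_def De)
qed

text \<open>If the denominators \<open>1 + s (e \<bullet> y)\<close> tend to 0, the limit is a recession direction of \<open>L\<close> with
  \<open>s (e \<bullet> y) = -1\<close>, which is impossible.\<close>

lemma kconv_proj_image_limit:
  fixes L :: "(real^'n) set"
  assumes K: "kconv K L" "\<And>j. convex (K j)" and r: "strict_mono r"
    and y: "\<And>j. y j \<in> proj_image (f j) (s j) (K (r j))" "y \<longlonglongrightarrow> x"
    and lim: "f \<longlonglongrightarrow> e" "s \<longlonglongrightarrow> t" and t: "t \<ge> 0"
    and rc: "\<And>v. v \<in> recession_cone L \<Longrightarrow> 0 \<le> e \<bullet> v"
  shows "x \<in> proj_image e t L"
proof -
  define D where "D j = 1 + s j * (f j \<bullet> y j)" for j
  have D: "D j > 0" "y j /\<^sub>R D j \<in> K (r j)" for j using y(1)[of j] by (auto simp: proj_image_def D_def)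
  have Dl: "D \<longlonglongrightarrow> 1 + t * (e \<bullet> x)" unfolding D_def by (intro tendsto_intros lim y)
  have "1 + t * (e \<bullet> x) \<ge> 0" by (rule LIMSEQ_le_const[OF Dl]) (auto intro: less_imp_le D)
  moreover have "1 + t * (e \<bullet> x) \<noteq> 0"
  proof
    assume 0: "1 + t * (e \<bullet> x) = 0"
    have "x \<in> recession_cone L"
    proof (rule kconv_direction[OF K r D(2) D(1)])
      show "D \<longlonglongrightarrow> 0" using Dl 0 by simp
      have "D j *\<^sub>R (y j /\<^sub>R D j) = y j" for j using D(1)[of j] by simp
      then show "(\<lambda>j. D j *\<^sub>R (y j /\<^sub>R D j)) \<longlonglongrightarrow> x" using y(2) by simp
    qed
    then show False using rc[of x] t 0 by (smt (verit) mult_nonneg_nonneg)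
  qed
  ultimately have pos: "1 + t * (e \<bullet> x) > 0" by simp
  have "x /\<^sub>R (1 + t * (e \<bullet> x)) \<in> L"
  proof (rule kconv_limit_in[OF K(1) r D(2)])
    show "(\<lambda>j. y j /\<^sub>R D j) \<longlonglongrightarrow> x /\<^sub>R (1 + t * (e \<bullet> x))"
      using pos by (intro tendsto_intros y Dl) auto
  qed
  then show ?thesis using pos by (simp add: proj_image_def)
qed

lemma closed_proj_image:
  assumes "closed X" "convex X" "s \<ge> 0" "\<And>v. v \<in> recession_cone X \<Longrightarrow> 0 \<le> e \<bullet> v"
  shows "closed (proj_image e s X)"
proof (cases "X = {}")
  case True then show ?thesis by (simp add: proj_image_def)
next
  case False
  show ?thesis
    unfolding closed_sequential_limits
  proof (intro allI impI)
    fix y x assume "(\<forall>n. y n \<in> proj_image e s X) \<and> y \<longlonglongrightarrow> x"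
    then show "x \<in> proj_image e s X"
      using kconv_proj_image_limit[OF kconv_const[OF assms(1) False] assms(2) strict_mono_id, of y "\<lambda>_. e" "\<lambda>_. s" x e s] assms(3,4)
      by simp
  qed
qed

lemma zero_in_interior_proj_image:
  assumes "0 \<in> interior X" shows "0 \<in> interior (proj_image e s X)"
proof -
  define O' where "O' = {y. 1 + s * (e \<bullet> y) > 0}"
  have O: "open O'" unfolding O'_def by (intro open_Collect_less continuous_intros)
  have "continuous_on O' (\<lambda>y. y /\<^sub>R (1 + s * (e \<bullet> y)))" by (intro continuous_intros) (auto simp: O'_def)
  then have "open (O' \<inter> (\<lambda>y. y /\<^sub>R (1 + s * (e \<bullet> y))) -` interior X)"
    by (rule continuous_open_preimage[OF _ O open_interior])
  moreover have "O' \<inter> (\<lambda>y. y /\<^sub>R (1 + s * (e \<bullet> y))) -` interior X \<subseteq> proj_image e s X"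
    using interior_subset by (auto simp: O'_def proj_image_def)
  moreover have "0 \<in> O' \<inter> (\<lambda>y. y /\<^sub>R (1 + s * (e \<bullet> y))) -` interior X" using assms by (simp add: O'_def)
  ultimately show ?thesis by (meson interiorI)
qed

lemma proj_image_closed_convex:
  assumes X: "axial_body e X" and s: "s \<ge> 0"
  shows "closed (proj_image e s X)" "convex (proj_image e s X)" "0 \<in> proj_image e s X"
  using closed_proj_image[of X s e] convex_proj_image[of X e s] zero_in_interior_proj_image[of X e s]
    axial_bodyD[OF X] s interior_subset by auto

text \<open>Pulled back to \<open>X\<close>, the ray of \<open>y\<close> consists of the points
  \<open>(l / (1 + s * (l * (e \<bullet> y)))) *\<^sub>R y\<close>. For
  \<open>e \<bullet> y > 0\<close> they tend to a point of the hyperplane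
  \<open>s * (e \<bullet> x) = 1\<close>. So the new recession cone is made of the cone over that
  slice of \<open>X\<close> and of the old recession directions orthogonal to
  \<open>e\<close>.\<close>

lemma recession_cone_proj_imageD:
  assumes X: "axial_body e X" and s: "s > 0" and y: "y \<in> recession_cone (proj_image e s X)"
  shows "0 \<le> e \<bullet> y" "e \<bullet> y = 0 \<Longrightarrow> y \<in> recession_cone X" "e \<bullet> y > 0 \<Longrightarrow> y /\<^sub>R (s * (e \<bullet> y)) \<in> X"
proof -
  note X' = axial_bodyD[OF X]
  note cl = proj_image_closed_convex(1)[OF X less_imp_le[OF s]]
    and cv = proj_image_closed_convex(2)[OF X less_imp_le[OF s]]
    and 0 = proj_image_closed_convex(3)[OF X less_imp_le[OF s]]
  have ray: "1 + s * (l * (e \<bullet> y)) > 0" "(l / (1 + s * (l * (e \<bullet> y)))) *\<^sub>R y \<in> X" if "l \<ge> 0" for l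
    using recession_cone_iff[OF cl cv 0, of y] y that
    by (auto simp: proj_image_def divide_inverse mult.commute)
  show nn: "0 \<le> e \<bullet> y"
  proof (rule ccontr)
    assume "\<not> ?thesis"
    then have n: "e \<bullet> y < 0" by simp
    \<comment> \<open>At this parameter the ray would reach the hyperplane where the denominator
      vanishes.\<close>
    define l where "l = - 1 / (s * (e \<bullet> y))"
    have "s * (l * (e \<bullet> y)) = - 1" using n s by (simp add: l_def)
    moreover have "l \<ge> 0" using n s by (simp add: l_def divide_nonpos_neg mult_pos_neg less_imp_le)
    ultimately show False using ray(1)[of l] by simp
  qed
  show "y \<in> recession_cone X" if "e \<bullet> y = 0"
    using recession_cone_iff[OF X'(1,2,4), of y] ray(2) that by simp
  show "y /\<^sub>R (s * (e \<bullet> y)) \<in> X" if p: "e \<bullet> y > 0"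
  proof (rule closed_sequentially[OF X'(1)])
    show "(real n / (1 + s * (real n * (e \<bullet> y)))) *\<^sub>R y \<in> X" for n by (rule ray) simp
    define c where "c n = inverse (inverse (real n) + s * (e \<bullet> y))" for n
    have "c \<longlonglongrightarrow> inverse (0 + s * (e \<bullet> y))" unfolding c_def
      using p s by (intro tendsto_intros lim_inverse_n) auto
    then have "(\<lambda>n. c n *\<^sub>R y) \<longlonglongrightarrow> y /\<^sub>R (s * (e \<bullet> y))" by (intro tendsto_intros) simp
    moreover have "\<forall>\<^sub>F n in sequentially. c n *\<^sub>R y = (real n / (1 + s * (real n * (e \<bullet> y)))) *\<^sub>R y"
      using eventually_gt_at_top[of 0]
    proof eventually_elim
      case (elim n)
      then have "inverse (real n) + s * (e \<bullet> y) = (1 + s * (real n * (e \<bullet> y))) / real n" by (simp add: field_simps)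
      then show ?case by (simp add: c_def)
    qed
    ultimately show "(\<lambda>n. (real n / (1 + s * (real n * (e \<bullet> y)))) *\<^sub>R y) \<longlonglongrightarrow> y /\<^sub>R (s * (e \<bullet> y))"
      by (rule Lim_transform_eventually)
  qed
qed

lemma recession_cone_proj_imageI:
  assumes X: "axial_body e X" and s: "s > 0" and y: "e \<bullet> y > 0" "y /\<^sub>R (s * (e \<bullet> y)) \<in> X"
  shows "y \<in> recession_cone (proj_image e s X)"
proof -
  note X' = axial_bodyD[OF X]
  note cl = proj_image_closed_convex(1)[OF X less_imp_le[OF s]]
    and cv = proj_image_closed_convex(2)[OF X less_imp_le[OF s]]
    and 0 = proj_image_closed_convex(3)[OF X less_imp_le[OF s]]
  show ?thesis
    unfolding recession_cone_iff[OF cl cv 0]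
  proof (intro allI impI)
    fix l :: real assume l: "l \<ge> 0"
    define D where "D = 1 + s * (l * (e \<bullet> y))"
    have D: "D > 0" using l s y(1) by (simp add: D_def add_pos_nonneg)
    define c where "c = l * s * (e \<bullet> y) / D"
    have c: "0 \<le> c" "c \<le> 1" using D l s y(1) by (auto simp: c_def) (simp add: D_def)
    have "(1 - c) *\<^sub>R 0 + c *\<^sub>R (y /\<^sub>R (s * (e \<bullet> y))) \<in> X"
      by (intro convexD_alt X' y c)
    also have "(1 - c) *\<^sub>R 0 + c *\<^sub>R (y /\<^sub>R (s * (e \<bullet> y))) = (0 + l *\<^sub>R y) /\<^sub>R D"
    proof -
      have "c * inverse (s * (e \<bullet> y)) = l / D" using s y(1) by (simp add: c_def field_simps)
      then show ?thesis by (simp add: divide_inverse mult.commute)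
    qed
    finally show "0 + l *\<^sub>R y \<in> proj_image e s X" using D by (simp add: proj_image_def D_def)
  qed
qed

lemma recession_cone_subset_proj_image:
  assumes X: "axial_body e X" and s: "s \<ge> 0"
  shows "recession_cone X \<subseteq> recession_cone (proj_image e s X)"
proof
  note X' = axial_bodyD[OF X]
  fix y assume y: "y \<in> recession_cone X"
  note cl = proj_image_closed_convex(1)[OF X s]
    and cv = proj_image_closed_convex(2)[OF X s]
    and 0 = proj_image_closed_convex(3)[OF X s]
  show "y \<in> recession_cone (proj_image e s X)"
    unfolding recession_cone_iff[OF cl cv 0]
  proof (intro allI impI)
    fix l :: real assume l: "l \<ge> 0"
    have D: "1 + s * (l * (e \<bullet> y)) > 0" using l s X'(8)[OF y] by (simp add: add_pos_nonneg)
    then have "0 + (l / (1 + s * (l * (e \<bullet> y)))) *\<^sub>R y \<in> X"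
      using recession_cone_iff[OF X'(1,2,4), of y] y l by (metis divide_nonneg_pos)
    then show "0 + l *\<^sub>R y \<in> proj_image e s X" using D by (simp add: proj_image_def divide_inverse mult.commute)
  qed
qed

text \<open>New recession directions are strictly positive against \<open>e\<close>, and those
  orthogonal to \<open>e\<close> are old ones. Together with the semigroup law this allows every
  one-step result to be restarted from a later time.\<close>

lemma axial_body_proj_image:
  assumes X: "axial_body e X" and s: "s \<ge> 0"
  shows "axial_body e (proj_image e s X)"
proof (cases "s = 0")
  case False
  then have s: "s > 0" using assms(2) by simp
  note X' = axial_bodyD[OF X]
  show ?thesis
    unfolding axial_body_def
  proof (intro conjI ballI impI)
    show "closed (proj_image e s X)" using closed_proj_image[of X s e] X' s by simp
    show "convex (proj_image e s X)" using convex_proj_image X' by blast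
    show "0 \<in> interior (proj_image e s X)" using zero_in_interior_proj_image[OF X'(3)] .
    show "norm e = 1" by (rule X')
    show "e \<in> recession_cone (proj_image e s X)" using recession_cone_subset_proj_image[OF X, of s] s X'(6) by auto
    fix y assume y: "y \<in> recession_cone (proj_image e s X)"
    show "0 \<le> e \<bullet> y" by (rule recession_cone_proj_imageD[OF X s y])
    assume "e \<bullet> y = 0"
    then have "- y \<in> recession_cone X" using recession_cone_proj_imageD(2)[OF X s y] X'(9) by blast
    then show "- y \<in> recession_cone (proj_image e s X)" using recession_cone_subset_proj_image[OF X, of s] s by auto
  qed
qed (use X in simp)

text \<open>The point \<open>e /\<^sub>R s\<close> of the slice is interior to \<open>X\<close>,
  being an interior point 0 moved along a recession direction; the cone over a neighbourhood of it
  contains a neighbourhood of \<open>e\<close>.\<close>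

lemma axis_in_interior_recession_cone:
  assumes X: "axial_body e X" and s: "s > 0"
  shows "e \<in> interior (recession_cone (proj_image e s X))"
proof -
  note X' = axial_bodyD[OF X]
  define O' where "O' = {y. e \<bullet> y > 0}"
  have O: "open O'" unfolding O'_def by (intro open_Collect_less continuous_intros)
  have "continuous_on O' (\<lambda>y. y /\<^sub>R (s * (e \<bullet> y)))" using s by (intro continuous_intros) (auto simp: O'_def)
  then have "open (O' \<inter> (\<lambda>y. y /\<^sub>R (s * (e \<bullet> y))) -` interior X)"
    by (rule continuous_open_preimage[OF _ O open_interior])
  moreover have "O' \<inter> (\<lambda>y. y /\<^sub>R (s * (e \<bullet> y))) -` interior X \<subseteq> recession_cone (proj_image e s X)"
    using interior_subset recession_cone_proj_imageI[OF X s] by (auto simp: O'_def)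
  moreover have "e \<in> O' \<inter> (\<lambda>y. y /\<^sub>R (s * (e \<bullet> y))) -` interior X"
  proof -
    obtain d where d: "d > 0" "cball 0 d \<subseteq> X" using X'(3) by (auto simp: mem_interior_cball)
    have "e /\<^sub>R s \<in> interior X" unfolding mem_interior_cball
    proof (intro exI conjI subsetI)
      fix x assume "x \<in> cball (e /\<^sub>R s) d"
      then have "x - e /\<^sub>R s \<in> cball 0 d" by (simp add: dist_norm norm_minus_commute)
      then have "x - e /\<^sub>R s \<in> X" using d by blast
      moreover have "e /\<^sub>R s \<in> recession_cone X" using recession_cone_scale[OF X'(1,2,6), of "inverse s"] s by simp
      ultimately have "x - e /\<^sub>R s + e /\<^sub>R s \<in> X" by (rule recession_coneD[rotated])
      then show "x \<in> X" by simp
    qed (rule d)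
    then show ?thesis using X'(7) by (simp add: O'_def)
  qed
  ultimately show ?thesis by (meson interiorI)
qed

section \<open>Normal cones of projective images\<close>

text \<open>\<open>c\<close> is the support value of \<open>v\<close>, positive because 0 is
  interior to the image. Clearing denominators in \<open>v \<bullet> y \<le> c\<close> gives the
  inequality on the part of \<open>X\<close> with \<open>s * (e \<bullet> x) < 1\<close>, with
  equality at the preimage \<open>x0\<close> of a contact point.\<close>

lemma unit_normal_cone_proj_image_aux:
  assumes X: "axial_body e X" and s: "s \<ge> 0" and v: "v \<in> unit_normal_cone (proj_image e s X)"
  obtains c where "c > 0" "\<And>x. x \<in> X \<Longrightarrow> (v + (s * c) *\<^sub>R e) \<bullet> x \<le> c"
proof -
  note X' = axial_bodyD[OF X]
  obtain c y0 where nv: "norm v = 1" and y0: "y0 \<in> proj_image e s X" "v \<bullet> y0 = c"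
    and le: "\<And>y. y \<in> proj_image e s X \<Longrightarrow> v \<bullet> y \<le> c"
    using v by (auto simp: unit_normal_cone_def)
  define u where "u = v + (s * c) *\<^sub>R e"
  obtain d where d: "d > 0" "cball 0 d \<subseteq> proj_image e s X"
    using zero_in_interior_proj_image[OF X'(3), of e s] by (auto simp: mem_interior_cball)
  have "d *\<^sub>R v \<in> proj_image e s X" using d nv by (intro subsetD[OF d(2)]) simp
  from le[OF this] have c: "c > 0" using nv d(1) by (simp add: norm_eq_1)
  define D where "D = 1 + s * (e \<bullet> y0)"
  define x0 where "x0 = y0 /\<^sub>R D"
  have D: "D > 0" and x0: "x0 \<in> X" using y0(1) by (auto simp: proj_image_def D_def x0_def)
  have ux0: "u \<bullet> x0 = c"
    using D y0(2) by (simp add: u_def x0_def inner_add_left field_simps) (simp add: D_def algebra_simps)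
  have ex0: "1 - s * (e \<bullet> x0) = 1 / D" using D by (simp add: x0_def field_simps) (simp add: D_def)
  have near: "u \<bullet> x \<le> c" if x: "x \<in> X" "1 - s * (e \<bullet> x) > 0" for x
  proof -
    define E where "E = 1 - s * (e \<bullet> x)"
    have E: "E > 0" using x by (simp add: E_def)
    have 1: "1 + s * (e \<bullet> (x /\<^sub>R E)) = 1 / E" using E by (simp add: field_simps) (simp add: E_def)
    have "x /\<^sub>R E \<in> proj_image e s X" unfolding proj_image_def mem_Collect_eq 1 using E x by simp
    from le[OF this] have "v \<bullet> x \<le> c * E" using E by (simp add: field_simps)
    then show ?thesis by (simp add: u_def E_def inner_add_left algebra_simps)
  qed
  \<comment> \<open>A value above \<open>c\<close> at \<open>x\<close> would persist along the
    segment to \<open>x0\<close>, where \<open>u\<close> equals \<open>c\<close>; but close to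
    \<open>x0\<close> the bound \<open>near\<close> applies.\<close>
  have "u \<bullet> x \<le> c" if x: "x \<in> X" for x
  proof -
    have "(\<lambda>\<tau>. 1 - s * (e \<bullet> ((1 - \<tau>) *\<^sub>R x0 + \<tau> *\<^sub>R x))) \<midarrow>0\<rightarrow> 1 - s * (e \<bullet> ((1 - 0) *\<^sub>R x0 + 0 *\<^sub>R x))"
      by (intro tendsto_intros)
    then have "((\<lambda>\<tau>. 1 - s * (e \<bullet> ((1 - \<tau>) *\<^sub>R x0 + \<tau> *\<^sub>R x))) \<longlongrightarrow> 1 / D) (at_right 0)"
      using ex0 tendsto_within_subset[of _ _ 0 UNIV "{0<..}"] by simp
    then have "\<forall>\<^sub>F \<tau> in at_right 0. 1 - s * (e \<bullet> ((1 - \<tau>) *\<^sub>R x0 + \<tau> *\<^sub>R x)) > 0"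
      by (rule order_tendstoD) (use D in simp)
    moreover have "\<forall>\<^sub>F \<tau> in at_right (0::real). \<tau> > 0 \<and> \<tau> < 1"
      using eventually_at_right_less[of "0::real"] eventually_at_right_field[of _ "0::real"] zero_less_one
      by (auto simp: eventually_conj_iff eventually_at_right_field intro!: exI[of _ 1])
    ultimately have "\<forall>\<^sub>F \<tau> in at_right 0. \<tau> > 0 \<and> \<tau> < 1 \<and> 1 - s * (e \<bullet> ((1 - \<tau>) *\<^sub>R x0 + \<tau> *\<^sub>R x)) > 0"
      by eventually_elim simp
    then obtain \<tau> where \<tau>: "\<tau> > 0" "\<tau> < 1" "1 - s * (e \<bullet> ((1 - \<tau>) *\<^sub>R x0 + \<tau> *\<^sub>R x)) > 0"
      using eventually_happens[of _ "at_right (0::real)"] by auto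
    have "(1 - \<tau>) *\<^sub>R x0 + \<tau> *\<^sub>R x \<in> X" using \<tau> by (intro convexD_alt X' x0 x) auto
    from near[OF this \<tau>(3)] have "(1 - \<tau>) * c + \<tau> * (u \<bullet> x) \<le> c" by (simp add: inner_add_right ux0)
    then have "\<tau> * (u \<bullet> x) \<le> \<tau> * c" by (simp add: algebra_simps)
    then show ?thesis using \<tau>(1) by simp
  qed
  then show ?thesis using c that unfolding u_def by blast
qed

lemma unit_normal_coneI:
  assumes "norm v = 1" "x0 \<in> X" "\<And>x. x \<in> X \<Longrightarrow> v \<bullet> x \<le> v \<bullet> x0"
  shows "v \<in> unit_normal_cone X"
  using assms unfolding unit_normal_cone_def by blast

text \<open>\<open>v\<close> is the bounded functional \<open>v + (s * c) *\<^sub>R e\<close> minus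
  a positive multiple of \<open>e\<close>, exactly the situation in which the maximum over
  \<open>X\<close> is attained.\<close>

lemma unit_normal_cone_proj_image:
  assumes X: "axial_body e X" and s: "s \<ge> 0"
  shows "unit_normal_cone (proj_image e s X) \<subseteq> unit_normal_cone X"
proof
  fix v assume v: "v \<in> unit_normal_cone (proj_image e s X)"
  show "v \<in> unit_normal_cone X"
  proof (cases "s = 0")
    case False
    then have s: "s > 0" using assms(2) by simp
    obtain c where c: "c > 0" "\<And>x. x \<in> X \<Longrightarrow> (v + (s * c) *\<^sub>R e) \<bullet> x \<le> c"
      using unit_normal_cone_proj_image_aux[OF assms v] by blast
    have "s * c > 0" using s c by simp
    from axial_body_attains_max[OF X c(2) this]
    obtain x0 where "x0 \<in> X" "\<And>x. x \<in> X \<Longrightarrow> v \<bullet> x \<le> v \<bullet> x0" by auto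
    then show ?thesis using v by (intro unit_normal_coneI) (auto simp: unit_normal_cone_def)
  qed (use v in simp)
qed

text \<open>The zero functional is bounded; subtracting \<open>e\<close> from it makes the maximum
  attained.\<close>

lemma axis_in_unit_normal_cone:
  assumes X: "axial_body e X" shows "- e \<in> unit_normal_cone X"
proof -
  obtain x0 where "x0 \<in> X" "\<And>x. x \<in> X \<Longrightarrow> (- e) \<bullet> x \<le> (- e) \<bullet> x0"
    using axial_body_attains_max[OF X, of 0 0 1] by auto
  then show ?thesis using axial_bodyD(5)[OF X] by (intro unit_normal_coneI) auto
qed

text \<open>\<open>u = v + (s * c) *\<^sub>R e\<close> is at most \<open>c\<close> on the ball of
  radius \<open>d\<close>, so \<open>norm u \<le> c / d\<close>. Division by \<open>s * c\<close>
  puts \<open>q *\<^sub>R v\<close> within \<open>1 / (s * d)\<close> of \<open>- e\<close>;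
  comparing lengths, \<open>q\<close> is that close to 1, which costs the same amount again.\<close>

lemma unit_normal_cone_proj_image_dist:
  assumes X: "axial_body e X" and s: "s > 0" and d: "d > 0" "cball 0 d \<subseteq> X"
    and v: "v \<in> unit_normal_cone (proj_image e s X)"
  shows "dist v (- e) \<le> 2 / (s * d)"
proof -
  obtain c where c: "c > 0" "\<And>x. x \<in> X \<Longrightarrow> (v + (s * c) *\<^sub>R e) \<bullet> x \<le> c"
    using unit_normal_cone_proj_image_aux[OF X _ v] s by (metis less_imp_le)
  define u where "u = v + (s * c) *\<^sub>R e"
  have nv: "norm v = 1" using v by (simp add: unit_normal_cone_def)
  have ne: "norm e = 1" by (rule axial_bodyD[OF X])
  have "d * norm u \<le> c"
  proof (cases "u = 0")
    case False
    have "(d / norm u) *\<^sub>R u \<in> X" using d(1) False by (intro subsetD[OF d(2)]) simp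
    from c(2)[OF this, folded u_def] False show ?thesis
      by (simp add: power2_norm_eq_inner[symmetric] power2_eq_square)
  qed (use c in simp)
  then have nu: "norm u \<le> c / d" using d(1) by (simp add: field_simps)
  define q where "q = 1 / (s * c)"
  have q: "q > 0" "q * (s * c) = 1" using s c by (auto simp: q_def)
  have "norm (q *\<^sub>R v + e) = norm (q *\<^sub>R u)" using q by (simp add: u_def scaleR_add_right)
  also have "\<dots> \<le> q * (c / d)" using mult_left_mono[OF nu, of q] q by simp
  also have "\<dots> = 1 / (s * d)" using c s d by (simp add: q_def)
  finally have 1: "norm (q *\<^sub>R v + e) \<le> 1 / (s * d)" .
  have "\<bar>q - 1\<bar> \<le> 1 / (s * d)"
    using norm_triangle_ineq3[of "q *\<^sub>R v" "- e"] 1 q(1) by (simp add: nv ne)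
  moreover have "norm (v - q *\<^sub>R v) = \<bar>q - 1\<bar>"
  proof -
    have "v - q *\<^sub>R v = (1 - q) *\<^sub>R v" by (simp add: scaleR_diff_left)
    then show ?thesis using nv by simp
  qed
  moreover have "norm (v + e) \<le> norm (v - q *\<^sub>R v) + norm (q *\<^sub>R v + e)"
    using norm_triangle_ineq[of "v - q *\<^sub>R v" "q *\<^sub>R v + e"] by simp
  ultimately have "norm (v + e) \<le> 1 / (s * d) + 1 / (s * d)" using 1 by linarith
  then show ?thesis by (simp add: dist_norm field_simps)
qed

section \<open>Center direction and center point\<close>

abbreviation cube :: "(real^'n) set" where
  "cube \<equiv> cbox (- One) One"

text \<open>The closest-point map passes to Kuratowski limits and is 1-Lipschitz, so its integral
  depends continuously on \<open>S\<close>, even where the dimension of \<open>S\<close> drops and a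
  centroid of a truncation could jump. The integral is not divided by the volume of the
  cube.\<close>

definition mean_closest_point :: "(real^'n) set \<Rightarrow> real \<Rightarrow> real^'n" where
  "mean_closest_point S R = integral cube (\<lambda>z. closest_point S (R *\<^sub>R z))"

lemma box_cube_nonempty: "box (- One) One \<noteq> ({} :: (real^'n) set)"
  by (simp add: box_ne_empty)

lemma content_cube_pos: "measure lborel (cube :: (real^'n) set) > 0"
  by (rule content_pos_lt) simp

lemma small_in_cube:
  assumes "norm z \<le> 1" shows "(z :: real^'n) \<in> cube"
  unfolding mem_box using Basis_le_norm[of _ z] assms by (fastforce simp: abs_le_iff)

lemma continuous_on_closest_point_scaled:
  assumes "closed S" "convex S" "S \<noteq> {}"
  shows "continuous_on T (\<lambda>z. closest_point S (R *\<^sub>R z))"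
  by (rule continuous_on_compose2[OF continuous_on_closest_point[OF assms(2,1,3), of UNIV]])
     (auto intro!: continuous_intros)

lemma closest_point_scaled_integrable:
  assumes "closed S" "convex S" "S \<noteq> {}"
  shows "(\<lambda>z. closest_point S (R *\<^sub>R z)) integrable_on cube"
  by (intro integrable_continuous continuous_on_closest_point_scaled assms)

lemma inner_mean_closest_point:
  assumes "closed S" "convex S" "S \<noteq> {}"
  shows "a \<bullet> mean_closest_point S R = integral cube (\<lambda>z. a \<bullet> closest_point S (R *\<^sub>R z))"
  using integral_linear[OF closest_point_scaled_integrable[OF assms] bounded_linear_inner_right[of a], of R]
  by (simp add: mean_closest_point_def o_def)

lemma integral_inner_cube: "integral cube (\<lambda>z. a \<bullet> (z :: real^'n)) = 0"
proof -
  have "integral cube (\<lambda>z. a \<bullet> (- z)) = integral cube (\<lambda>z. a \<bullet> (z :: real^'n))"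
    using integral_reflect[of One "- One" "\<lambda>z. a \<bullet> (z :: real^'n)"] by simp
  then show ?thesis by simp
qed

lemma closed_convex_cone_separation:
  fixes C :: "(real^'n) set"
  assumes "closed C" "convex_cone C" "x \<notin> C"
  obtains a where "a \<bullet> x > 0" "\<And>w. w \<in> C \<Longrightarrow> a \<bullet> w \<le> 0"
proof -
  have cv: "convex C" using assms(2) by (simp add: convex_cone_def)
  obtain a b where ab: "a \<bullet> x < b" "\<And>w. w \<in> C \<Longrightarrow> a \<bullet> w > b"
    using separating_hyperplane_closed_point[OF cv assms(1,3)] by blast
  have "b < 0" using ab(2)[OF convex_cone_contains_0[OF assms(2)]] by simp
  have "a \<bullet> w \<ge> 0" if w: "w \<in> C" for w
  proof (rule ccontr)
    assume "\<not> ?thesis"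
    then have n: "a \<bullet> w < 0" by simp
    have "(b / (a \<bullet> w)) *\<^sub>R w \<in> C"
      using n \<open>b < 0\<close> by (intro convex_cone_scaleR[OF assms(2)] w) (simp add: divide_nonpos_neg less_imp_le)
    from ab(2)[OF this] n show False by simp
  qed
  then show ?thesis using that[of "- a"] ab(1) \<open>b < 0\<close> by simp
qed

text \<open>Moreau decomposition: \<open>z\<close> minus its closest point lies in the polar cone,
  as testing the variational inequality at the closest point plus \<open>y\<close> shows.\<close>

lemma closest_point_cone_dual:
  fixes C :: "(real^'n) set"
  assumes "closed C" "convex_cone C" "y \<in> C"
  shows "z \<bullet> y \<le> closest_point C z \<bullet> y"
proof -
  have cv: "convex C" and ne: "C \<noteq> {}" using assms(2) by (auto simp: convex_cone_def)
  have "closest_point C z + y \<in> C"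
    by (intro convex_cone_add[OF assms(2)] closest_point_in_set assms ne)
  from closest_point_dot[OF cv assms(1) this, of z] show ?thesis by (simp add: inner_diff_left)
qed

text \<open>By the symmetry of the cube the mean does not change if \<open>z\<close> is subtracted from the closest point
  of \<open>z\<close>, and this difference is the negative of the closest point in the polar cone.\<close>

lemma mean_closest_point_dual:
  fixes C :: "(real^'n) set"
  assumes C: "closed C" "convex_cone C" "y \<in> C"
  shows "0 \<le> mean_closest_point C 1 \<bullet> y" 
    and "mean_closest_point C 1 \<bullet> y = 0 \<Longrightarrow> - y \<in> C"
proof -
  have cv: "convex C" and ne: "C \<noteq> {}" using assms(2) by (auto simp: convex_cone_def)
  define g where "g z = y \<bullet> closest_point C (1 *\<^sub>R z) - y \<bullet> z" for z
  have cont: "continuous_on cube g" unfolding g_def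
    by (intro continuous_intros continuous_on_closest_point_scaled C cv ne)
  have nn: "g z \<ge> 0" for z
    using closest_point_cone_dual[OF C, of z] by (simp add: g_def inner_commute)
  have "integral cube g = integral cube (\<lambda>z. y \<bullet> closest_point C (1 *\<^sub>R z)) - integral cube (\<lambda>z. y \<bullet> z)"
    unfolding g_def
    by (intro integral_diff integrable_continuous continuous_intros continuous_on_closest_point_scaled C cv ne)
  then have int: "integral cube g = mean_closest_point C 1 \<bullet> y"
    using inner_mean_closest_point[OF C(1) cv ne, of y 1] integral_inner_cube[of y]
    by (simp add: inner_commute[of _ "mean_closest_point C 1"] inner_commute[of y "mean_closest_point C 1"])
  show "0 \<le> mean_closest_point C 1 \<bullet> y"
    unfolding int[symmetric] by (intro integral_nonneg integrable_continuous cont nn)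
  assume "mean_closest_point C 1 \<bullet> y = 0"
  then have "integral cube g = 0" using int by simp
  then have z: "g z = 0" if "z \<in> cube" for z
    using integral_cbox_eq_0_iff[OF cont box_cube_nonempty] nn that by blast
  show "- y \<in> C"
  proof (rule ccontr)
    assume "- y \<notin> C"
    from closed_convex_cone_separation[OF C(1,2) this]
    obtain a where a: "a \<bullet> (- y) > 0" "\<And>w. w \<in> C \<Longrightarrow> a \<bullet> w \<le> 0" by blast
    \<comment> \<open>A unit vector of the polar cone lies in the cube and has closest point 0, so
      \<open>g\<close> is positive there unless \<open>b \<bullet> y = 0\<close>.\<close>
    define b where "b = a /\<^sub>R norm a"
    have "a \<noteq> 0" using a(1) by auto
    then have b: "norm b = 1" "b \<bullet> y < 0" "\<And>w. w \<in> C \<Longrightarrow> b \<bullet> w \<le> 0"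
      using a by (auto simp: b_def mult_pos_neg mult_nonneg_nonpos)
    have "dist b 0 \<le> dist b w" if w: "w \<in> C" for w
    proof -
      have "(dist b w)\<^sup>2 = (norm b)\<^sup>2 - 2 * (b \<bullet> w) + (norm w)\<^sup>2"
        unfolding dist_norm power2_norm_eq_inner by (simp add: inner_diff_left inner_diff_right inner_commute)
      then have "(dist b 0)\<^sup>2 \<le> (dist b w)\<^sup>2" using b(3)[OF w] by (simp add: order_trans[of "2 * (b \<bullet> w)" 0])
      then show ?thesis by (rule power2_le_imp_le) simp
    qed
    then have "closest_point C b = 0"
      using closest_point_unique[OF cv C(1) convex_cone_contains_0[OF C(2)], of b] by simp
    then have "g b = - (y \<bullet> b)" by (simp add: g_def)
    then show False using z[OF small_in_cube[of b]] b by (simp add: inner_commute)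
  qed
qed

lemma mean_closest_point_in_cone:
  fixes C :: "(real^'n) set"
  assumes C: "closed C" "convex_cone C" shows "mean_closest_point C R \<in> C"
proof (rule ccontr)
  have cv: "convex C" and ne: "C \<noteq> {}" using assms(2) by (auto simp: convex_cone_def)
  assume "\<not> ?thesis"
  from closed_convex_cone_separation[OF C this]
  obtain a where a: "a \<bullet> mean_closest_point C R > 0" "\<And>w. w \<in> C \<Longrightarrow> a \<bullet> w \<le> 0" by blast
  have "0 \<le> integral cube (\<lambda>z. - (a \<bullet> closest_point C (R *\<^sub>R z)))"
    using a(2) closest_point_in_set[OF C(1) ne]
    by (intro integral_nonneg integrable_continuous continuous_intros continuous_on_closest_point_scaled C cv ne) auto
  then show False using a(1) inner_mean_closest_point[OF C(1) cv ne, of a R] by simp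
qed

definition center_dir :: "(real^'n) set \<Rightarrow> real^'n" where
  "center_dir C = mean_closest_point C 1 /\<^sub>R norm (mean_closest_point C 1)"

lemma center_dir:
  fixes C :: "(real^'n) set"
  assumes C: "closed C" "convex_cone C" and nl: "\<exists>y\<in>C. - y \<notin> C"
  shows "norm (center_dir C) = 1" "center_dir C \<in> C" "mean_closest_point C 1 \<noteq> 0"
    "\<And>y. y \<in> C \<Longrightarrow> 0 \<le> center_dir C \<bullet> y" 
    "\<And>y. y \<in> C \<Longrightarrow> center_dir C \<bullet> y = 0 \<Longrightarrow> - y \<in> C"
proof -
  show nz: "mean_closest_point C 1 \<noteq> 0" using nl mean_closest_point_dual(2)[OF C] by fastforce
  show "norm (center_dir C) = 1" using nz by (simp add: center_dir_def)
  show "center_dir C \<in> C" unfolding center_dir_def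
    by (intro convex_cone_scaleR[OF C(2)] mean_closest_point_in_cone C) simp
  show "0 \<le> center_dir C \<bullet> y" if "y \<in> C" for y
    using mean_closest_point_dual(1)[OF C that] by (simp add: center_dir_def)
  show "- y \<in> C" if "y \<in> C" "center_dir C \<bullet> y = 0" for y
    using mean_closest_point_dual(2)[OF C that(1)] that(2) nz by (simp add: center_dir_def)
qed

text \<open>No other unit vector lies in both the half-space and its dual: \<open>u - e\<close> lies
  in the half-space because \<open>u \<bullet> e \<le> 1\<close>, and testing \<open>e\<close>
  against it gives \<open>1 \<le> u \<bullet> e\<close>.\<close>

lemma center_dir_halfspace:
  fixes u :: "real^'n"
  assumes "norm u = 1" shows "center_dir {y. 0 \<le> u \<bullet> y} = u"
proof -
  define C where "C = {y. 0 \<le> u \<bullet> y}"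
  have uu: "u \<bullet> u = 1" using assms by (simp add: norm_eq_1)
  have C: "closed C" "convex_cone C" unfolding C_def
    using closed_halfspace_ge[of 0 u] convex_cone_halfspace_ge[of u] by auto
  have "u \<in> C" "- u \<notin> C" using uu by (auto simp: C_def)
  then have nl: "\<exists>y\<in>C. - y \<notin> C" by blast
  define e where "e = center_dir C"
  note e = center_dir[OF C nl, folded e_def]
  have ee: "e \<bullet> e = 1" using e(1) by (simp add: norm_eq_1)
  have "u \<bullet> e \<le> 1" using norm_cauchy_schwarz[of u e] assms e(1) by simp
  then have "u - e \<in> C" by (simp add: C_def inner_diff_right uu)
  from e(4)[OF this] have "1 \<le> u \<bullet> e" by (simp add: inner_diff_right ee inner_commute)
  then have "(u - e) \<bullet> (u - e) \<le> 0" by (simp add: inner_diff_left inner_diff_right uu ee inner_commute)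
  then have "u - e = 0" using inner_gt_zero_iff[of "u - e"] by fastforce
  then show ?thesis by (simp add: e_def C_def)
qed

text \<open>Dominated convergence. The bound consists of the norms of the closest points of the
  origin, which converge, and the 1-Lipschitz estimate over the scaled cube.\<close>

lemma mean_closest_point_tendsto:
  fixes L :: "(real^'n) set"
  assumes K: "kconv K L" "\<And>j. closed (K j)" "\<And>j. convex (K j)" "closed L" "convex L" "L \<noteq> {}"
    and R: "R \<longlonglongrightarrow> r"
  shows "(\<lambda>j. mean_closest_point (K j) (R j)) \<longlonglongrightarrow> mean_closest_point L r"
proof -
  have "(\<lambda>j. closest_point (K j) 0) \<longlonglongrightarrow> closest_point L 0"
    by (rule kconv_closest_point[OF K(1,2,4,5,6) tendsto_const])
  then have "bounded (range (\<lambda>j. closest_point (K j) 0))" "bounded (range R)"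
    using R by (auto intro: convergent_imp_bounded)
  then obtain A B where A: "\<And>j. norm (closest_point (K j) 0) \<le> A" and B: "\<And>j. \<bar>R j\<bar> \<le> B"
    by (auto simp: bounded_iff)
  obtain M where M: "\<And>z. z \<in> cube \<Longrightarrow> norm (z :: real^'n) \<le> M"
    using bounded_cbox[of "- One :: real^'n" One] by (auto simp: bounded_iff)
  show ?thesis unfolding mean_closest_point_def
  proof (rule dominated_convergence(2)[where h = "\<lambda>_. A + B * M"])
    show "(\<lambda>z. closest_point (K k) (R k *\<^sub>R z)) integrable_on cube" for k
      by (intro closest_point_scaled_integrable K kconv_nonempty[OF K(1)])
    show "(\<lambda>_ :: real^'n. A + B * M) integrable_on cube" by (rule integrable_const)
    show "norm (closest_point (K k) (R k *\<^sub>R z)) \<le> A + B * M" if z: "z \<in> cube" for k and z :: "real^'n"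
    proof -
      have "dist (closest_point (K k) (R k *\<^sub>R z)) (closest_point (K k) 0) \<le> dist (R k *\<^sub>R z) 0"
        by (intro closest_point_lipschitz K kconv_nonempty[OF K(1)])
      also have "\<dots> = \<bar>R k\<bar> * norm z" by simp
      also have "\<dots> \<le> B * M" using B[of k] M[OF z] by (intro mult_mono) auto
      finally have "norm (closest_point (K k) (R k *\<^sub>R z) - closest_point (K k) 0) \<le> B * M" by (simp add: dist_norm)
      then show ?thesis using A[of k] norm_triangle_sub[of "closest_point (K k) (R k *\<^sub>R z)" "closest_point (K k) 0"] by linarith
    qed
    show "(\<lambda>k. closest_point (K k) (R k *\<^sub>R z)) \<longlonglongrightarrow> closest_point L (r *\<^sub>R z)" for z :: "real^'n"
      by (intro kconv_closest_point K tendsto_intros R)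
  qed
qed

lemma center_dir_tendsto:
  fixes C :: "(real^'n) set"
  assumes "kconv D C" "\<And>j. closed (D j)" "\<And>j. convex (D j)" "closed C" "convex_cone C" "\<exists>y\<in>C. - y \<notin> C"
  shows "(\<lambda>j. center_dir (D j)) \<longlonglongrightarrow> center_dir C"
  unfolding center_dir_def using assms center_dir(3)[OF assms(4-6)]
  by (intro tendsto_intros mean_closest_point_tendsto) (auto simp: convex_cone_def)

section \<open>A continuously chosen interior point and its depth\<close>

text \<open>The scale exceeds the distance from the origin to \<open>K\<close> by 1. So the scaled
  cube contains interior points of \<open>K\<close>, which are their own closest points and pull the
  mean off the boundary.\<close>

definition center_pt :: "(real^'n) set \<Rightarrow> real^'n" where
  "center_pt K = mean_closest_point K (norm (closest_point K 0) + 1) /\<^sub>R measure lborel (cube :: (real^'n) set)"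

text \<open>If the mean is not interior, a separating functional \<open>a\<close> satisfies
  \<open>a \<bullet> x \<le> b\<close> on \<open>K\<close> but has mean value at least
  \<open>b\<close>, so the continuous gap \<open>g\<close> vanishes on the cube. At
  \<open>x0 /\<^sub>R R\<close> with \<open>x0\<close> interior to \<open>K\<close> it cannot
  vanish.\<close>

lemma center_pt_in_interior:
  fixes K :: "(real^'n) set"
  assumes K: "closed K" "convex K" "interior K \<noteq> {}"
  shows "center_pt K \<in> interior K"
proof (rule ccontr)
  assume nin: "center_pt K \<notin> interior K"
  have ne: "K \<noteq> {}" using K(3) by auto
  define R where "R = norm (closest_point K 0) + 1"
  have R: "R > 0" unfolding R_def using norm_ge_zero[of "closest_point K 0"] by linarith
  define m where "m = measure lborel (cube :: (real^'n) set)"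
  have m: "m > 0" unfolding m_def by (rule content_cube_pos)
  have c: "center_pt K = mean_closest_point K R /\<^sub>R m" by (simp add: center_pt_def R_def m_def)
  obtain a b where ab: "a \<noteq> 0" "\<And>x. x \<in> interior K \<Longrightarrow> a \<bullet> x \<le> b" "a \<bullet> center_pt K \<ge> b"
    using separating_hyperplane_sets[of "interior K" "{center_pt K}"] K(2,3) nin by (auto simp: convex_interior)
  have Kb: "a \<bullet> x \<le> b" if "x \<in> K" for x
  proof -
    have "K \<subseteq> closure (interior K)" using convex_closure_interior[OF K(2,3)] closure_subset by blast
    moreover have "closure (interior K) \<subseteq> {x. a \<bullet> x \<le> b}"
      using ab(2) by (intro closure_minimal closed_halfspace_le) auto
    ultimately show ?thesis using that by blast
  qed
  define g where "g z = b - a \<bullet> closest_point K (R *\<^sub>R z)" for z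
  have cont: "continuous_on cube g" unfolding g_def
    by (intro continuous_intros continuous_on_closest_point_scaled K ne)
  have nn: "g z \<ge> 0" for z
    using Kb[OF closest_point_in_set[OF K(1) ne]] by (simp add: g_def)
  have "integral cube g = m * b - a \<bullet> mean_closest_point K R"
    unfolding g_def inner_mean_closest_point[OF K(1,2) ne]
    by (subst integral_diff)
       (auto intro!: integrable_continuous continuous_intros continuous_on_closest_point_scaled K ne simp: m_def)
  also have "a \<bullet> mean_closest_point K R = m * (a \<bullet> center_pt K)" using m by (simp add: c)
  also have "m * b - m * (a \<bullet> center_pt K) \<le> 0" using ab(3) m by simp
  finally have "integral cube g = 0"
    using integral_nonneg[OF integrable_continuous[OF cont] nn] by simp
  then have z: "g z = 0" if "z \<in> cube" for z
    using integral_cbox_eq_0_iff[OF cont box_cube_nonempty] nn that by blast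
  have "closest_point K 0 \<in> closure (interior K)"
    using closest_point_in_set[OF K(1) ne, of 0] convex_closure_interior[OF K(2,3)] closure_subset by blast
  then obtain x0 where x0: "x0 \<in> interior K" "dist x0 (closest_point K 0) < 1"
    unfolding closure_approachable by (meson zero_less_one)
  have x0K: "x0 \<in> K" using x0(1) interior_subset by blast
  have "norm x0 \<le> R" using x0(2) norm_triangle_sub[of x0 "closest_point K 0"] by (simp add: R_def dist_norm)
  then have "x0 /\<^sub>R R \<in> cube" using R by (intro small_in_cube) (simp add: field_simps)
  from z[OF this] have "a \<bullet> x0 = b" using R x0K closest_point_self[OF x0K] by (simp add: g_def)
  moreover obtain d where d: "d > 0" "cball x0 d \<subseteq> K" using x0(1) by (auto simp: mem_interior_cball)
  have "x0 + (d / norm a) *\<^sub>R a \<in> K" using d(1) ab(1) by (intro subsetD[OF d(2)]) (simp add: dist_norm)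
  from Kb[OF this] have "a \<bullet> x0 + (d / norm a) * (a \<bullet> a) \<le> b" by (simp add: inner_add_right)
  moreover have "(d / norm a) * (a \<bullet> a) > 0" using d(1) ab(1) by simp
  ultimately show False by linarith
qed

lemma center_pt_tendsto:
  fixes L :: "(real^'n) set"
  assumes "kconv K L" "\<And>j. closed (K j)" "\<And>j. convex (K j)" "closed L" "convex L" "L \<noteq> {}"
  shows "(\<lambda>j. center_pt (K j)) \<longlonglongrightarrow> center_pt L"
  unfolding center_pt_def
  by (intro tendsto_intros mean_closest_point_tendsto kconv_closest_point assms)

text \<open>Since \<open>infdist\<close> to the empty set is 0, the whole space has depth 0
  everywhere; for this reason \<open>UNIV\<close> is excluded below.\<close>

definition depth :: "(real^'n) set \<Rightarrow> real^'n \<Rightarrow> real" where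
  "depth K p = infdist p (- K)"

lemma ball_depth_subset: "ball p (depth K p) \<subseteq> K"
  using infdist_le[of _ "- K" p] unfolding depth_def by force

lemma depth_pos:
  assumes "p \<in> interior K" "K \<noteq> UNIV" shows "depth K p > 0"
proof -
  have "p \<notin> closure (- K)" using assms(1) by (simp add: closure_complement)
  then show ?thesis using assms(2) in_closure_iff_infdist_zero[of "- K" p] infdist_nonneg[of p "- K"]
    by (auto simp: depth_def less_le)
qed

lemma depth_halfspace:
  fixes u :: "real^'n"
  assumes u: "norm u = 1" and p: "u \<bullet> p \<ge> c"
  shows "depth {x. c \<le> u \<bullet> x} p = u \<bullet> p - c"
proof (rule antisym)
  have uu: "u \<bullet> u = 1" using u by (simp add: norm_eq_1)
  have ne: "- {x. c \<le> u \<bullet> x} \<noteq> {}"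
  proof -
    have "(c - 1) *\<^sub>R u \<in> - {x. c \<le> u \<bullet> x}" by (simp add: uu)
    then show ?thesis by blast
  qed
  show "depth {x. c \<le> u \<bullet> x} p \<le> u \<bullet> p - c"
  proof (rule field_le_epsilon)
    fix e :: real assume e: "e > 0"
    have "p - (u \<bullet> p - c + e) *\<^sub>R u \<in> - {x. c \<le> u \<bullet> x}" using e by (simp add: inner_diff_right uu)
    then have "depth {x. c \<le> u \<bullet> x} p \<le> dist p (p - (u \<bullet> p - c + e) *\<^sub>R u)"
      unfolding depth_def by (rule infdist_le)
    also have "\<dots> = u \<bullet> p - c + e" using u e p by (simp add: dist_norm)
    finally show "depth {x. c \<le> u \<bullet> x} p \<le> u \<bullet> p - c + e" .
  qed
  show "u \<bullet> p - c \<le> depth {x. c \<le> u \<bullet> x} p"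
    unfolding depth_def infdist_notempty[OF ne]
  proof (rule cINF_greatest[OF ne])
    fix y assume "y \<in> - {x. c \<le> u \<bullet> x}"
    then have "u \<bullet> y < c" by simp
    moreover have "u \<bullet> (p - y) \<le> norm u * norm (p - y)" by (rule norm_cauchy_schwarz)
    ultimately show "u \<bullet> p - c \<le> dist p y" using u by (simp add: inner_diff_right dist_norm)
  qed
qed

text \<open>From above: a point outside \<open>L\<close> is eventually outside \<open>K j\<close>.
  From below: points missing from \<open>K j\<close> within \<open>r < depth L q\<close> of
  \<open>p j\<close> would accumulate at an interior point of \<open>L\<close>, contradicting
  \<open>kconv_eventually_in\<close>.\<close>

lemma depth_tendsto:
  fixes L :: "(real^'n) set"
  assumes K: "kconv K L" "\<And>j. closed (K j)" "\<And>j. convex (K j)" and L: "closed L" "L \<noteq> UNIV"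
    and p: "p \<longlonglongrightarrow> q" "q \<in> interior L"
  shows "(\<lambda>j. depth (K j) (p j)) \<longlonglongrightarrow> depth L q"
proof (rule order_tendstoI)
  have out: "\<forall>\<^sub>F j in sequentially. y \<notin> K j" if y: "y \<notin> L" for y
  proof (rule ccontr)
    assume "\<not> ?thesis"
    then obtain r :: "nat \<Rightarrow> nat" where "strict_mono r" "\<And>j. y \<in> K (r j)"
      using not_eventually_sequentiallyD by blast
    from kconv_limit_in[OF K(1) this tendsto_const] y show False by blast
  qed
  {
    fix a assume "a > depth L q"
    have ne: "- L \<noteq> {}" using L(2) by blast
    obtain y where y: "y \<notin> L" "dist q y < a"
    proof (rule ccontr)
      assume "\<not> thesis"
      then have "a \<le> dist q y" if "y \<in> - L" for y using that \<open>\<And>y. y \<notin> L \<Longrightarrow> dist q y < a \<Longrightarrow> thesis\<close> by force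
      then have "a \<le> depth L q" unfolding depth_def infdist_notempty[OF ne] by (rule cINF_greatest[OF ne])
      then show False using \<open>a > depth L q\<close> by simp
    qed
    have "\<forall>\<^sub>F j in sequentially. dist (p j) y < a"
      using tendsto_dist[OF p(1) tendsto_const] y(2) by (rule order_tendstoD)
    then show "\<forall>\<^sub>F j in sequentially. depth (K j) (p j) < a"
      using out[OF y(1)]
    proof eventually_elim
      case (elim j)
      then show ?case using infdist_le[of y "- K j" "p j"] by (simp add: depth_def)
    qed
  }
  {
    fix a assume a: "a < depth L q"
    obtain r where r: "a < r" "r < depth L q" using dense[OF a] by blast
    obtain y where y: "y \<notin> L" using L(2) by blast
    have "\<forall>\<^sub>F j in sequentially. \<forall>x. dist (p j) x < r \<longrightarrow> x \<in> K j"
    proof (rule ccontr)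
      assume "\<not> ?thesis"
      then obtain s :: "nat \<Rightarrow> nat" where s: "strict_mono s" "\<And>j. \<exists>x. dist (p (s j)) x < r \<and> x \<notin> K (s j)"
        using not_eventually_sequentiallyD[of "\<lambda>j. \<forall>x. dist (p j) x < r \<longrightarrow> x \<in> K j"] by auto
      then obtain x where x: "\<And>j. dist (p (s j)) (x j) < r" "\<And>j. x j \<notin> K (s j)" by metis
      have "bounded (range p)" using p(1) by (auto intro: convergent_imp_bounded)
      then obtain M where M: "\<And>j. norm (p j) \<le> M" by (auto simp: bounded_iff)
      have "norm (x j) \<le> M + r" for j
        using x(1)[of j] M[of "s j"] norm_triangle_sub[of "x j" "p (s j)"] by (simp add: dist_norm norm_minus_commute)
      then have "bounded (range x)" by (auto intro!: boundedI)
      then obtain l v where v: "strict_mono v" "(x \<circ> v) \<longlonglongrightarrow> l" using bounded_imp_convergent_subsequence by blast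
      have sv: "strict_mono (\<lambda>j. s (v j))" using s(1) v(1) by (simp add: strict_mono_def)
      have xl: "(\<lambda>j. x (v j)) \<longlonglongrightarrow> l" using v(2) by (simp add: o_def)
      have "(\<lambda>j. dist (p (s (v j))) (x (v j))) \<longlonglongrightarrow> dist q l"
        using LIMSEQ_subseq_LIMSEQ[OF p(1) sv] by (intro tendsto_dist xl) (simp add: o_def)
      then have "dist q l \<le> r" by (rule LIMSEQ_le_const2) (auto intro: less_imp_le x(1))
      then have "l \<in> ball q (depth L q)" using r(2) by simp
      then have "l \<in> interior L" using ball_depth_subset[of q L] interior_maximal[OF _ open_ball] by blast
      then have "\<forall>\<^sub>F j in sequentially. x (v j) \<in> K (s (v j))"
        using kconv_eventually_in[OF kconv_subseq[OF K(1) sv]] K(2,3) xl by blast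
      then show False using x(2) by (auto simp: eventually_sequentially)
    qed
    then show "\<forall>\<^sub>F j in sequentially. a < depth (K j) (p j)"
      using out[OF y]
    proof eventually_elim
      case (elim j)
      then have ne: "- K j \<noteq> {}" by blast
      have "r \<le> depth (K j) (p j)" unfolding depth_def infdist_notempty[OF ne]
        using elim(1) by (intro cINF_greatest[OF ne]) force
      then show ?case using r(1) by simp
    qed
  }
qed

section \<open>Convergence of the projective flow\<close>

definition proj_flow :: "real^'n \<Rightarrow> real \<Rightarrow> (real^'n) set \<Rightarrow> (real^'n) set" where
  "proj_flow e t X = (if t = 1 then {y. 0 \<le> e \<bullet> y} else proj_image e (t / (1 - t)) X)"

lemma recession_cone_halfspace: "recession_cone {y. c \<le> e \<bullet> y} = {y. 0 \<le> (e :: real^'n) \<bullet> y}"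
proof (cases "e = 0")
  case False
  have "v \<in> recession_cone {y. c \<le> e \<bullet> y} \<longleftrightarrow> 0 \<le> e \<bullet> v" for v
  proof
    assume v: "v \<in> recession_cone {y. c \<le> e \<bullet> y}"
    have "(c / (e \<bullet> e)) *\<^sub>R e \<in> {y. c \<le> e \<bullet> y}" using False by simp
    from recession_coneD[OF v this] show "0 \<le> e \<bullet> v" using False by (simp add: inner_add_right)
  qed (auto simp: recession_cone_def inner_add_right)
  then show ?thesis by auto
qed (auto simp: recession_cone_def)

lemma interior_add_recession:
  assumes "x \<in> interior X" "v \<in> recession_cone X" shows "x + v \<in> interior X"
proof -
  have "(+) v ` interior X \<subseteq> X"
    using recession_coneD[OF assms(2)] interior_subset by (force simp: add.commute)
  moreover have "open ((+) v ` interior X)" by (rule open_translation) simp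
  ultimately have "(+) v ` interior X \<subseteq> interior X" by (simp add: interior_maximal)
  then show ?thesis using assms(1) by (auto simp: add.commute)
qed

lemma flow_factor: "t < 1 \<Longrightarrow> 1 + t / (1 - t) * q = (1 - t + t * q) / (1 - (t::real))"
  by (simp add: field_simps)

text \<open>With denominators cleared the criterion remains meaningful at \<open>t = 1\<close>,
  where it reads \<open>0 \<in> X\<close>. Times tending to 1 and the time 1 itself can thus be
  handled together.\<close>

lemma mem_proj_flow:
  assumes X: "axial_body e X" and t: "t \<in> {0..1}" and y: "e \<bullet> y > 0"
  shows "y \<in> proj_flow e t X \<longleftrightarrow> ((1 - t) / (1 - t + t * (e \<bullet> y))) *\<^sub>R y \<in> X"
proof (cases "t = 1")
  case True
  then show ?thesis using y axial_bodyD(4)[OF X] by (simp add: proj_flow_def)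
next
  case False
  then have t1: "t < 1" "0 \<le> t" using t by auto
  have "1 - t + t * (e \<bullet> y) > 0" using t1 y by (simp add: add_pos_nonneg)
  then show ?thesis using t1 False unfolding proj_flow_def proj_image_def mem_Collect_eq flow_factor[OF t1(1)]
    by (simp add: zero_less_divide_iff inverse_eq_divide)
qed

lemma proj_flow_nonneg:
  assumes "t \<in> {0..1}" "y \<in> proj_flow e t X"
  shows "1 - t + t * (e \<bullet> y) \<ge> 0"
proof (cases "t = 1")
  case False
  then have t1: "t < 1" using assms by auto
  have "0 < (1 - t + t * (e \<bullet> y)) / (1 - t)"
    using assms(2) False unfolding flow_factor[OF t1, symmetric] by (simp add: proj_flow_def proj_image_def)
  then show ?thesis using t1 by (simp add: zero_less_divide_iff)
qed (use assms in \<open>simp add: proj_flow_def\<close>)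

lemma zero_in_proj_flow:
  assumes "axial_body e X" "t \<in> {0..1}" shows "0 \<in> proj_flow e t X"
  using axial_bodyD(4)[OF assms(1)] by (simp add: proj_flow_def proj_image_def)

lemma recession_cone_subset_proj_flow:
  assumes X: "axial_body e X" and t: "t \<in> {0..1}"
  shows "recession_cone X \<subseteq> recession_cone (proj_flow e t X)"
proof (cases "t = 1")
  case True
  then show ?thesis using axial_bodyD(8)[OF X] by (auto simp: proj_flow_def recession_cone_halfspace)
next
  case False
  then show ?thesis using recession_cone_subset_proj_image[OF X, of "t / (1 - t)"] t by (simp add: proj_flow_def)
qed

lemma recession_cone_proj_flowI:
  assumes X: "axial_body e X" and t: "t \<in> {0..1}" "t > 0" and y: "e \<bullet> y > 0"
    and z: "((1 - t) / (t * (e \<bullet> y))) *\<^sub>R y \<in> X"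
  shows "y \<in> recession_cone (proj_flow e t X)"
proof (cases "t = 1")
  case True
  then show ?thesis using y by (simp add: proj_flow_def recession_cone_halfspace)
next
  case False
  then have s: "t / (1 - t) > 0" using t by simp
  have "y /\<^sub>R (t / (1 - t) * (e \<bullet> y)) \<in> X" using z by (simp add: divide_inverse mult_ac)
  then show ?thesis using recession_cone_proj_imageI[OF X s y] False by (simp add: proj_flow_def)
qed

lemma kconv_eventually_eq:
  assumes "kconv K' L" "\<forall>\<^sub>F j in sequentially. K j = K' j" "\<And>j. K j \<noteq> {}"
  shows "kconv K L"
  unfolding kconv_def
proof (intro conjI allI ballI impI)
  fix x assume "x \<in> L"
  from kconv_infdist[OF assms(1) this]
  show "(\<lambda>j. infdist x (K j)) \<longlonglongrightarrow> 0"
    by (rule Lim_transform_eventually) (use assms(2) in eventually_elim, simp)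
next
  fix r \<xi> x assume r: "strict_mono r" "\<forall>j. \<xi> j \<in> K (r j)" "\<xi> \<longlonglongrightarrow> x"
  obtain N where N: "\<And>j. j \<ge> N \<Longrightarrow> K j = K' j" using assms(2) by (auto simp: eventually_sequentially)
  show "x \<in> L"
  proof (rule kconv_limit_in[OF assms(1)])
    show "strict_mono (\<lambda>j. r (j + N))" using r(1) by (simp add: strict_mono_def)
    show "(\<lambda>j. \<xi> (j + N)) \<longlonglongrightarrow> x" using r(3) by (rule LIMSEQ_ignore_initial_segment)
    show "\<xi> (j + N) \<in> K' (r (j + N))" for j
    proof -
      have "N \<le> r (j + N)" using strict_mono_imp_increasing[OF r(1), of "j + N"] by simp
      then show ?thesis using N[of "r (j + N)"] r(2) by metis
    qed
  qed
qed (rule assms(3))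

lemma kconv_proj_image:
  fixes X :: "nat \<Rightarrow> (real^'n) set"
  assumes X: "kconv X L" "\<And>j. axial_body (e j) (X j)" "axial_body f L" and e: "e \<longlonglongrightarrow> f"
    and s: "s \<longlonglongrightarrow> t" "t \<ge> 0"
  shows "kconv (\<lambda>j. proj_image (e j) (s j) (X j)) (proj_image f t L)"
  unfolding kconv_def
proof (intro conjI allI ballI impI)
  show "proj_image (e j) (s j) (X j) \<noteq> {}" for j
    using axial_bodyD(4)[OF X(2)[of j]] by (auto simp: proj_image_def intro!: exI[of _ 0])
  fix y assume y: "y \<in> proj_image f t L"
  define D where "D = 1 + t * (f \<bullet> y)"
  have D: "D > 0" "y /\<^sub>R D \<in> L" using y by (auto simp: proj_image_def D_def)
  obtain \<xi> where \<xi>: "\<And>j. \<xi> j \<in> X j" "\<xi> \<longlonglongrightarrow> y /\<^sub>R D" using kconv_seq[OF X(1) D(2)] by blast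
  \<comment> \<open>The denominator of the forward map at \<xi>; its limit \<open>1 / D\<close> is
    positive, so the approximating points are eventually in the domain.\<close>
  define E where "E j = 1 - s j * (e j \<bullet> \<xi> j)" for j
  have "E \<longlonglongrightarrow> 1 - t * (f \<bullet> (y /\<^sub>R D))" unfolding E_def by (intro tendsto_intros s e \<xi>)
  moreover have "1 - t * (f \<bullet> (y /\<^sub>R D)) = 1 / D" using D(1) by (simp add: field_simps) (simp add: D_def)
  ultimately have El: "E \<longlonglongrightarrow> 1 / D" by simp
  show "(\<lambda>j. infdist y (proj_image (e j) (s j) (X j))) \<longlonglongrightarrow> 0"
  proof (rule infdist_tendsto_0I)
    have "(\<lambda>j. \<xi> j /\<^sub>R E j) \<longlonglongrightarrow> (y /\<^sub>R D) /\<^sub>R (1 / D)" using D(1) by (intro tendsto_intros \<xi> El) simp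
    then show "(\<lambda>j. \<xi> j /\<^sub>R E j) \<longlonglongrightarrow> y" using D(1) by simp
    have "\<forall>\<^sub>F j in sequentially. E j > 0" by (rule order_tendstoD(1)[OF El]) (use D(1) in simp)
    then show "\<forall>\<^sub>F j in sequentially. \<xi> j /\<^sub>R E j \<in> proj_image (e j) (s j) (X j)"
    proof eventually_elim
      case (elim j)
      have 1: "1 + s j * (e j \<bullet> (\<xi> j /\<^sub>R E j)) = 1 / E j" using elim by (simp add: field_simps) (simp add: E_def)
      show ?case unfolding proj_image_def mem_Collect_eq 1 using elim \<xi>(1) by simp
    qed
  qed
next
  fix r \<xi> x assume r: "strict_mono r" "\<forall>j. \<xi> j \<in> proj_image (e (r j)) (s (r j)) (X (r j))" "\<xi> \<longlonglongrightarrow> x"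
  show "x \<in> proj_image f t L"
    by (rule kconv_proj_image_limit[OF X(1) axial_bodyD(2)[OF X(2)] r(1) _ r(3) _ _ s(2) axial_bodyD(8)[OF X(3)]])
       (use r(2) LIMSEQ_subseq_LIMSEQ[OF e r(1)] LIMSEQ_subseq_LIMSEQ[OF s(1) r(1)] in \<open>auto simp: o_def\<close>)
qed

text \<open>The new case is \<open>t = 1\<close>. A point with \<open>f \<bullet> y > 0\<close> is
  pulled back to points tending to 0, an interior point of \<open>L\<close>, and so belongs to the
  images eventually; other points of the half-space are first pushed along \<open>f\<close>.
  Conversely the nonnegative denominators turn in the limit into
  \<open>0 \<le> f \<bullet> x\<close>.\<close>

lemma kconv_proj_flow:
  fixes X :: "nat \<Rightarrow> (real^'n) set"
  assumes X: "kconv X L" "\<And>j. axial_body (e j) (X j)" "axial_body f L" and e: "e \<longlonglongrightarrow> f"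
    and s: "s \<longlonglongrightarrow> t" "\<And>j. s j \<in> {0..1}" "t \<in> {0..1}"
  shows "kconv (\<lambda>j. proj_flow (e j) (s j) (X j)) (proj_flow f t L)"
proof (cases "t = 1")
  case False
  then have t: "t < 1" "0 \<le> t" using s(3) by auto
  have ev: "\<forall>\<^sub>F j in sequentially. s j < 1" using s(1) t(1) by (rule order_tendstoD)
  have "(\<lambda>j. s j / (1 - s j)) \<longlonglongrightarrow> t / (1 - t)" using t by (intro tendsto_intros s) simp
  from kconv_proj_image[OF X e this] t
  have "kconv (\<lambda>j. proj_image (e j) (s j / (1 - s j)) (X j)) (proj_flow f t L)"
    using False by (simp add: proj_flow_def)
  then show ?thesis
  proof (rule kconv_eventually_eq)
    show "\<forall>\<^sub>F j in sequentially. proj_flow (e j) (s j) (X j) = proj_image (e j) (s j / (1 - s j)) (X j)"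
      using ev by eventually_elim (simp add: proj_flow_def)
    show "proj_flow (e j) (s j) (X j) \<noteq> {}" for j using zero_in_proj_flow[OF X(2) s(2)] by blast
  qed
next
  case True
  have flow1: "proj_flow f t L = {y. 0 \<le> f \<bullet> y}" using True by (simp add: proj_flow_def)
  have ff: "f \<bullet> f = 1" by (rule axial_bodyD[OF X(3)])
  show ?thesis
    unfolding kconv_def flow1
  proof (intro conjI allI ballI impI)
    show "proj_flow (e j) (s j) (X j) \<noteq> {}" for j using zero_in_proj_flow[OF X(2) s(2)] by blast
    fix x assume x: "x \<in> {y. 0 \<le> f \<bullet> y}"
    have ev: "\<forall>\<^sub>F j in sequentially. y \<in> proj_flow (e j) (s j) (X j)" if y: "f \<bullet> y > 0" for y
    proof -
      have ey: "(\<lambda>j. e j \<bullet> y) \<longlonglongrightarrow> f \<bullet> y" by (intro tendsto_intros e)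
      have "(\<lambda>j. ((1 - s j) / (1 - s j + s j * (e j \<bullet> y))) *\<^sub>R y) \<longlonglongrightarrow> ((1 - 1) / (1 - 1 + 1 * (f \<bullet> y))) *\<^sub>R y"
        using y s(1) True by (intro tendsto_intros ey) auto
      then have lim: "(\<lambda>j. ((1 - s j) / (1 - s j + s j * (e j \<bullet> y))) *\<^sub>R y) \<longlonglongrightarrow> 0" by simp
      have "\<forall>\<^sub>F j in sequentially. ((1 - s j) / (1 - s j + s j * (e j \<bullet> y))) *\<^sub>R y \<in> X j"
        by (rule kconv_eventually_in[OF X(1) axial_bodyD(2)[OF X(2)] axial_bodyD(1)[OF X(2)] lim axial_bodyD(3)[OF X(3)]])
      moreover have "\<forall>\<^sub>F j in sequentially. e j \<bullet> y > 0" using ey y by (rule order_tendstoD)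
      ultimately show ?thesis
        by eventually_elim (simp add: mem_proj_flow[OF X(2) s(2)])
    qed
    show "(\<lambda>j. infdist x (proj_flow (e j) (s j) (X j))) \<longlonglongrightarrow> 0"
    proof (rule infdist_tendsto_0_closure)
      fix \<epsilon> :: real assume \<epsilon>: "\<epsilon> > 0"
      have "f \<bullet> (x + (\<epsilon> / 2) *\<^sub>R f) > 0" using x \<epsilon> ff by (simp add: inner_add_right add_nonneg_pos)
      then have "(\<lambda>j. infdist (x + (\<epsilon> / 2) *\<^sub>R f) (proj_flow (e j) (s j) (X j))) \<longlonglongrightarrow> 0"
        by (intro infdist_tendsto_0I[OF ev tendsto_const])
      moreover have "dist x (x + (\<epsilon> / 2) *\<^sub>R f) < \<epsilon>" using \<epsilon> axial_bodyD(5)[OF X(3)] by (simp add: dist_norm)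
      ultimately show "\<exists>y. dist x y < \<epsilon> \<and> (\<lambda>j. infdist y (proj_flow (e j) (s j) (X j))) \<longlonglongrightarrow> 0" by blast
    qed
  next
    fix r \<xi> x assume r: "strict_mono r" "\<forall>j. \<xi> j \<in> proj_flow (e (r j)) (s (r j)) (X (r j))" "\<xi> \<longlonglongrightarrow> x"
    have "(\<lambda>j. 1 - s (r j) + s (r j) * (e (r j) \<bullet> \<xi> j)) \<longlonglongrightarrow> 1 - 1 + 1 * (f \<bullet> x)"
      using LIMSEQ_subseq_LIMSEQ[OF e r(1)] LIMSEQ_subseq_LIMSEQ[OF s(1) r(1)] True
      by (intro tendsto_intros r(3)) (auto simp: o_def)
    moreover have "1 - s (r j) + s (r j) * (e (r j) \<bullet> \<xi> j) \<ge> 0" for j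
      using proj_flow_nonneg[OF s(2)] r(2) by blast
    ultimately have "1 - 1 + 1 * (f \<bullet> x) \<ge> 0" by (intro LIMSEQ_le_const) auto
    then show "x \<in> {y. 0 \<le> f \<bullet> y}" by simp
  qed
qed

text \<open>For \<open>t > 0\<close> the criterion \<open>recession_cone_proj_flowI\<close> is an interior condition at the
  perturbed direction \<open>y + (\<epsilon> / 2) e\<close>, hence it persists along the sequence.\<close>

lemma kconv_recession_cone_proj_flow:
  fixes X :: "nat \<Rightarrow> (real^'n) set"
  assumes X: "kconv X L" "\<And>j. axial_body (e j) (X j)" "axial_body f L" and e: "e \<longlonglongrightarrow> f"
    and rc: "kconv (\<lambda>j. recession_cone (X j)) (recession_cone L)"
    and s: "s \<longlonglongrightarrow> t" "\<And>j. s j \<in> {0..1}" "t \<in> {0..1}"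
  shows "kconv (\<lambda>j. recession_cone (proj_flow (e j) (s j) (X j))) (recession_cone (proj_flow f t L))"
  unfolding kconv_def
proof (intro conjI allI ballI impI)
  show "recession_cone (proj_flow (e j) (s j) (X j)) \<noteq> {}" for j by (rule recession_cone_nonempty)
  note L = axial_bodyD[OF X(3)]
  fix y assume y: "y \<in> recession_cone (proj_flow f t L)"
  show "(\<lambda>j. infdist y (recession_cone (proj_flow (e j) (s j) (X j)))) \<longlonglongrightarrow> 0"
  proof (cases "t = 0")
    case True
    then have "y \<in> recession_cone L" using y by (simp add: proj_flow_def)
    then obtain \<xi> where \<xi>: "\<And>j. \<xi> j \<in> recession_cone (X j)" "\<xi> \<longlonglongrightarrow> y" using kconv_seq[OF rc] by blast
    show ?thesis
      by (rule infdist_tendsto_0I[OF always_eventually \<xi>(2)])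
         (use \<xi>(1) recession_cone_subset_proj_flow[OF X(2) s(2)] in blast)
  next
    case False
    then have t: "t > 0" "t \<le> 1" using s(3) by auto
    show ?thesis
    proof (rule infdist_tendsto_0_closure)
      fix \<epsilon> :: real assume \<epsilon>: "\<epsilon> > 0"
      define z where "z = y + (\<epsilon> / 2) *\<^sub>R f"
      \<comment> \<open>The factor in \<open>recession_cone_proj_flowI\<close> for the direction
        \<open>z\<close> at time \<open>t\<close>; the aim is that \<open>m *\<^sub>R z\<close> is
        interior to \<open>L\<close>.\<close>
      define m where "m = (1 - t) / (t * (f \<bullet> z))"
      have fz: "f \<bullet> z = f \<bullet> y + \<epsilon> / 2" using L(7) by (simp add: z_def inner_add_right)
      have y0: "0 \<le> f \<bullet> y"
      proof (cases "t = 1")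
        case True then show ?thesis using y by (simp add: proj_flow_def recession_cone_halfspace)
      next
        case False
        then have "t / (1 - t) > 0" using t by simp
        from recession_cone_proj_imageD(1)[OF X(3) this] y False show ?thesis by (simp add: proj_flow_def)
      qed
      then have z0: "f \<bullet> z > 0" using \<epsilon> by (simp add: fz)
      have m0: "m \<ge> 0" using t z0 by (simp add: m_def)
      have "m *\<^sub>R y \<in> interior L"
      proof (cases "t = 1")
        case True then show ?thesis using L(3) by (simp add: m_def)
      next
        case t1: False
        define q where "q = t / (1 - t)"
        have q: "q > 0" using t t1 by (simp add: q_def)
        have yq: "y \<in> recession_cone (proj_image f q L)" using y t1 by (simp add: proj_flow_def q_def)
        show ?thesis
        proof (cases "f \<bullet> y = 0")
          case True
          then have "y \<in> recession_cone L" using recession_cone_proj_imageD(2)[OF X(3) q yq] by blast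
          then have "m *\<^sub>R y \<in> recession_cone L" by (intro recession_cone_scale L m0)
          from interior_add_recession[OF L(3) this] show ?thesis by simp
        next
          case False
          then have fy: "f \<bullet> y > 0" using y0 by simp
          from recession_cone_proj_imageD(3)[OF X(3) q yq this] 
          have x: "y /\<^sub>R (q * (f \<bullet> y)) \<in> L" .
          \<comment> \<open>Since \<open>f \<bullet> z > f \<bullet> y\<close>, the point
            \<open>m *\<^sub>R y\<close> is a proper fraction \<theta> of the slice point, hence
            strictly between it and the interior point 0.\<close>
          define \<theta> where "\<theta> = (f \<bullet> y) / (f \<bullet> z)"
          have \<theta>: "0 < 1 - \<theta>" "1 - \<theta> \<le> 1" using fy z0 \<epsilon> by (auto simp: \<theta>_def fz)
          have "y /\<^sub>R (q * (f \<bullet> y)) - (1 - \<theta>) *\<^sub>R (y /\<^sub>R (q * (f \<bullet> y)) - 0) \<in> interior L"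
            by (rule mem_interior_convex_shrink[OF L(2,3) x \<theta>])
          also have "y /\<^sub>R (q * (f \<bullet> y)) - (1 - \<theta>) *\<^sub>R (y /\<^sub>R (q * (f \<bullet> y)) - 0) = \<theta> *\<^sub>R (y /\<^sub>R (q * (f \<bullet> y)))"
            by (simp add: algebra_simps)
          also have "\<dots> = m *\<^sub>R y"
          proof -
            have "\<theta> * inverse (q * (f \<bullet> y)) = m" using fy z0 t t1 by (simp add: \<theta>_def m_def q_def field_simps)
            then show ?thesis by simp
          qed
          finally show ?thesis .
        qed
      qed
      moreover have "(m * (\<epsilon> / 2)) *\<^sub>R f \<in> recession_cone L" using m0 \<epsilon> by (intro recession_cone_scale L) simp
      ultimately have "m *\<^sub>R y + (m * (\<epsilon> / 2)) *\<^sub>R f \<in> interior L" by (rule interior_add_recession)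
      then have mz: "m *\<^sub>R z \<in> interior L" by (simp add: z_def scaleR_add_right)
      have ez: "(\<lambda>j. e j \<bullet> z) \<longlonglongrightarrow> f \<bullet> z" by (intro tendsto_intros e)
      have lim: "(\<lambda>j. ((1 - s j) / (s j * (e j \<bullet> z))) *\<^sub>R z) \<longlonglongrightarrow> m *\<^sub>R z"
        unfolding m_def using t z0 by (intro tendsto_intros s(1) ez) auto
      have "\<forall>\<^sub>F j in sequentially. ((1 - s j) / (s j * (e j \<bullet> z))) *\<^sub>R z \<in> X j"
        by (rule kconv_eventually_in[OF X(1) axial_bodyD(2)[OF X(2)] axial_bodyD(1)[OF X(2)] lim mz])
      moreover have "\<forall>\<^sub>F j in sequentially. e j \<bullet> z > 0" using ez z0 by (rule order_tendstoD)
      moreover have "\<forall>\<^sub>F j in sequentially. s j > 0" using s(1) t(1) by (rule order_tendstoD)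
      ultimately have "\<forall>\<^sub>F j in sequentially. z \<in> recession_cone (proj_flow (e j) (s j) (X j))"
        by eventually_elim (rule recession_cone_proj_flowI[OF X(2) s(2)])
      then have "(\<lambda>j. infdist z (recession_cone (proj_flow (e j) (s j) (X j)))) \<longlonglongrightarrow> 0"
        by (rule infdist_tendsto_0I[OF _ tendsto_const])
      moreover have "dist y z < \<epsilon>" using \<epsilon> L(5) by (simp add: dist_norm z_def)
      ultimately show "\<exists>x. dist y x < \<epsilon> \<and> (\<lambda>j. infdist x (recession_cone (proj_flow (e j) (s j) (X j)))) \<longlonglongrightarrow> 0" by blast
    qed
  qed
next
  fix r \<xi> x assume "strict_mono r" "\<forall>j. \<xi> j \<in> recession_cone (proj_flow (e (r j)) (s (r j)) (X (r j)))" "\<xi> \<longlonglongrightarrow> x"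
  then show "x \<in> recession_cone (proj_flow f t L)"
    using kconv_recession_cone_limit[OF kconv_proj_flow[OF X e s]] by blast
qed

section \<open>Boundaries of unbounded convex bodies\<close>

text \<open>\<open>Euclidean_space m\<close> consists of the real sequences that vanish from index
  \<open>m\<close> on, so the homeomorphism is given by orthonormal coordinates padded with
  zeros.\<close>

lemma homeomorphic_space_hyperplane_Euclidean_space:
  fixes e :: "real^'n"
  assumes "e \<noteq> 0"
  shows "top_of_set {x. e \<bullet> x = 0} homeomorphic_space Euclidean_space (CARD('n) - 1)"
proof -
  define H where "H = {x. e \<bullet> x = 0}"
  define m where "m = CARD('n) - 1"
  have H: "subspace H" unfolding H_def by (rule subspace_hyperplane)
  obtain B where B: "B \<subseteq> H" "pairwise orthogonal B" "\<And>x. x \<in> B \<Longrightarrow> norm x = 1" "independent B" "card B = dim H" "span B = H"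
    using orthonormal_basis_subspace[OF H] by blast
  have "finite B" using B(4) by (rule independent_imp_finite)
  moreover have "card B = m" using B(5) dim_hyperplane[OF assms] by (simp add: H_def m_def)
  ultimately obtain b where b: "bij_betw b {..<m} B" using ex_bij_betw_nat_finite[of B] by (auto simp: atLeast0LessThan)
  have orth: "b i \<bullet> b j = (if i = j then 1 else 0)" if "i < m" "j < m" for i j
  proof (cases "i = j")
    case True
    have "b i \<in> B" using b that by (auto simp: bij_betw_def)
    then show ?thesis using B(3) True by (simp add: norm_eq_1)
  next
    case False
    then have "b i \<noteq> b j" using b that by (auto simp: bij_betw_def inj_on_def)
    moreover have "b i \<in> B" "b j \<in> B" using b that by (auto simp: bij_betw_def)
    ultimately show ?thesis using B(2) False by (auto simp: pairwise_def orthogonal_def)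
  qed
  define f where "f x = (\<lambda>i. if i < m then x \<bullet> b i else 0)" for x
  define g where "g z = (\<Sum>i<m. z i *\<^sub>R b i)" for z :: "nat \<Rightarrow> real"
  have g_in: "g z \<in> H" for z unfolding g_def
    using b B(1) by (intro subspace_sum[OF H] subspace_scale[OF H]) (auto simp: bij_betw_def)
  have fg: "f (g z) = z" if "\<forall>i\<ge>m. z i = 0" for z
  proof
    fix i show "f (g z) i = z i"
      using that by (auto simp: f_def g_def inner_sum_left orth if_distrib cong: if_cong)
  qed
  have gf: "g (f x) = x" if "x \<in> H" for x
  proof -
    have "x - g (f x) \<in> H" using that g_in by (intro subspace_diff[OF H])
    moreover have "orthogonal (x - g (f x)) y" if yB: "y \<in> B" for y
    proof -
      obtain i where "i < m" "y = b i" using b yB by (auto simp: bij_betw_def)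
      then show ?thesis by (simp add: orthogonal_def inner_diff_left g_def f_def inner_sum_left orth if_distrib cong: if_cong)
    qed
    ultimately have "orthogonal (x - g (f x)) (x - g (f x))"
      using orthogonal_to_span[of "x - g (f x)" B "x - g (f x)"] B(6) by (auto simp: orthogonal_commute)
    then show ?thesis by (simp add: orthogonal_def)
  qed
  have "homeomorphic_maps (top_of_set H) (Euclidean_space m) f g"
    unfolding homeomorphic_maps_def Euclidean_space_def euclidean_product_topology
  proof (intro conjI ballI)
    have "continuous_on H f" 
    proof (rule continuous_on_coordinatewise_then_product)
      show "continuous_on H (\<lambda>x. f x i)" for i
        by (cases "i < m") (auto simp: f_def intro!: continuous_intros)
    qed
    then show "continuous_map (top_of_set H) (top_of_set {x. \<forall>i\<ge>m. x i = 0}) f"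
      by (auto simp: f_def)
    have "continuous_on {x. \<forall>i\<ge>m. x i = 0} g" unfolding g_def
      by (intro continuous_intros continuous_on_product_then_coordinatewise continuous_on_id)
    then show "continuous_map (top_of_set {x. \<forall>i\<ge>m. x i = 0}) (top_of_set H) g"
      using g_in by auto
  qed (use fg gf in auto)
  then show ?thesis unfolding homeomorphic_space_def H_def m_def by blast
qed

text \<open>If \<open>e\<close> is interior to the recession cone, the boundary is the graph of a Lipschitz function over
  the hyperplane orthogonal to \<open>e\<close>.\<close>

lemma frontier_homeomorphic_hyperplane:
  fixes W :: "(real^'n) set"
  assumes W: "closed W" "W \<noteq> {}" "W \<noteq> UNIV" and e: "e \<in> interior (recession_cone W)" "norm e = 1"
    and scale: "\<And>v l. v \<in> recession_cone W \<Longrightarrow> l \<ge> 0 \<Longrightarrow> l *\<^sub>R v \<in> recession_cone W"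
  shows "frontier W homeomorphic {x. e \<bullet> x = 0}"
proof -
  define H where "H = {x. e \<bullet> x = 0}"
  have ee: "e \<bullet> e = 1" using e(2) by (simp add: norm_eq_1)
  obtain d where d: "d > 0" "ball e d \<subseteq> recession_cone W" using e(1) by (auto simp: mem_interior)
  \<comment> \<open>A ball of radius \<open>d\<close> around \<open>e\<close> in the recession cone
    means that above each point of \<open>W\<close> there is a whole circular cone in
    \<open>W\<close>. Two boundary points can therefore not differ too steeply.\<close>
  have up: "y + w + t *\<^sub>R e \<in> W" if "y \<in> W" "norm w < t * d" for y w t
  proof -
    have "0 < t * d" using that(2) norm_ge_zero[of w] by linarith
    then have t: "t > 0" using d(1) by (simp add: zero_less_mult_iff)
    have "e + w /\<^sub>R t \<in> ball e d" using that(2) t by (simp add: dist_norm field_simps)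
    then have "t *\<^sub>R (e + w /\<^sub>R t) \<in> recession_cone W" using d(2) t by (intro scale) auto
    from recession_coneD[OF this that(1)] t show ?thesis by (simp add: scaleR_add_right algebra_simps)
  qed
  have up_int: "y + w + t *\<^sub>R e \<in> interior W" if "y \<in> W" "norm w < t * d" for y w t
  proof (rule interiorI)
    show "open ((\<lambda>w. y + w + t *\<^sub>R e) ` ball 0 (t * d))"
    proof -
      have "(\<lambda>w. y + w + t *\<^sub>R e) = (+) (y + t *\<^sub>R e)" by (auto simp: algebra_simps)
      then show ?thesis by (metis open_translation open_ball)
    qed
    show "y + w + t *\<^sub>R e \<in> (\<lambda>w. y + w + t *\<^sub>R e) ` ball 0 (t * d)" using that(2) by auto
    show "(\<lambda>w. y + w + t *\<^sub>R e) ` ball 0 (t * d) \<subseteq> W" using up[OF that(1)] by auto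
  qed
  define \<phi> where "\<phi> y = y - (e \<bullet> y) *\<^sub>R e" for y
  have \<phi>H: "\<phi> y \<in> H" for y by (simp add: \<phi>_def H_def inner_diff_right ee)
  have frW: "y \<in> W" "y \<notin> interior W" if "y \<in> frontier W" for y
    using that W(1) by (auto simp: frontier_def)
  have lip1: "e \<bullet> (y' - y) * d \<le> norm (\<phi> y' - \<phi> y)" if y: "y \<in> frontier W" "y' \<in> frontier W" for y y'
  proof (rule ccontr)
    assume "\<not> ?thesis"
    then have "y + (\<phi> y' - \<phi> y) + (e \<bullet> (y' - y)) *\<^sub>R e \<in> interior W"
      by (intro up_int frW y) simp
    moreover have "y + (\<phi> y' - \<phi> y) + (e \<bullet> (y' - y)) *\<^sub>R e = y'"
      by (simp add: \<phi>_def inner_diff_right algebra_simps)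
    ultimately show False using frW(2)[OF y(2)] by simp
  qed
  have lip: "dist y y' \<le> (1 + 1 / d) * dist (\<phi> y) (\<phi> y')" if y: "y \<in> frontier W" "y' \<in> frontier W" for y y'
  proof -
    have "\<bar>e \<bullet> (y' - y)\<bar> * d \<le> norm (\<phi> y' - \<phi> y)"
      using lip1[OF y] lip1[OF y(2,1)] by (auto simp: abs_if norm_minus_commute inner_diff_right)
    then have "\<bar>e \<bullet> (y' - y)\<bar> \<le> norm (\<phi> y' - \<phi> y) / d" using d(1) by (simp add: field_simps)
    moreover have "y' - y = (\<phi> y' - \<phi> y) + (e \<bullet> (y' - y)) *\<^sub>R e" by (simp add: \<phi>_def inner_diff_right algebra_simps)
    then have "norm (y' - y) \<le> norm (\<phi> y' - \<phi> y) + norm ((e \<bullet> (y' - y)) *\<^sub>R e)" by (metis norm_triangle_ineq)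
    then have "norm (y' - y) \<le> norm (\<phi> y' - \<phi> y) + \<bar>e \<bullet> (y' - y)\<bar>" using e(2) by simp
    ultimately show ?thesis by (simp add: dist_norm norm_minus_commute algebra_simps)
  qed
  have inj: "inj_on \<phi> (frontier W)" using lip by (fastforce simp: inj_on_def)
  have surj: "\<phi> ` frontier W = H"
  proof (intro equalityI subsetI)
    fix x assume x: "x \<in> H"
    \<comment> \<open>The heights at which the line over \<open>x\<close> is in \<open>W\<close>;
      they are bounded below because a point outside \<open>W\<close> would otherwise be covered by
      a cone. The least height is the boundary point.\<close>
    define S where "S = {t. x + t *\<^sub>R e \<in> W}"
    obtain y0 where y0: "y0 \<in> W" using W(2) by blast
    have "y0 + (x - y0) + ((norm (x - y0) + 1) / d) *\<^sub>R e \<in> W"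
      by (rule up[OF y0]) (use d(1) in simp)
    then have ne: "S \<noteq> {}" by (auto simp: S_def)
    obtain z where z: "z \<notin> W" using W(3) by blast
    have lb: "- (norm (z - x) + 1) / d \<le> t" if t: "t \<in> S" for t
    proof (rule ccontr)
      assume "\<not> ?thesis"
      then have "norm (z - x) + 1 < (- t) * d" using d(1) by (simp add: field_simps)
      then have "(x + t *\<^sub>R e) + (z - x) + (- t) *\<^sub>R e \<in> W" using t by (intro up) (auto simp: S_def)
      then show False using z by simp
    qed
    have bdd: "bdd_below S" using lb by (rule bdd_belowI)
    have "closed ((\<lambda>t. x + t *\<^sub>R e) -` W)" by (intro continuous_closed_vimage W(1) continuous_intros)
    then have "closed S" by (simp add: S_def vimage_def)
    then have inS: "Inf S \<in> S" using closed_contains_Inf[OF ne bdd] by blast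
    define y where "y = x + Inf S *\<^sub>R e"
    have yW: "y \<in> W" using inS by (simp add: S_def y_def)
    have "y \<notin> interior W"
    proof
      assume "y \<in> interior W"
      then obtain r where r: "r > 0" "cball y r \<subseteq> W" by (auto simp: mem_interior_cball)
      have "y - r *\<^sub>R e \<in> W" using r(1) e(2) by (intro subsetD[OF r(2)]) (simp add: dist_norm)
      then have "Inf S - r \<in> S" by (simp add: S_def y_def algebra_simps)
      from cInf_lower[OF this bdd] r(1) show False by simp
    qed
    then have "y \<in> frontier W" using yW W(1) by (simp add: frontier_def)
    moreover have "\<phi> y = x" using x by (simp add: \<phi>_def y_def H_def inner_add_right ee)
    ultimately show "x \<in> \<phi> ` frontier W" by blast
  qed (use \<phi>H in auto)
  have "homeomorphism (frontier W) H \<phi> (inv_into (frontier W) \<phi>)"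
    unfolding homeomorphism_def
  proof (intro conjI ballI)
    show "continuous_on (frontier W) \<phi>" unfolding \<phi>_def by (intro continuous_intros)
    have "(1 + 1 / d)-lipschitz_on H (inv_into (frontier W) \<phi>)"
    proof (rule lipschitz_onI)
      fix x x' assume x: "x \<in> H" "x' \<in> H"
      then have "x \<in> \<phi> ` frontier W" "x' \<in> \<phi> ` frontier W" using surj by auto
      then show "dist (inv_into (frontier W) \<phi> x) (inv_into (frontier W) \<phi> x') \<le> (1 + 1 / d) * dist x x'"
        using lip[of "inv_into (frontier W) \<phi> x" "inv_into (frontier W) \<phi> x'"]
        by (simp add: inv_into_into f_inv_into_f)
    qed (use d(1) in simp)
    then show "continuous_on H (inv_into (frontier W) \<phi>)" by (rule lipschitz_on_continuous_on)
    show "inv_into (frontier W) \<phi> ` H = frontier W" using surj inj by (metis inv_into_image_cancel subset_refl)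
  qed (use surj inj in \<open>auto simp: f_inv_into_f\<close>)
  then show ?thesis unfolding homeomorphic_def H_def by blast
qed

text \<open>Brouwer's theorem, applied to the map sending \<open>x\<close> to the point of the disc closest to a far away
  point opposite to the retraction of \<open>x\<close>.\<close>

lemma frontier_retract_of_disc_contradiction:
  fixes K :: "(real^'n) set"
  assumes K: "convex K" "closed K" and P: "subspace P" and bd: "bounded (K \<inter> P)"
    and x0: "x0 \<in> interior K" "x0 \<in> P" and ret: "(frontier K \<inter> P) retract_of (K \<inter> P)"
  shows False
proof -
  define B where "B = K \<inter> P"
  have B: "closed B" "convex B" "compact B" "x0 \<in> B"
    unfolding B_def using K P bd closed_subspace[OF P] subspace_imp_convex[OF P] x0 interior_subset
    by (auto intro: convex_Int simp: compact_eq_bounded_closed)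
  have Bne: "B \<noteq> {}" using B(4) by blast
  obtain r where r: "continuous_on B r" "r ` B \<subseteq> frontier K \<inter> P" "\<And>x. x \<in> frontier K \<inter> P \<Longrightarrow> r x = x"
    using ret unfolding retract_of_def retraction_def B_def by (auto simp: image_subset_iff_funcset)
  obtain d where d: "d > 0" "ball x0 d \<subseteq> interior K" using x0(1) by (meson open_contains_ball open_interior)
  have far: "d \<le> norm (s - x0)" if "s \<in> frontier K" for s
  proof (rule ccontr)
    assume "\<not> ?thesis"
    then have "s \<in> ball x0 d" by (simp add: dist_norm norm_minus_commute)
    then show False using that d(2) by (auto simp: frontier_def)
  qed
  obtain M where M: "\<And>x. x \<in> B \<Longrightarrow> norm (x - x0) \<le> M"
    using bd unfolding B_def by (metis bounded_any_center dist_norm norm_minus_commute)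
  \<comment> \<open>Boundary points are at least \<open>d\<close> away from \<open>x0\<close>, so
    the opposite point \<open>z x\<close> has distance at least \<open>N * d = M + 1\<close> from
    \<open>x0\<close> and lies outside \<open>B\<close>.\<close>
  define N where "N = (M + 1) / d"
  have "M \<ge> 0" using M[OF B(4)] by simp
  then have N: "N > 0" using d(1) by (simp add: N_def)
  define z where "z x = x0 - N *\<^sub>R (r x - x0)" for x
  define f where "f x = closest_point B (z x)" for x
  have zP: "z x \<in> P" if "x \<in> B" for x
    using r(2) that x0(2) unfolding z_def by (intro subspace_diff[OF P] subspace_scale[OF P]) auto
  have zB: "z x \<notin> B" if "x \<in> B" for x
  proof
    assume "z x \<in> B"
    then have "norm (z x - x0) \<le> M" by (rule M)
    moreover have "norm (z x - x0) = N * norm (r x - x0)" using N by (simp add: z_def)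
    moreover have "N * norm (r x - x0) \<ge> N * d" using far[of "r x"] r(2) that N by (intro mult_left_mono) auto
    moreover have "N * d = M + 1" using d(1) by (simp add: N_def)
    ultimately show False by simp
  qed
  have "continuous_on B z" unfolding z_def by (intro continuous_intros r(1))
  then have "continuous_on B f" unfolding f_def
    by (intro continuous_on_compose2[OF continuous_on_closest_point[OF B(2,1) Bne, of UNIV]]) auto
  moreover have "f \<in> B \<rightarrow> B" unfolding f_def using closest_point_in_set[OF B(1) Bne] by auto
  ultimately obtain x where x: "x \<in> B" "f x = x" using brouwer[OF B(3,2) Bne, of f] by blast
  have dot: "(z x - x) \<bullet> (y - x) \<le> 0" if "y \<in> B" for y
    using closest_point_dot[OF B(2,1) that, of "z x"] x(2) by (simp add: f_def)
  have "x \<in> frontier K"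
  proof (rule ccontr)
    assume "x \<notin> frontier K"
    then have "x \<in> interior K" using x(1) K(2) by (auto simp: B_def frontier_def)
    then obtain \<eta> where \<eta>: "\<eta> > 0" "cball x \<eta> \<subseteq> K" by (auto simp: mem_interior_cball)
    have nz: "z x - x \<noteq> 0" using zB[OF x(1)] x(1) by auto
    define y where "y = x + (\<eta> / norm (z x - x)) *\<^sub>R (z x - x)"
    have "y \<in> K" using \<eta>(1) nz by (intro subsetD[OF \<eta>(2)]) (simp add: y_def dist_norm)
    moreover have "y \<in> P" unfolding y_def using zP[OF x(1)] x(1)
      by (intro subspace_add[OF P] subspace_scale[OF P] subspace_diff[OF P]) (auto simp: B_def)
    ultimately have "(\<eta> / norm (z x - x)) * ((z x - x) \<bullet> (z x - x)) \<le> 0" using dot[of y] by (simp add: B_def y_def)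
    moreover have "(\<eta> / norm (z x - x)) * ((z x - x) \<bullet> (z x - x)) > 0" using \<eta>(1) nz by (intro mult_pos_pos) simp_all
    ultimately show False by simp
  qed
  then have rx: "r x = x" using r(3) x(1) by (simp add: B_def)
  \<comment> \<open>A fixed point is a boundary point fixed by \<open>r\<close>, so
    \<open>z x\<close> lies on the far side of \<open>x0\<close> from \<open>x\<close>. Moving from
    \<open>x\<close> towards \<open>x0\<close> would come closer to it, which forces
    \<open>x = x0\<close>.\<close>
  have "z x - x = (N + 1) *\<^sub>R (x0 - x)" by (simp add: z_def rx algebra_simps)
  then have "(N + 1) * ((x0 - x) \<bullet> (x0 - x)) \<le> 0" using dot[OF B(4)] by simp
  then have "(x0 - x) \<bullet> (x0 - x) \<le> 0" using N by (simp add: mult_le_0_iff)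
  then have "x = x0" using inner_gt_zero_iff[of "x0 - x"] by fastforce
  then show False using far[OF \<open>x \<in> frontier K\<close>] d(1) by simp
qed

lemma Kn_convex_body: "K \<in> Kn \<Longrightarrow> closed K \<and> convex K \<and> interior K \<noteq> {} \<and> \<not> bounded K"
  by (simp add: Kn_def convex_body_def)

lemma Kn_frontier_contractible:
  fixes K :: "(real^'n) set"
  assumes "K \<in> Kn" shows "contractible (frontier K)" "frontier K \<noteq> {}"
proof -
  have h: "top_of_set (frontier K) homeomorphic_space Euclidean_space (CARD('n) - 1)"
    using assms by (simp add: Kn_def)
  show "contractible (frontier K)"
    using homeomorphic_space_contractibility[OF h] by (simp add: contractible_space_top_of_set)
  show "frontier K \<noteq> {}"
    using homeomorphic_empty_space[OF h] nontrivial_Euclidean_space by force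
qed

text \<open>Otherwise \<open>K\<close> is the product of a compact convex body with a subspace, so its boundary retracts
  onto a sphere, which is not contractible.\<close>

lemma Kn_recession_cone_not_subspace:
  fixes K :: "(real^'n) set"
  assumes K: "K \<in> Kn" shows "\<exists>y\<in>recession_cone K. - y \<notin> recession_cone K"
proof (rule ccontr)
  assume "\<not> ?thesis"
  then have neg: "- y \<in> recession_cone K" if "y \<in> recession_cone K" for y using that by blast
  have cl: "closed K" and cv: "convex K" and int: "interior K \<noteq> {}" and unb: "\<not> bounded K"
    using Kn_convex_body[OF K] by auto
  define L where "L = recession_cone K"
  have L: "subspace L"
  proof (rule subspaceI)
    show "c *\<^sub>R x \<in> L" if "x \<in> L" for c x
    proof (cases "c \<ge> 0")
      case True then show ?thesis using that recession_cone_scale[OF cl cv] by (simp add: L_def)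
    next
      case False
      then have "(- c) *\<^sub>R (- x) \<in> L" unfolding L_def using that neg by (intro recession_cone_scale[OF cl cv]) (auto simp: L_def)
      then show ?thesis by simp
    qed
  qed (auto simp: L_def recession_cone_zero recession_cone_add)
  obtain Bs where Bs: "Bs \<subseteq> L" "pairwise orthogonal Bs" "\<And>x. x \<in> Bs \<Longrightarrow> norm x = 1" "independent Bs" "card Bs = dim L" "span Bs = L"
    using orthonormal_basis_subspace[OF L] by blast
  have fin: "finite Bs" using Bs(4) by (rule independent_imp_finite)
  define P where "P = {x. \<forall>y\<in>L. x \<bullet> y = 0}"
  have P: "subspace P" unfolding P_def by (auto simp: subspace_def inner_add_left)
  \<comment> \<open>Orthogonal projection along \<open>L\<close> onto its complement. As
    \<open>K\<close> is invariant under translations by \<open>L\<close>, it preserves interior and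
    frontier.\<close>
  define \<pi> where "\<pi> x = x - (\<Sum>b\<in>Bs. (x \<bullet> b) *\<^sub>R b)" for x
  have \<pi>L: "x - \<pi> x \<in> L" for x
    unfolding \<pi>_def using Bs(1) by (auto intro!: subspace_sum[OF L] subspace_scale[OF L])
  have orthB: "orthogonal (\<pi> x) b" if b: "b \<in> Bs" for x b
  proof -
    have "(\<Sum>a\<in>Bs. (x \<bullet> a) * (a \<bullet> b)) = (\<Sum>a\<in>Bs. if a = b then x \<bullet> b else 0)"
      using Bs(2,3) b by (intro sum.cong) (auto simp: pairwise_def orthogonal_def norm_eq_1)
    also have "\<dots> = x \<bullet> b" using fin b by simp
    finally show ?thesis by (simp add: orthogonal_def \<pi>_def inner_diff_left inner_sum_left)
  qed
  have \<pi>P: "\<pi> x \<in> P" for x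
    using orthogonal_to_span[OF _ orthB] Bs(6) by (auto simp: P_def orthogonal_def)
  have \<pi>id: "\<pi> x = x" if "x \<in> P" for x
    using that Bs(1) unfolding \<pi>_def P_def by (subst sum.neutral) auto
  have shift: "(+) l ` K = K" if l: "l \<in> L" for l
  proof
    show "(+) l ` K \<subseteq> K" using recession_coneD[of l K] l by (auto simp: L_def add.commute[of l])
    have "x = l + (x + (- l))" for x by simp
    moreover have "x + (- l) \<in> K" if "x \<in> K" for x using recession_coneD[OF neg that] l by (simp add: L_def)
    ultimately show "K \<subseteq> (+) l ` K" by blast
  qed
  have fr: "x - l \<in> frontier K" if "x \<in> frontier K" "l \<in> L" for x l
  proof -
    have "- l \<in> L" using that(2) subspace_neg[OF L] by blast
    then have "frontier K = (+) (- l) ` frontier K" using shift[of "- l"] frontier_translation[of "- l" K] by simp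
    then show ?thesis using that(1) by (metis image_eqI add.commute uminus_add_conv_diff)
  qed
  have intr: "x - l \<in> interior K" if "x \<in> interior K" "l \<in> L" for x l
  proof -
    have "- l \<in> L" using that(2) subspace_neg[OF L] by blast
    then have "interior K = (+) (- l) ` interior K" using shift[of "- l"] interior_translation[of "- l" K] by simp
    then show ?thesis using that(1) by (metis image_eqI add.commute uminus_add_conv_diff)
  qed
  have \<pi>fr: "\<pi> x \<in> frontier K" if "x \<in> frontier K" for x
    using fr[OF that \<pi>L[of x]] by simp
  define S where "S = frontier K \<inter> P"
  have "retraction (frontier K) S \<pi>"
    unfolding retraction_def S_def
  proof (intro conjI ballI)
    show "continuous_on (frontier K) \<pi>" unfolding \<pi>_def by (intro continuous_intros)
  qed (use \<pi>fr \<pi>P \<pi>id in auto)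
  then have ret: "S retract_of frontier K" unfolding retract_of_def by blast
  have contr: "contractible S" using retract_of_contractible[OF Kn_frontier_contractible(1)[OF K] ret] .
  have Sne: "S \<noteq> {}" using Kn_frontier_contractible(2)[OF K] \<pi>fr \<pi>P by (auto simp: S_def)
  obtain x1 where "x1 \<in> interior K" using int by blast
  then have x0: "\<pi> x1 \<in> interior K" "\<pi> x1 \<in> P" using intr[OF _ \<pi>L[of x1], of x1] \<pi>P by simp_all
  have bd: "bounded (K \<inter> P)"
  proof (rule ccontr)
    assume unb: "\<not> bounded (K \<inter> P)"
    have clB: "closed (K \<inter> P)" "convex (K \<inter> P)"
      using cl cv closed_subspace[OF P] subspace_imp_convex[OF P] by (auto intro: convex_Int)
    obtain v where v: "v \<in> recession_cone (K \<inter> P)" "norm v = 1" using unbounded_recession_cone[OF clB unb] by blast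
    have xB: "\<pi> x1 \<in> K \<inter> P" using x0 interior_subset by blast
    have "\<pi> x1 + v \<in> P" using recession_coneD[OF v(1) xB] by blast
    then have "v \<in> P" using subspace_diff[OF P _ x0(2), of "\<pi> x1 + v"] by simp
    moreover have "v \<in> L" unfolding L_def
      using recession_cone_iff[OF clB xB] recession_cone_iff[OF cl cv, of "\<pi> x1"] v(1) xB by blast
    ultimately have "v \<bullet> v = 0" by (auto simp: P_def)
    then show False using v(2) by simp
  qed
  have "rel_frontier (K \<inter> P) = frontier K \<inter> P"
    using convex_affine_rel_frontier_Int[OF cv subspace_imp_affine[OF P]] x0 by blast
  then have SB: "S = rel_frontier (K \<inter> P)" by (simp add: S_def)
  \<comment> \<open>A nonempty contractible ANR is an AR and hence a retract of every set containing
    it as a closed subset, here of the disc it bounds.\<close>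
  have "ANR S" unfolding SB
    by (rule ANR_rel_frontier_convex[OF bd]) (use cv subspace_imp_convex[OF P] in \<open>auto intro: convex_Int\<close>)
  then have "AR S" using contr Sne by (simp add: AR_ANR)
  moreover have "closedin (top_of_set (K \<inter> P)) S"
    unfolding S_def using cl by (intro closed_subset closed_Int frontier_closed closed_subspace[OF P]) (auto simp: frontier_def)
  ultimately have "S retract_of (K \<inter> P)" using AR_imp_retract by blast
  then show False
    using frontier_retract_of_disc_contradiction[OF cv cl P bd x0] by (simp add: S_def)
qed

section \<open>Bodies with a common boundary\<close>

text \<open>The connected interior of \<open>K\<close> misses the common frontier, so it lies
  entirely inside or entirely outside \<open>J\<close>.\<close>

lemma frontier_eq_interior_subset:
  fixes K :: "(real^'n) set"
  assumes K: "convex K" and fr: "frontier K = frontier J" and meet: "interior K \<inter> interior J \<noteq> {}"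
  shows "interior K \<subseteq> interior J"
proof -
  have "connected (interior K)" using K by (intro convex_connected convex_interior)
  moreover have "interior K \<inter> frontier J = {}" unfolding fr[symmetric] by (auto simp: frontier_def)
  then have cover: "interior K \<subseteq> interior J \<union> (- closure J)" by (auto simp: frontier_def)
  moreover have "interior J \<inter> (- closure J) \<inter> interior K = {}"
    using interior_subset[of J] closure_subset[of J] by blast
  ultimately have "interior J \<inter> interior K = {} \<or> (- closure J) \<inter> interior K = {}"
    by (intro connectedD) auto
  then show ?thesis using meet cover by blast
qed

text \<open>If the interiors are disjoint, a separating hyperplane contains the common frontier, as
  this lies in both bodies. So the boundary map fails to be injective only at hyperplanes.\<close>

lemma frontier_eq_imp:
  fixes K J :: "(real^'n) set"
  assumes K: "closed K" "convex K" "interior K \<noteq> {}" and J: "closed J" "convex J" "interior J \<noteq> {}"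
    and fr: "frontier K = frontier J"
  shows "K = J \<or> (\<exists>u c. norm u = 1 \<and> K = {x. c \<le> u \<bullet> x} \<and> J = {x. - c \<le> (- u) \<bullet> x})"
proof (cases "interior K \<inter> interior J = {}")
  case False
  then have "interior K = interior J"
    using frontier_eq_interior_subset[OF K(2) fr] frontier_eq_interior_subset[OF J(2) fr[symmetric]] by blast
  then have "closure K = closure J"
    unfolding convex_closure_interior[OF K(2,3), symmetric] convex_closure_interior[OF J(2,3), symmetric] by (rule arg_cong)
  then show ?thesis using K(1) J(1) by (simp add: closure_closed)
next
  case True
  have cv: "convex (interior K)" "convex (interior J)" using K J by (auto intro: convex_interior)
  obtain a b where ab: "a \<noteq> 0" "\<forall>x\<in>interior J. a \<bullet> x \<le> b" "\<forall>x\<in>interior K. a \<bullet> x \<ge> b"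
    using separating_hyperplane_sets[OF cv(2,1) J(3) K(3)] True by blast
  define u where "u = a /\<^sub>R norm a"
  define c where "c = b / norm a"
  have u: "norm u = 1" using ab(1) by (simp add: u_def)
  \<comment> \<open>The open half-space is connected, meets \<open>S\<close> and misses its
    frontier, hence is contained in \<open>S\<close>.\<close>
  have half: "S = {x. v \<bullet> x \<ge> k}"
    if S: "closed S" "convex S" "interior S \<noteq> {}" and v: "norm v = 1" and le: "\<And>x. x \<in> interior S \<Longrightarrow> k \<le> v \<bullet> x"
     and frS: "\<And>x. x \<in> frontier S \<Longrightarrow> v \<bullet> x = k" for S :: "(real^'n) set" and v k
  proof
    have "S \<subseteq> closure (interior S)" using convex_closure_interior[OF S(2,3)] closure_subset by blast
    also have "\<dots> \<subseteq> {x. v \<bullet> x \<ge> k}" using le by (intro closure_minimal closed_halfspace_ge) auto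
    finally show sub: "S \<subseteq> {x. v \<bullet> x \<ge> k}" .
    have isub: "interior S \<subseteq> {x. v \<bullet> x > k}"
      using interior_mono[OF sub] interior_halfspace_ge[of v k] v by fastforce
    have "connected {x. v \<bullet> x > k}" by (intro convex_connected convex_halfspace_gt)
    moreover have "{x. v \<bullet> x > k} \<inter> frontier S = {}" using frS by force
    moreover have "{x. v \<bullet> x > k} \<inter> S \<noteq> {}" using isub S(3) interior_subset by blast
    ultimately have "{x. v \<bullet> x > k} - S = {}" using connected_Int_frontier by blast
    then have "{x. v \<bullet> x > k} \<subseteq> S" by blast
    then have "closure {x. v \<bullet> x > k} \<subseteq> S" using S(1) by (simp add: closure_minimal)
    then show "{x. v \<bullet> x \<ge> k} \<subseteq> S" using closure_halfspace_gt[of v k] v by fastforce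
  qed
  have leK: "c \<le> u \<bullet> x" if "x \<in> interior K" for x
    using ab(1,3) that by (simp add: u_def c_def divide_inverse mult.commute mult_left_mono)
  have leJ: "u \<bullet> x \<le> c" if "x \<in> interior J" for x
    using ab(1,2) that by (simp add: u_def c_def divide_inverse mult.commute mult_left_mono)
  have clK: "c \<le> u \<bullet> x" if "x \<in> K" for x
  proof -
    have "closure (interior K) \<subseteq> {x. c \<le> u \<bullet> x}" using leK by (intro closure_minimal closed_halfspace_ge) auto
    then show ?thesis using that convex_closure_interior[OF K(2,3)] closure_subset by blast
  qed
  have clJ: "u \<bullet> x \<le> c" if "x \<in> J" for x
  proof -
    have "closure (interior J) \<subseteq> {x. u \<bullet> x \<le> c}" using leJ by (intro closure_minimal closed_halfspace_le) auto
    then show ?thesis using that convex_closure_interior[OF J(2,3)] closure_subset by blast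
  qed
  have frc: "u \<bullet> x = c" if "x \<in> frontier K" for x
  proof -
    have "x \<in> K" using that K(1) by (auto simp: frontier_def)
    moreover have "x \<in> J" using that J(1) unfolding fr by (auto simp: frontier_def)
    ultimately show ?thesis using clK clJ by force
  qed
  have "K = {x. c \<le> u \<bullet> x}" using half[OF K u leK frc] by simp
  moreover have "J = {x. - c \<le> (- u) \<bullet> x}"
  proof (rule half[OF J])
    show "norm (- u) = 1" using u by simp
    show "- c \<le> (- u) \<bullet> x" if "x \<in> interior J" for x using leJ[OF that] by simp
    show "(- u) \<bullet> x = - c" if "x \<in> frontier J" for x using frc[unfolded fr, OF that] by simp
  qed
  ultimately show ?thesis using u by blast
qed

section \<open>The deformation\<close>

lemma mem_translation: "x \<in> (+) b ` S \<longleftrightarrow> x - b \<in> (S :: 'a::ab_group_add set)"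
  by (auto intro!: image_eqI[of x _ "x - b"])

lemma convex_cone_recession_cone:
  "closed K \<Longrightarrow> convex K \<Longrightarrow> convex_cone (recession_cone K)"
  by (simp add: convex_cone_iff recession_cone_zero recession_cone_add recession_cone_scale)

lemma unbounded_of_recession:
  assumes "closed K" "convex K" "x \<in> K" "v \<in> recession_cone K" "v \<noteq> (0 :: real^'n)"
  shows "\<not> bounded K"
proof
  assume "bounded K"
  then obtain M where M: "\<And>y. y \<in> K \<Longrightarrow> norm y \<le> M" by (auto simp: bounded_iff)
  define l where "l = (M + norm x + 1) / norm v"
  have "M \<ge> 0" using M[OF assms(3)] norm_ge_zero order_trans by blast
  then have l: "l \<ge> 0" by (simp add: l_def)
  have "x + l *\<^sub>R v \<in> K" using recession_cone_iff[OF assms(1-3)] assms(4) l by blast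
  then have "norm (x + l *\<^sub>R v) \<le> M" by (rule M)
  moreover have "norm (l *\<^sub>R v) = M + norm x + 1" using assms(5) \<open>M \<ge> 0\<close> by (simp add: l_def)
  ultimately show False using norm_triangle_ineq4[of "x + l *\<^sub>R v" x] by simp
qed

lemma unbounded_recession_cone_Kn:
  fixes K :: "(real^'n) set"
  assumes "K \<in> Kn" shows "\<not> bounded (recession_cone K)"
proof -
  have K: "closed K" "convex K" using Kn_convex_body[OF assms] by auto
  obtain y where y: "y \<in> recession_cone K" "- y \<notin> recession_cone K"
    using Kn_recession_cone_not_subspace[OF assms] by blast
  then have "y \<noteq> 0" using recession_cone_zero[of K] by auto
  moreover have "y \<in> recession_cone (recession_cone K)"
    using y(1) recession_cone_add[of _ K y] by (auto simp: recession_cone_def[of "recession_cone K"])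
  ultimately show ?thesis
    using unbounded_of_recession[OF closed_recession_cone convex_recession_cone recession_cone_zero] K by blast
qed

lemma Kn_neq_UNIV: "K \<in> Kn \<Longrightarrow> K \<noteq> UNIV"
  using Kn_frontier_contractible(2)[of K] by auto

lemma KnI:
  fixes W :: "(real^'n) set"
  assumes W: "closed W" "convex W" "interior W \<noteq> {}" "W \<noteq> UNIV"
    and e: "e \<in> interior (recession_cone W)" "norm e = 1"
  shows "W \<in> Kn"
proof -
  have ne: "W \<noteq> {}" using W(3) by auto
  then obtain x where x: "x \<in> W" by blast
  have e0: "e \<noteq> 0" "e \<in> recession_cone W" using e interior_subset by auto
  have "frontier W homeomorphic {x. e \<bullet> x = 0}"
    by (rule frontier_homeomorphic_hyperplane[OF W(1) ne W(4) e]) (rule recession_cone_scale[OF W(1,2)])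
  then obtain f g where fg: "homeomorphism (frontier W) {x. e \<bullet> x = 0} f g" by (auto simp: homeomorphic_def)
  then have "homeomorphic_maps (top_of_set (frontier W)) (top_of_set {x. e \<bullet> x = 0}) f g"
    by (auto simp: homeomorphic_maps_def homeomorphism_def)
  then have "top_of_set (frontier W) homeomorphic_space top_of_set {x. e \<bullet> x = 0}"
    by (auto simp: homeomorphic_space_def)
  then have "top_of_set (frontier W) homeomorphic_space Euclidean_space (CARD('n) - 1)"
    using homeomorphic_space_hyperplane_Euclidean_space[OF e0(1)] by (rule homeomorphic_space_trans)
  then show ?thesis
    using W unbounded_of_recession[OF W(1,2) x e0(2,1)] by (simp add: Kn_def convex_body_def)
qed

lemma halfspace_in_Kn:
  fixes e :: "real^'n"
  assumes "norm e = 1" shows "{x. c \<le> e \<bullet> x} \<in> Kn"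
proof (rule KnI)
  have ee: "e \<bullet> e = 1" and e0: "e \<noteq> 0" using assms by (auto simp: norm_eq_1)
  show "closed {x. c \<le> e \<bullet> x}" "convex {x. c \<le> e \<bullet> x}" by (rule closed_halfspace_ge, rule convex_halfspace_ge)
  have "(c + 1) *\<^sub>R e \<in> interior {x. c \<le> e \<bullet> x}" using e0 ee by simp
  then show "interior {x. c \<le> e \<bullet> x} \<noteq> {}" by blast
  have "(c - 1) *\<^sub>R e \<notin> {x. c \<le> e \<bullet> x}" using ee by simp
  then show "{x. c \<le> e \<bullet> x} \<noteq> UNIV" by blast
  show "e \<in> interior (recession_cone {x. c \<le> e \<bullet> x})"
    unfolding recession_cone_halfspace using e0 ee by simp
qed (rule assms)

lemma Hn_eq: "Hn = {{x. 0 \<le> u \<bullet> x} | u :: real^'n. norm u = 1}"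
proof (intro equalityI subsetI)
  fix H :: "(real^'n) set" assume "H \<in> Hn"
  then obtain u where u: "u \<noteq> 0" "H = {x. u \<bullet> x \<le> 0}" by (auto simp: Hn_def)
  have "H = {x. 0 \<le> (- u /\<^sub>R norm u) \<bullet> x}" using u by (auto simp: mult_le_0_iff zero_le_mult_iff)
  moreover have "norm (- u /\<^sub>R norm u) = 1" using u by simp
  ultimately show "H \<in> {{x. 0 \<le> u \<bullet> x} | u :: real^'n. norm u = 1}" by blast
next
  fix H :: "(real^'n) set" assume "H \<in> {{x. 0 \<le> u \<bullet> x} | u :: real^'n. norm u = 1}"
  then obtain u where u: "norm u = 1" "H = {x. 0 \<le> u \<bullet> x}" by blast
  have "H = {x. (- u) \<bullet> x \<le> 0}" "- u \<noteq> 0" using u by auto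
  then show "H \<in> Hn" unfolding Hn_def by blast
qed

text \<open>For a half-space with inner normal \<open>e\<close>, \<open>p - d *\<^sub>R e\<close> is
  the boundary point below the center, and its multiple moves the boundary linearly to the origin.
  The flow changes the depth \<open>d\<close> of the center into \<open>d / (1 + s * d)\<close> with
  \<open>s = t / (1 - t)\<close>, which is the coefficient of the second term. The shift is
  \<open>p\<close> at \<open>t = 0\<close> and 0 at \<open>t = 1\<close>.\<close>

definition flow_shift :: "real^'n \<Rightarrow> real^'n \<Rightarrow> real \<Rightarrow> real \<Rightarrow> real^'n" where
  "flow_shift e p d t = (1 - t) *\<^sub>R (p - d *\<^sub>R e) + ((1 - t) * d / (1 - t + t * d)) *\<^sub>R e"

abbreviation body_axis :: "(real^'n) set \<Rightarrow> real^'n" where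
  "body_axis K \<equiv> center_dir (recession_cone K)"

abbreviation centered :: "(real^'n) set \<Rightarrow> (real^'n) set" where
  "centered K \<equiv> (+) (- center_pt K) ` K"

text \<open>The shift is chosen such that \<open>{x. c \<le> u \<bullet> x}\<close> is moved to \<open>{x. (1 - t) * c \<le> u \<bullet> x}\<close>.
  This fixes the half-spaces in \<open>Hn\<close> and treats complementary half-spaces alike, as is needed for the
  hypersurfaces.\<close>

definition deform :: "(real^'n) set \<times> real \<Rightarrow> (real^'n) set" where
  "deform = (\<lambda>(K, t). (+) (flow_shift (body_axis K) (center_pt K) (depth K (center_pt K)) t) `
       proj_flow (body_axis K) t (centered K))"

lemma axial_body_centered:
  fixes K :: "(real^'n) set"
  assumes K: "closed K" "convex K" "interior K \<noteq> {}" and nl: "\<exists>y\<in>recession_cone K. - y \<notin> recession_cone K"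
  shows "axial_body (body_axis K) (centered K)"
proof -
  note C = closed_recession_cone[OF K(1)] convex_cone_recession_cone[OF K(1,2)]
  have "0 \<in> (+) (- center_pt K) ` interior K" unfolding mem_translation using center_pt_in_interior[OF K] by simp
  then have "0 \<in> interior (centered K)" unfolding interior_translation .
  moreover have "closed (centered K)" by (rule closed_translation[OF K(1)])
  moreover have "convex (centered K)" by (rule convex_translation[OF K(2)])
  ultimately show ?thesis
    unfolding axial_body_def recession_cone_translation using center_dir[OF C nl] by blast
qed

lemma axial_body_centered_Kn: "K \<in> Kn \<Longrightarrow> axial_body (body_axis K) (centered K)"
  by (rule axial_body_centered)
     (simp_all only: Kn_convex_body Kn_recession_cone_not_subspace not_False_eq_True)

lemma axial_body_proj_flow: "axial_body e X \<Longrightarrow> 0 \<le> t \<Longrightarrow> t < 1 \<Longrightarrow> axial_body e (proj_flow e t X)"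
  using axial_body_proj_image[of e X "t / (1 - t)"] by (simp add: proj_flow_def)

lemma depth_center_pt_pos: "K \<in> Kn \<Longrightarrow> 0 < depth K (center_pt K)"
  using depth_pos[of "center_pt K" K] center_pt_in_interior[of K] Kn_convex_body[of K] Kn_neq_UNIV[of K] by simp

lemma deform_0: "deform (K, 0) = K"
  by (simp add: deform_def flow_shift_def proj_flow_def image_image)

lemma deform_1: "deform (K, 1) = {x. 0 \<le> body_axis K \<bullet> x}"
  by (simp add: deform_def flow_shift_def proj_flow_def)

lemma deform_halfspace:
  fixes u :: "real^'n"
  assumes u: "norm u = 1" and t: "t \<in> {0..1}"
  shows "deform ({x. c \<le> u \<bullet> x}, t) = {x. (1 - t) * c \<le> u \<bullet> x}"
proof (cases "t = 1")
  case True
  then show ?thesis using center_dir_halfspace[OF u] by (simp add: deform_1 recession_cone_halfspace)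
next
  case False
  then have t: "0 \<le> t" "t < 1" using t by auto
  define K where "K = {x. c \<le> u \<bullet> x}"
  define s where "s = t / (1 - t)"
  have s: "s \<ge> 0" using t by (simp add: s_def)
  have K: "K \<in> Kn" unfolding K_def by (rule halfspace_in_Kn[OF u])
  have ax: "body_axis K = u" using center_dir_halfspace[OF u] by (simp add: K_def recession_cone_halfspace)
  define p where "p = center_pt K"
  have "p \<in> K" using center_pt_in_interior Kn_convex_body[OF K] interior_subset by (auto simp: p_def)
  then have d: "depth K p = u \<bullet> p - c" using depth_halfspace[OF u] by (simp add: K_def)
  define d where "d = depth K p"
  have d0: "d > 0" unfolding d_def p_def by (rule depth_center_pt_pos[OF K])
  have uu: "u \<bullet> u = 1" using u by (simp add: norm_eq_1)
  have X: "centered K = {y. - d \<le> u \<bullet> y}"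
  proof -
    have "y \<in> centered K \<longleftrightarrow> y + p \<in> K" for y
      unfolding mem_translation p_def by simp
    then have "centered K = {y. y + p \<in> K}" by blast
    moreover have "d = u \<bullet> p - c" using d by (simp add: d_def)
    then have "y + p \<in> K \<longleftrightarrow> - d \<le> u \<bullet> y" for y unfolding K_def by (simp add: inner_add_right) linarith
    ultimately show ?thesis by blast
  qed
  have pos: "1 + s * d > 0" using s d0 by (simp add: add_pos_nonneg)
  have flow: "proj_flow u t (centered K) = {y. - d / (1 + s * d) \<le> u \<bullet> y}"
  proof -
    have "y \<in> proj_flow u t (centered K) \<longleftrightarrow> - d / (1 + s * d) \<le> u \<bullet> y" for y
    proof -
      have 1: "1 + s * (u \<bullet> y) > 0" if "- d / (1 + s * d) \<le> u \<bullet> y"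
      proof -
        have "s * (- d / (1 + s * d)) \<le> s * (u \<bullet> y)" using that s by (rule mult_left_mono)
        moreover have "1 + s * (- d / (1 + s * d)) = 1 / (1 + s * d)" using pos by (simp add: field_simps)
        moreover have "1 / (1 + s * d) > 0" using pos by simp
        ultimately show ?thesis by linarith
      qed
      have "y \<in> proj_flow u t (centered K) \<longleftrightarrow> 1 + s * (u \<bullet> y) > 0 \<and> - d \<le> (u \<bullet> y) / (1 + s * (u \<bullet> y))"
        unfolding X using False by (simp add: proj_flow_def proj_image_def s_def inverse_eq_divide)
      also have "\<dots> \<longleftrightarrow> 1 + s * (u \<bullet> y) > 0 \<and> - d \<le> (1 + s * d) * (u \<bullet> y)"
        by (auto simp: pos_le_divide_eq algebra_simps)
      also have "\<dots> \<longleftrightarrow> 1 + s * (u \<bullet> y) > 0 \<and> - d / (1 + s * d) \<le> u \<bullet> y"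
        unfolding pos_divide_le_eq[OF pos] by (simp only: mult.commute)
      finally show ?thesis using 1 by blast
    qed
    then show ?thesis by blast
  qed
  define b where "b = flow_shift u p d t"
  have "(1 - t) * d / (1 - t + t * d) = d / (1 + s * d)"
    using t by (simp add: s_def field_simps)
  then have ub: "u \<bullet> b = (1 - t) * c + d / (1 + s * d)"
    unfolding b_def flow_shift_def using d by (simp add: inner_add_right inner_diff_right uu d_def)
  have "x \<in> deform (K, t) \<longleftrightarrow> x - b \<in> proj_flow u t (centered K)" for x
    by (simp only: deform_def prod.case mem_translation ax p_def d_def b_def)
  then show ?thesis unfolding K_def[symmetric] flow using ub by (auto simp: inner_diff_right)
qed

text \<open>For \<open>0 < t < 1\<close> the axis is interior to the recession cone of the image, so
  the boundary is a graph, whatever the boundary of \<open>K\<close> looks like.\<close>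

lemma deform_in_Kn:
  fixes K :: "(real^'n) set"
  assumes K: "K \<in> Kn" and t: "t \<in> {0..1}"
  shows "deform (K, t) \<in> Kn"
proof -
  note X = axial_body_centered_Kn[OF K]
  consider "t = 0" | "t = 1" | "0 < t" "t < 1" using t by fastforce
  then show ?thesis
  proof cases
    case 3
    define W where "W = proj_flow (body_axis K) t (centered K)"
    define b where "b = flow_shift (body_axis K) (center_pt K) (depth K (center_pt K)) t"
    have s: "t / (1 - t) > 0" using 3 by simp
    have W: "axial_body (body_axis K) W" unfolding W_def using axial_body_proj_flow[OF X] 3 by simp
    note W' = axial_bodyD[OF W]
    have eW: "body_axis K \<in> interior (recession_cone W)"
      using axis_in_interior_recession_cone[OF X s] 3 by (simp add: W_def proj_flow_def)
    have "- body_axis K \<notin> recession_cone W" using W'(8)[of "- body_axis K"] W'(7) by auto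
    then have "W \<noteq> UNIV" by (auto simp: recession_cone_def)
    have "(+) b ` W \<in> Kn"
    proof (rule KnI)
      show "closed ((+) b ` W)" "convex ((+) b ` W)" using W' by (auto simp: closed_translation convex_translation)
      show "interior ((+) b ` W) \<noteq> {}" unfolding interior_translation using W'(3) by blast
      show "(+) b ` W \<noteq> UNIV"
      proof
        assume "(+) b ` W = UNIV"
        then have "(+) (- b) ` (+) b ` W = (+) (- b) ` UNIV" by simp
        then show False using \<open>W \<noteq> UNIV\<close> by (simp add: image_image)
      qed
      show "body_axis K \<in> interior (recession_cone ((+) b ` W))" unfolding recession_cone_translation by (rule eW)
    qed (rule W')
    then show ?thesis by (simp add: deform_def W_def b_def)
  qed (use K axial_bodyD(5)[OF X] in \<open>simp_all add: deform_0 deform_1 halfspace_in_Kn\<close>)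
qed

lemma continuous_deform:
  "continuous_map (prod_topology asymptotic_topology (top_of_set {0..1})) asymptotic_topology
     (deform :: (real^'n) set \<times> real \<Rightarrow> _)"
proof (rule continuous_map_asymptotic_topology)
  fix K :: "nat \<Rightarrow> (real^'n) set" and L s and t :: real
  assume K: "\<And>j. K j \<in> Kn" and L: "L \<in> Kn" and KL: "limitin asymptotic_topology K L sequentially"
    and s: "\<And>j. s j \<in> {0..1}" "t \<in> {0..1}" "s \<longlonglongrightarrow> t"
  note K' = Kn_convex_body[OF K, THEN conjunct1] Kn_convex_body[OF K, THEN conjunct2, THEN conjunct1]
  have L': "closed L" "convex L" "interior L \<noteq> {}" "L \<noteq> {}" using Kn_convex_body[OF L] by auto
  have kc: "kconv K L" "kconv (\<lambda>j. recession_cone (K j)) (recession_cone L)"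
    using limitin_asymptotic_topology_iff[OF K L unbounded_recession_cone_Kn[OF L] closed_recession_cone[OF L'(1)]] KL
    by auto
  have e: "(\<lambda>j. body_axis (K j)) \<longlonglongrightarrow> body_axis L"
    using K' L' by (intro center_dir_tendsto kc closed_recession_cone convex_recession_cone
        convex_cone_recession_cone Kn_recession_cone_not_subspace L)
  have p: "(\<lambda>j. center_pt (K j)) \<longlonglongrightarrow> center_pt L"
    by (intro center_pt_tendsto kc K' L')
  have d: "(\<lambda>j. depth (K j) (center_pt (K j))) \<longlonglongrightarrow> depth L (center_pt L)"
    by (intro depth_tendsto kc K' L' p center_pt_in_interior Kn_neq_UNIV[OF L])
  have X: "kconv (\<lambda>j. centered (K j)) (centered L)"
    by (intro kconv_translation kc tendsto_minus p)
  have rX: "kconv (\<lambda>j. recession_cone (centered (K j))) (recession_cone (centered L))"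
    unfolding recession_cone_translation by (rule kc)
  note ax = axial_body_centered_Kn[OF K] axial_body_centered_Kn[OF L]
  have "1 - t + t * depth L (center_pt L) \<noteq> 0"
  proof (cases "t = 1")
    case False
    then have "1 - t > 0" "0 \<le> t * depth L (center_pt L)" using s(2) depth_center_pt_pos[OF L] by auto
    then show ?thesis by linarith
  qed (use depth_center_pt_pos[OF L] in simp)
  then have b: "(\<lambda>j. flow_shift (body_axis (K j)) (center_pt (K j)) (depth (K j) (center_pt (K j))) (s j))
     \<longlonglongrightarrow> flow_shift (body_axis L) (center_pt L) (depth L (center_pt L)) t"
    unfolding flow_shift_def by (intro tendsto_intros e p d s)
  have "kconv (\<lambda>j. deform (K j, s j)) (deform (L, t))"
    unfolding deform_def prod.case
    by (intro kconv_translation b kconv_proj_flow[OF X ax e s(3,1,2)])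
  moreover have "kconv (\<lambda>j. recession_cone (deform (K j, s j))) (recession_cone (deform (L, t)))"
    unfolding deform_def prod.case recession_cone_translation
    by (rule kconv_recession_cone_proj_flow[OF X ax e rX s(3,1,2)])
  moreover have D: "deform (L, t) \<in> Kn" "deform (K j, s j) \<in> Kn" for j
    by (intro deform_in_Kn K L s)+
  ultimately show "limitin asymptotic_topology (\<lambda>j. deform (K j, s j)) (deform (L, t)) sequentially"
    using limitin_asymptotic_topology_iff[of "\<lambda>j. deform (K j, s j)", OF D(2,1) unbounded_recession_cone_Kn[OF D(1)]
        closed_recession_cone] Kn_convex_body[OF D(1)] by blast
qed (rule deform_in_Kn)

lemma strong_deformation_retraction_deform:
  "strong_deformation_retraction asymptotic_topology Hn (deform :: (real^'n) set \<times> real \<Rightarrow> _)"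
  unfolding strong_deformation_retraction_def topspace_asymptotic_topology
proof (intro conjI ballI)
  show "(Hn :: (real^'n) set set) \<subseteq> Kn" using halfspace_in_Kn[of _ 0] by (auto simp: Hn_eq)
  fix K :: "(real^'n) set" assume K: "K \<in> Kn"
  show "deform (K, 0) = K" by (rule deform_0)
  show "deform (K, 1) \<in> Hn"
    unfolding deform_1 Hn_eq using axial_bodyD(5)[OF axial_body_centered_Kn[OF K]] by blast
next
  fix K :: "(real^'n) set" and t :: real assume "K \<in> Hn" "t \<in> {0..1}"
  then show "deform (K, t) = K" using deform_halfspace[of _ t 0] by (auto simp: Hn_eq)
qed (rule continuous_deform)

section \<open>Regularity along the deformation\<close>

text \<open>The denominators of the two maps at corresponding points are reciprocal.\<close>

lemma proj_map_inverse:
  assumes "1 + a \<bullet> (y - b) > 0"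
  shows "1 + (- a) \<bullet> (proj_map a b p y - p) > 0" "proj_map (- a) p b (proj_map a b p y) = y"
proof -
  define D where "D = 1 + a \<bullet> (y - b)"
  have D: "D > 0" using assms by (simp add: D_def)
  have x: "proj_map a b p y - p = (y - b) /\<^sub>R D" by (simp add: proj_map_def D_def)
  have "D * inverse D = 1" using D by simp
  then have 1: "1 + (- a) \<bullet> (proj_map a b p y - p) = inverse D"
    unfolding x by (simp add: D_def) algebra
  then show "1 + (- a) \<bullet> (proj_map a b p y - p) > 0" using D by simp
  show "proj_map (- a) p b (proj_map a b p y) = y"
    unfolding proj_map_def[of "- a"] unfolding 1 unfolding x using D by simp
qed

lemma continuous_on_proj_map: "continuous_on {y. 1 + a \<bullet> (y - b) > 0} (proj_map a b p)"
  by (intro continuous_at_imp_continuous_on ballI has_derivative_continuous[OF has_derivative_proj_map]) auto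

lemma interior_proj_map_vimage:
  fixes K :: "(real^'n) set"
  assumes "1 + a \<bullet> (y - b) > 0" and "proj_map a b p y \<in> interior K"
  shows "y \<in> interior {y. 1 + a \<bullet> (y - b) > 0 \<and> proj_map a b p y \<in> K}"
proof -
  have "open {y. 1 + a \<bullet> (y - b) > 0}" by (intro open_Collect_less continuous_intros)
  then have "open ({y. 1 + a \<bullet> (y - b) > 0} \<inter> proj_map a b p -` interior K)"
    by (intro continuous_open_preimage[OF continuous_on_proj_map] open_interior)
  then show ?thesis using assms interior_subset by (elim interiorI) auto
qed

text \<open>On its domain the map is inverted by a continuous map of the same kind, so interiors
  correspond. Closedness of \<open>?W\<close> rules out frontier points on the hyperplane bounding
  the domain.\<close>

lemma frontier_proj_map_vimage:
  fixes K :: "(real^'n) set"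
  assumes K: "closed K" and W: "closed {y. 1 + a \<bullet> (y - b) > 0 \<and> proj_map a b p y \<in> K}" (is "closed ?W")
  shows "frontier ?W = {y. 1 + a \<bullet> (y - b) > 0 \<and> proj_map a b p y \<in> frontier K}"
proof -
  have "proj_map a b p y \<in> interior K" if y: "y \<in> interior ?W" for y
  proof -
    have p: "1 + a \<bullet> (y - b) > 0" using y interior_subset by blast
    define x where "x = proj_map a b p y"
    have x: "1 + (- a) \<bullet> (x - p) > 0" "proj_map (- a) p b x = y"
      using proj_map_inverse[OF p] by (simp_all add: x_def)
    have "x \<in> interior {x. 1 + (- a) \<bullet> (x - p) > 0 \<and> proj_map (- a) p b x \<in> ?W}"
      by (rule interior_proj_map_vimage) (use x y in auto)
    also have "\<dots> \<subseteq> interior K"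
    proof (rule interior_mono, clarify)
      fix x assume "1 + (- a) \<bullet> (x - p) > 0" "proj_map a b p (proj_map (- a) p b x) \<in> K"
      then show "x \<in> K" using proj_map_inverse(2)[of "- a" x p b] by simp
    qed
    finally show ?thesis by (simp add: x_def)
  qed
  then show ?thesis
    using interior_proj_map_vimage[of a _ b p K] interior_subset[of K] K W
    by (auto simp: frontier_def)
qed

text \<open>Recentering, flow and shift combine into a single \<open>proj_map\<close> back to
  \<open>K\<close>, so that equations of the boundary can be pulled back.\<close>

lemma deform_eq_proj_map_vimage:
  assumes "t < 1"
  shows "deform (K, t) = {y. 1 + (t / (1 - t)) *\<^sub>R body_axis K \<bullet> (y - flow_shift (body_axis K) (center_pt K) (depth K (center_pt K)) t) > 0
     \<and> proj_map ((t / (1 - t)) *\<^sub>R body_axis K) (flow_shift (body_axis K) (center_pt K) (depth K (center_pt K)) t) (center_pt K) y \<in> K}"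
proof -
  define b where "b = flow_shift (body_axis K) (center_pt K) (depth K (center_pt K)) t"
  have c: "centered K = {y. center_pt K + y \<in> K}"
    unfolding mem_translation set_eq_iff by (simp add: add.commute)
  have "x \<in> deform (K, t) \<longleftrightarrow> x - b \<in> proj_flow (body_axis K) t {y. center_pt K + y \<in> K}" for x
    by (simp only: deform_def prod.case mem_translation b_def c)
  then show ?thesis
    unfolding b_def[symmetric] using assms by (auto simp: proj_flow_def proj_image_def proj_map_def)
qed

lemma regularity_preserving_deform: "regularity_preserving_bodies (deform :: (real^'n) set \<times> real \<Rightarrow> _)"
  unfolding regularity_preserving_bodies_def
proof (intro ballI impI)
  fix K :: "(real^'n) set" and r t
  assume K: "K \<in> Kn" and r: "hypersurface_of_class r (frontier K)" and t: "t \<in> {0..1::real}"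
  show "hypersurface_of_class r (frontier (deform (K, t)))"
  proof (cases "t = 1")
    case True
    have "body_axis K \<noteq> 0" using axial_bodyD(5)[OF axial_body_centered_Kn[OF K]] by auto
    then have "frontier (deform (K, t)) = {x. body_axis K \<bullet> x = 0}"
      using True frontier_halfspace_ge[of "body_axis K" 0] by (simp add: deform_1)
    then show ?thesis using hypersurface_of_class_hyperplane[OF \<open>body_axis K \<noteq> 0\<close>] by simp
  next
    case False
    then have t1: "t < 1" using t by simp
    have "closed K" "closed (deform (K, t))" using Kn_convex_body K deform_in_Kn[OF K t] by auto
    note fr = frontier_proj_map_vimage[OF this[unfolded deform_eq_proj_map_vimage[OF t1]]]
    show ?thesis unfolding deform_eq_proj_map_vimage[OF t1] fr
      by (rule hypersurface_of_class_proj_map[OF r])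
  qed
qed

section \<open>Normal cones and total curvature along the deformation\<close>

lemma hausdorff_premeasure_mono:
  "A \<subseteq> B \<Longrightarrow> hausdorff_premeasure s \<delta> A \<le> hausdorff_premeasure s \<delta> B"
  unfolding hausdorff_premeasure_def by (rule INF_superset_mono) auto

lemma hausdorff_measure_mono: "A \<subseteq> B \<Longrightarrow> hausdorff_measure s A \<le> hausdorff_measure s B"
  unfolding hausdorff_measure_def by (intro SUP_mono) (use hausdorff_premeasure_mono in blast)

lemma hausdorff_dist_singleton_le:
  assumes "A \<noteq> {}" "bounded A" "\<And>a. a \<in> A \<Longrightarrow> dist a v \<le> r"
  shows "hausdorff_dist A {v} \<le> r"
proof -
  obtain a where a: "a \<in> A" using assms(1) by blast
  have "infdist v A \<le> dist v a" by (rule infdist_le[OF a])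
  also have "\<dots> \<le> r" unfolding dist_commute[of v a] by (rule assms(3)[OF a])
  finally have 1: "infdist v A \<le> r" .
  have 2: "infdist a {v} \<le> r" if "a \<in> A" for a using assms(3)[OF that] by simp
  have "hausdorff_dist A {v} \<le> r \<longleftrightarrow> (\<forall>a\<in>A. infdist a {v} \<le> r) \<and> (\<forall>b\<in>{v}. infdist b A \<le> r)"
    by (rule hausdorff_dist_le_iff[OF assms(1) _ assms(2)]) simp_all
  then show ?thesis using 1 2 by blast
qed

lemma hausdorff_dist_singleton_mono:
  assumes "A \<subseteq> B" "A \<noteq> {}" "bounded B"
  shows "hausdorff_dist A {v} \<le> hausdorff_dist B {v}"
proof (rule hausdorff_dist_singleton_le)
  show "bounded A" using assms bounded_subset by blast
  show "dist a v \<le> hausdorff_dist B {v}" if "a \<in> A" for a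
  proof -
    have "infdist a {v} \<le> hausdorff_dist B {v}"
      by (rule infdist_le_hausdorff_dist) (use assms that in auto)
    then show ?thesis by simp
  qed
qed (rule assms)

lemma unit_normal_cone_translation: "unit_normal_cone ((+) b ` K) = unit_normal_cone K"
proof -
  have sub: "unit_normal_cone K \<subseteq> unit_normal_cone ((+) b ` K)" for b and K :: "(real^'n) set"
  proof
    fix u assume "u \<in> unit_normal_cone K"
    then obtain c where "norm u = 1" "K \<inter> {x. u \<bullet> x = c} \<noteq> {}" "K \<subseteq> {x. u \<bullet> x \<le> c}"
      by (auto simp: unit_normal_cone_def)
    then show "u \<in> unit_normal_cone ((+) b ` K)"
      unfolding unit_normal_cone_def
      by (auto simp: inner_add_right intro!: exI[of _ "u \<bullet> b + c"])
  qed
  from sub[of K b] sub[of "(+) b ` K" "- b"] show ?thesis by (simp add: image_image)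
qed

lemma unit_normal_cone_halfspace:
  fixes e :: "real^'n"
  assumes e: "norm e = 1" shows "unit_normal_cone {x. 0 \<le> e \<bullet> x} = {- e}"
proof (intro equalityI subsetI)
  have ee: "e \<bullet> e = 1" using e by (simp add: norm_eq_1)
  fix u assume "u \<in> unit_normal_cone {x. 0 \<le> e \<bullet> x}"
  then obtain c where u: "norm u = 1" and le: "\<And>x. 0 \<le> e \<bullet> x \<Longrightarrow> u \<bullet> x \<le> c" by (auto simp: unit_normal_cone_def)
  have le0: "u \<bullet> w \<le> 0" if w: "0 \<le> e \<bullet> w" for w
  proof (rule ccontr)
    assume "\<not> ?thesis"
    then have p: "u \<bullet> w > 0" by simp
    have "u \<bullet> (((\<bar>c\<bar> + 1) / (u \<bullet> w)) *\<^sub>R w) \<le> c" using p w by (intro le) simp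
    then show False using p by simp
  qed
  have uu: "u \<bullet> u = 1" using u by (simp add: norm_eq_1)
  have "0 \<le> e \<bullet> (u - (u \<bullet> e) *\<^sub>R e)" by (simp add: inner_diff_right ee inner_commute)
  from le0[OF this] have 1: "1 \<le> (u \<bullet> e) * (u \<bullet> e)" by (simp add: inner_diff_right uu)
  have 2: "u \<bullet> e \<le> 0" by (rule le0) (simp add: ee)
  have "u \<bullet> e \<le> - 1"
  proof (rule ccontr)
    assume "\<not> ?thesis"
    then have "\<bar>u \<bullet> e\<bar> < 1" using 2 by simp
    then have "(u \<bullet> e)\<^sup>2 < 1" by (simp add: abs_square_less_1)
    then show False using 1 by (simp add: power2_eq_square)
  qed
  then have "(u + e) \<bullet> (u + e) \<le> 0" by (simp add: inner_add_left inner_add_right uu ee inner_commute)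
  then have "u + e = 0" using inner_gt_zero_iff[of "u + e"] by fastforce
  then show "u \<in> {- e}" by (simp add: eq_neg_iff_add_eq_0)
next
  fix u assume "u \<in> {- e}"
  then show "u \<in> unit_normal_cone {x. 0 \<le> e \<bullet> x}"
    using e by (auto intro!: unit_normal_coneI[of _ 0])
qed

lemma unit_normal_cone_deform:
  "unit_normal_cone (deform (K, t)) = unit_normal_cone (proj_flow (body_axis K) t (centered K))"
  by (simp add: deform_def unit_normal_cone_translation)

text \<open>By the semigroup law the body at time \<open>t < 1\<close> is a projective image, with
  parameter \<open>q\<close>, of the body at time \<open>s\<close>, which is again axial about
  \<open>e\<close>. At \<open>t = 1\<close> only \<open>- e\<close> remains, and it is a normal at
  every earlier time.\<close>

lemma unit_normal_cone_proj_flow_antimono: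
  assumes X: "axial_body e X" and st: "0 \<le> s" "s \<le> t" "t \<le> 1"
  shows "unit_normal_cone (proj_flow e t X) \<subseteq> unit_normal_cone (proj_flow e s X)"
proof (cases "s = t")
  case False
  then have s: "s < 1" using st by simp
  have Xs: "axial_body e (proj_flow e s X)" by (rule axial_body_proj_flow[OF X st(1) s])
  show ?thesis
  proof (cases "t = 1")
    case True
    then show ?thesis using unit_normal_cone_halfspace[OF axial_bodyD(5)[OF X]] axis_in_unit_normal_cone[OF Xs]
      by (simp add: proj_flow_def[of e 1])
  next
    case t: False
    define q where "q = t / (1 - t) - s / (1 - s)"
    have "s / (1 - s) \<le> t / (1 - t)" using t st by (intro frac_le) auto
    then have q: "q \<ge> 0" by (simp add: q_def)
    have "proj_image e q (proj_image e (s / (1 - s)) X) = proj_image e (s / (1 - s) + q) X"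
      by (rule proj_image_proj_image) (use s st q in auto)
    then have "proj_flow e t X = proj_image e q (proj_flow e s X)"
      using s t by (simp add: proj_flow_def q_def)
    then show ?thesis using unit_normal_cone_proj_image[OF Xs q] by simp
  qed
qed simp

lemma bounded_unit_normal_cone: "bounded (unit_normal_cone K)"
  by (rule boundedI[of _ 1]) (simp add: unit_normal_cone_def)

lemma antimono_total_curvature_deform:
  assumes "K \<in> Kn" shows "antimono_on {0..1} (\<lambda>t. total_curvature (deform (K, t)))"
  unfolding total_curvature_def unit_normal_cone_deform
  by (intro monotone_onI hausdorff_measure_mono unit_normal_cone_proj_flow_antimono axial_body_centered_Kn assms) auto

lemma normal_cone_shrinks_deform:
  fixes K :: "(real^'n) set"
  assumes K: "K \<in> Kn" shows "normal_cone_shrinks (\<lambda>t. deform (K, t))"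
  unfolding normal_cone_shrinks_def unit_normal_cone_deform
proof (intro exI[of _ "- body_axis K"] conjI)
  define e where "e = body_axis K"
  define X where "X = centered K"
  have X: "axial_body e X" unfolding e_def X_def by (rule axial_body_centered_Kn[OF K])
  have ne: "unit_normal_cone (proj_flow e t X) \<noteq> {}" if "t \<in> {0..1}" for t
  proof -
    have "unit_normal_cone (proj_flow e 1 X) \<subseteq> unit_normal_cone (proj_flow e t X)"
      using that by (intro unit_normal_cone_proj_flow_antimono X) auto
    then show ?thesis using unit_normal_cone_halfspace[OF axial_bodyD(5)[OF X]] by (auto simp: proj_flow_def)
  qed
  show "norm (- body_axis K) = 1" using axial_bodyD(5)[OF X] by (simp add: e_def)
  show "unit_normal_cone (proj_flow (body_axis K) 1 (centered K)) = {- body_axis K}"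
    using unit_normal_cone_halfspace[OF axial_bodyD(5)[OF X]] by (simp add: proj_flow_def e_def)
  show "antimono_on {0..1} (\<lambda>t. hausdorff_dist (unit_normal_cone (proj_flow (body_axis K) t (centered K))) {- body_axis K})"
    unfolding e_def[symmetric] X_def[symmetric]
    by (intro monotone_onI hausdorff_dist_singleton_mono unit_normal_cone_proj_flow_antimono X ne bounded_unit_normal_cone) auto
  obtain d where d: "d > 0" "cball 0 d \<subseteq> X" using axial_bodyD(3)[OF X] by (auto simp: mem_interior_cball)
  have ev: "\<forall>\<^sub>F t in at_left (1::real). 0 < t \<and> t < 1"
    using eventually_at_left_real[of 0 1] by (rule eventually_mono) auto
  have "((\<lambda>t. hausdorff_dist (unit_normal_cone (proj_flow e t X)) {- e}) \<longlongrightarrow> 0) (at_left 1)"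
  proof (rule tendsto_sandwich[OF _ _ tendsto_const])
    show "\<forall>\<^sub>F t in at_left 1. 0 \<le> hausdorff_dist (unit_normal_cone (proj_flow e t X)) {- e}"
      using ev by eventually_elim (intro hausdorff_dist_nonneg ne bounded_unit_normal_cone, auto)
    \<comment> \<open>The bound is \<open>2 / (s * d)\<close> at the projective parameter
      \<open>s = t / (1 - t)\<close>.\<close>
    show "\<forall>\<^sub>F t in at_left 1. hausdorff_dist (unit_normal_cone (proj_flow e t X)) {- e} \<le> 2 * (1 - t) / (t * d)"
      using ev
    proof eventually_elim
      case (elim t)
      then have s: "t / (1 - t) > 0" by simp
      show ?case
      proof (intro hausdorff_dist_singleton_le ne bounded_unit_normal_cone)
        fix v assume "v \<in> unit_normal_cone (proj_flow e t X)"
        then have "v \<in> unit_normal_cone (proj_image e (t / (1 - t)) X)" using elim by (simp add: proj_flow_def)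
        from unit_normal_cone_proj_image_dist[OF X s d this] show "dist v (- e) \<le> 2 * (1 - t) / (t * d)" by simp
      qed (use elim in auto)
    qed
    have "((\<lambda>t. 2 * (1 - t) / (t * d)) \<longlongrightarrow> 2 * (1 - 1) / (1 * d)) (at_left 1)"
      using d by (intro tendsto_intros) auto
    then show "((\<lambda>t. 2 * (1 - t) / (t * d)) \<longlongrightarrow> 0) (at_left 1)" by simp
  qed
  then show "((\<lambda>t. hausdorff_dist (unit_normal_cone (proj_flow (body_axis K) t (centered K))) {- body_axis K}) \<longlongrightarrow> 0) (at_left 1)"
    by (simp add: e_def X_def)
qed

section \<open>The induced deformation of hypersurfaces\<close>

definition deform_frontier :: "(real^'n) set \<times> real \<Rightarrow> (real^'n) set" where
  "deform_frontier = (\<lambda>(M, t). frontier (deform (SOME K. K \<in> Kn \<and> frontier K = M, t)))"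

text \<open>The chosen body can differ from \<open>K\<close> only by being the complementary
  half-space, and the shift was designed so that both move their boundary to
  \<open>u \<bullet> x = (1 - t) * c\<close>.\<close>

lemma deform_frontier_eq:
  fixes K :: "(real^'n) set"
  assumes K: "K \<in> Kn" and t: "t \<in> {0..1}"
  shows "deform_frontier (frontier K, t) = frontier (deform (K, t))"
proof -
  define J where "J = (SOME J. J \<in> Kn \<and> frontier J = frontier K)"
  have J: "J \<in> Kn" "frontier J = frontier K"
    using someI[of "\<lambda>J. J \<in> Kn \<and> frontier J = frontier K" K] K by (auto simp: J_def)
  have "J = K \<or> (\<exists>u c. norm u = 1 \<and> J = {x. c \<le> u \<bullet> x} \<and> K = {x. - c \<le> (- u) \<bullet> x})"
    using Kn_convex_body[OF J(1)] Kn_convex_body[OF K] J(2) by (intro frontier_eq_imp) blast+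
  then have "frontier (deform (J, t)) = frontier (deform (K, t))"
  proof (elim disjE exE conjE)
    fix u c assume u: "norm u = 1" and J: "J = {x. c \<le> u \<bullet> x}" and K: "K = {x. - c \<le> (- u) \<bullet> x}"
    have u0: "u \<noteq> 0" "norm (- u) = 1" using u by auto
    have "frontier (deform (J, t)) = {x. u \<bullet> x = (1 - t) * c}"
      unfolding J deform_halfspace[OF u t] by (rule frontier_halfspace_ge) (use u0 in simp)
    moreover have "frontier (deform (K, t)) = {x. (- u) \<bullet> x = (1 - t) * (- c)}"
      unfolding K deform_halfspace[OF u0(2) t] by (rule frontier_halfspace_ge) (use u0 in simp)
    ultimately show ?thesis by simp
  qed simp
  then show ?thesis by (simp add: deform_frontier_def J_def)
qed

text \<open>The product of the quotient map \<open>frontier\<close> with the identity of the locally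
  compact Hausdorff space [0,1] is again a quotient map. Continuity may therefore be tested on
  bodies, where the map becomes \<open>frontier \<circ> deform\<close>.\<close>

lemma continuous_deform_frontier:
  "continuous_map (prod_topology hypersurface_topology (top_of_set {0..1})) hypersurface_topology
     (deform_frontier :: (real^'n) set \<times> real \<Rightarrow> _)"
proof -
  have "locally_compact_space (top_of_set {0..1::real})"
    by (intro compact_imp_locally_compact_space) (simp add: compact_space_subtopology)
  moreover have "Hausdorff_space (top_of_set {0..1::real})" by (simp add: Hausdorff_space_subtopology)
  ultimately have q: "quotient_map (prod_topology asymptotic_topology (top_of_set {0..1::real}))
      (prod_topology hypersurface_topology (top_of_set {0..1})) (\<lambda>(K, t). (frontier (K :: (real^'n) set), t))"
    by (intro quotient_map_prod_left quotient_map_frontier) auto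
  have "continuous_map (prod_topology asymptotic_topology (top_of_set {0..1})) hypersurface_topology
      (frontier \<circ> (deform :: (real^'n) set \<times> real \<Rightarrow> _))"
    by (rule continuous_map_compose[OF continuous_deform quotient_imp_continuous_map[OF quotient_map_frontier]])
  then have "continuous_map (prod_topology asymptotic_topology (top_of_set {0..1})) hypersurface_topology
      ((deform_frontier :: (real^'n) set \<times> real \<Rightarrow> _) \<circ> (\<lambda>(K, t). (frontier K, t)))"
    by (rule continuous_map_eq) (auto simp: deform_frontier_eq)
  with q show ?thesis by (rule continuous_compose_quotient_map)
qed

theorem theorem1p1:
  shows "\<exists>(F :: (real^'n) set \<times> real \<Rightarrow> (real^'n) set) (G :: (real^'n) set \<times> real \<Rightarrow> (real^'n) set).
     strong_deformation_retraction asymptotic_topology Hn F \<and>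
     regularity_preserving_bodies F \<and>
     strong_deformation_retraction hypersurface_topology (frontier ` Hn) G \<and>
     regularity_preserving_hypersurfaces G \<and>
     (\<forall>K\<in>Kn. \<forall>t\<in>{0..1}. G (frontier K, t) = frontier (F (K, t))) \<and>
     (\<forall>K\<in>Kn. antimono_on {0..1} (\<lambda>t. total_curvature (F (K, t))) \<and>
              normal_cone_shrinks (\<lambda>t. F (K, t)))"
proof (intro exI conjI ballI)
  let ?F = "deform :: (real^'n) set \<times> real \<Rightarrow> _" and ?G = "deform_frontier :: (real^'n) set \<times> real \<Rightarrow> _"
  show F: "strong_deformation_retraction asymptotic_topology Hn ?F"
    by (rule strong_deformation_retraction_deform)
  show reg: "regularity_preserving_bodies ?F" by (rule regularity_preserving_deform)
  show G: "?G (frontier K, t) = frontier (?F (K, t))" if "K \<in> Kn" "t \<in> {0..1}" for K t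
    by (rule deform_frontier_eq[OF that])
  have HK: "(Hn :: (real^'n) set set) \<subseteq> Kn" and F01: "\<And>K. K \<in> Kn \<Longrightarrow> ?F (K, 0) = K \<and> ?F (K, 1) \<in> Hn"
    and FH: "\<And>H t. H \<in> Hn \<Longrightarrow> t \<in> {0..1} \<Longrightarrow> ?F (H, t) = H"
    using F by (auto simp: strong_deformation_retraction_def)
  show "strong_deformation_retraction hypersurface_topology (frontier ` Hn) ?G"
    unfolding strong_deformation_retraction_def topspace_hypersurface_topology
  proof (intro conjI ballI continuous_deform_frontier)
    show "frontier ` (Hn :: (real^'n) set set) \<subseteq> frontier ` Kn" using HK by blast
    fix M :: "(real^'n) set" assume "M \<in> frontier ` Kn"
    then obtain K where K: "K \<in> Kn" "M = frontier K" by blast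
    show "?G (M, 0) = M" "?G (M, 1) \<in> frontier ` Hn" using G[OF K(1)] F01[OF K(1)] by (auto simp: K(2))
  next
    fix M :: "(real^'n) set" and t :: real assume "M \<in> frontier ` Hn" and t: "t \<in> {0..1}"
    then obtain H where "H \<in> Hn" "M = frontier H" by blast
    then show "?G (M, t) = M" using G[of H t] FH[of H t] HK t by auto
  qed
  show "regularity_preserving_hypersurfaces ?G"
    using reg G unfolding regularity_preserving_hypersurfaces_def regularity_preserving_bodies_def by auto
  show "antimono_on {0..1} (\<lambda>t. total_curvature (?F (K, t)))" "normal_cone_shrinks (\<lambda>t. ?F (K, t))"
    if "K \<in> Kn" for K
    using antimono_total_curvature_deform normal_cone_shrinks_deform that by blast+
qed

end
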